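(* Let $U$, $\pi_s$ and $\varsigma_\ell$ be as in the context. For $s\in[0,1]$ and any $f_s\in L^2(\pi_s)$ with $\pi_sf_s=0$ there exists a non-negative measure $\nu_s$ on $([0,\infty),\mathcal B([0,\infty)))$ such that for every $\ell>0$ $$\varsigma_\ell(s)=\ell\int_0^\infty\frac{1+\exp(-\ell\lambda)}{1-\exp(-\ell\lambda)}\,\nu_s(\mathrm d\lambda),$$ and $$\varsigma_0(s)=2\int_0^\infty\lambda^{-1}\,\nu_s(\mathrm d\lambda).$$ Further, for any $s\in[0,1]$, $\ell\mapsto\varsigma_\ell(s)$ is a non-decreasing function on $[0,\infty)$.
   Context: For arrays $A(x)$, $\|A\|_p:=\sup_x\|A(x)\|_{\mathrm{H.S.}}/(1+\|x\|^{2p})$ (root of sum of squared entries in the numerator). $C_{1,2}^{p}([0,1]\times\mathbb R^d)$: functions $f_t(x)$ continuously differentiable in $t$ and twice continuously differentiable in $x$ with $\sup_t\|f_t\|_p,\sup_t\|\partial_tf_t\|_p,\sup_t\|\nabla f_t\|_p,\sup_t\|\nabla^{(2)}f_t\|_p<\infty$. Standing assumptions on $U:[0,1]\times\mathbb R^d\to\mathbb R^+$: (i) $U\in C_{1,2}^{p_0}([0,1]\times\mathbb R^d)$ for some $p_0\ge1$; (ii) for some $L<\infty$, $\sup_t\|\nabla U_t(x)-\nabla U_t(y)\|\le L\|x-y\|$ for all $x,y$; (iii) $\sup_t\|\nabla U_t(x)\|\le L(1+\|x\|)$ for all $x$; (iv) for some $K>0$, $\inf_{t,x}\sum_{i,j}v_i\frac{\partial^2U_t(x)}{\partial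 x_i\partial x_j}v_j\ge K\|v\|^2$ for all $v$; $x_t^\star$ denotes the unique minimizer of $U_t$ and $x_0^\star=0$; (v) for some $M<\infty$, $\|\nabla U_t(x)-\nabla U_s(x)\|\le M|t-s|\sqrt{1+\|x-x_{t\wedge s}^\star\|^2}$ for all $x,t,s$; (vi) the third-order $x$-derivatives of $U_t(x)$ exist, are continuous, and are bounded uniformly in $t,x$. $\pi_s(\mathrm dx)\propto e^{-U_s(x)}\mathrm dx$. For $s\in[0,1]$, $\epsilon>0$: $Y_t^{s,\epsilon}=Y_0^{s,\epsilon}-\epsilon^{-1}\int_0^t\nabla U_s(Y_u^{s,\epsilon})\mathrm du+\sqrt{2\epsilon^{-1}}B_t$, $t\ge0$, with $B$ a $d$-dimensional Brownian motion and $Y_0^{s,\epsilon}\sim\pi_s$ independent of $B$. Then (the limits exist and are finite) $\varsigma_0(s):=\lim_{\epsilon\to0}\mathrm{var}\big[\epsilon^{-1/2}\int_0^1f_s(Y_t^{s,\epsilon})\mathrm dt\big]$ and, for $\ell>0$ with $h=\ell\epsilon$ and $n=\lfloor1/h\rfloor$, $\varsigma_\ell(s):=\lim_{\epsilon\to0}\mathrm{var}\big[\epsilon^{-1/2}h\sum_{i=0}^{n-1}f_s(Y_{ih}^{s,\epsilon})\big]$. *)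

theory Defs
  imports "HOL-Probability.Probability"
begin

section \<open>Partial derivatives and weighted norms\<close>

definition pdiff :: "'d::finite \<Rightarrow> (real^'d \<Rightarrow> real) \<Rightarrow> real^'d \<Rightarrow> real" where
  "pdiff i f x = deriv (\<lambda>h. f (x + h *\<^sub>R axis i 1)) 0"

text \<open>All partial derivatives up to order \<open>k\<close> exist and are continuous.\<close>

primrec Ck :: "nat \<Rightarrow> (real^'d::finite \<Rightarrow> real) \<Rightarrow> bool" where
  "Ck 0 f \<longleftrightarrow> continuous_on UNIV f"
| "Ck (Suc k) f \<longleftrightarrow> continuous_on UNIV f \<and>
     (\<forall>i. (\<forall>x. (\<lambda>h. f (x + h *\<^sub>R axis i 1)) field_differentiable (at 0)) \<and> Ck k (pdiff i f))"

definition grad :: "(real^'d::finite \<Rightarrow> real) \<Rightarrow> real^'d \<Rightarrow> real^'d" where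
  "grad f x = (\<chi> i. pdiff i f x)"

definition hess :: "(real^'d::finite \<Rightarrow> real) \<Rightarrow> real^'d \<Rightarrow> real^'d^'d" where
  "hess f x = (\<chi> i j. pdiff i (pdiff j f) x)"

text \<open>The library norms on \<^typ>\<open>real\<close>, \<^typ>\<open>real^'d\<close> and \<^typ>\<open>real^'d^'d\<close> are all
  the root of the sum of the squared entries, i.e. the Hilbert-Schmidt norm.\<close>

definition wnorm :: "real \<Rightarrow> (real^'d::finite \<Rightarrow> 'b::real_normed_vector) \<Rightarrow> ennreal" where
  "wnorm p A = (SUP x. ennreal (norm (A x) / (1 + norm x powr (2 * p))))"

text \<open>One-sided at the end points of the time interval.\<close>

definition tdiff :: "(real \<Rightarrow> real^'d::finite \<Rightarrow> real) \<Rightarrow> real \<Rightarrow> real^'d \<Rightarrow> real" where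
  "tdiff f t x = vector_derivative (\<lambda>r. f r x) (at t within {0..1})"

definition C12 :: "real \<Rightarrow> (real \<Rightarrow> real^'d::finite \<Rightarrow> real) \<Rightarrow> bool" where
  "C12 p f \<longleftrightarrow>
     (\<forall>x. (\<lambda>t. f t x) differentiable_on {0..1} \<and> continuous_on {0..1} (\<lambda>t. tdiff f t x)) \<and>
     (\<forall>t\<in>{0..1}. Ck 2 (f t)) \<and>
     (SUP t\<in>{0..1}. wnorm p (f t)) < \<infinity> \<and>
     (SUP t\<in>{0..1}. wnorm p (tdiff f t)) < \<infinity> \<and>
     (SUP t\<in>{0..1}. wnorm p (grad (f t))) < \<infinity> \<and>
     (SUP t\<in>{0..1}. wnorm p (hess (f t))) < \<infinity>"


section \<open>Admissible potentials and their Gibbs measures\<close>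

text \<open>Under the strong convexity in \<open>admissible_potential\<close> the minimizer exists and is unique.\<close>

definition minimizer :: "(real^'d::finite \<Rightarrow> real) \<Rightarrow> real^'d" where
  "minimizer V = (THE x. is_arg_min V (\<lambda>_. True) x)"

text \<open>A potential is a total function of time; only its values for times in \<open>[0,1]\<close> matter.\<close>

definition admissible_potential :: "(real \<Rightarrow> real^'d::finite \<Rightarrow> real) \<Rightarrow> bool" where
  "admissible_potential U \<longleftrightarrow>
     (\<forall>t\<in>{0..1}. \<forall>x. 0 \<le> U t x) \<and>
     (\<exists>p\<^sub>0\<ge>1. C12 p\<^sub>0 U) \<and>
     (\<exists>L. (\<forall>x y. \<forall>t\<in>{0..1}. norm (grad (U t) x - grad (U t) y) \<le> L * norm (x - y)) \<and>
          (\<forall>x. \<forall>t\<in>{0..1}. norm (grad (U t) x) \<le> L * (1 + norm x))) \<and>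
     (\<exists>K>0. \<forall>v. \<forall>t\<in>{0..1}. \<forall>x.
          K * (norm v)\<^sup>2 \<le> (\<Sum>i\<in>UNIV. \<Sum>j\<in>UNIV. v $ i * pdiff i (pdiff j (U t)) x * v $ j)) \<and>
     minimizer (U 0) = 0 \<and>
     (\<exists>M. \<forall>x. \<forall>t\<in>{0..1}. \<forall>s\<in>{0..1}. norm (grad (U t) x - grad (U s) x)
          \<le> M * \<bar>t - s\<bar> * sqrt (1 + (norm (x - minimizer (U (min t s))))\<^sup>2)) \<and>
     (\<forall>t\<in>{0..1}. Ck 3 (U t)) \<and>
     (\<exists>C. \<forall>t\<in>{0..1}. \<forall>x i j k. \<bar>pdiff i (pdiff j (pdiff k (U t))) x\<bar> \<le> C)"

definition gibbs :: "(real^'d::finite \<Rightarrow> real) \<Rightarrow> (real^'d) measure" where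
  "gibbs V = density lborel (\<lambda>x. ennreal (exp (- V x) / (LINT y|lborel. exp (- V y))))"


section \<open>Stationary Langevin diffusions\<close>

definition brownian_motion ::
  "'w measure \<Rightarrow> (real \<Rightarrow> 'w \<Rightarrow> real^'d::finite) \<Rightarrow> bool" where
  "brownian_motion M B \<longleftrightarrow>
     prob_space M \<and>
     (\<forall>t\<ge>0. B t \<in> borel_measurable M) \<and>
     (AE \<omega> in M. B 0 \<omega> = 0) \<and>
     (AE \<omega> in M. continuous_on {0..} (\<lambda>t. B t \<omega>)) \<and>
     (\<forall>r t. 0 \<le> r \<and> r < t \<longrightarrow>
        distributed M lborel (\<lambda>\<omega>. B t \<omega> - B r \<omega>)
          (\<lambda>x. ennreal (\<Prod>i\<in>UNIV. normal_density 0 (sqrt (t - r)) (x $ i)))) \<and>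
     (\<forall>\<tau>::nat \<Rightarrow> real. 0 \<le> \<tau> 0 \<and> mono \<tau> \<longrightarrow>
        prob_space.indep_vars M (\<lambda>_. borel) (\<lambda>i \<omega>. B (\<tau> (Suc i)) \<omega> - B (\<tau> i) \<omega>) UNIV)"

text \<open>The equation is required almost surely, but the paths of \<open>Y\<close> are continuous on the
  whole of the sample space: \<open>M\<close> need not be complete, and this is what makes
  \<open>\<integral>\<^sub>0\<^sup>1 f(Y\<^sub>t) dt\<close> a random variable. The noise is additive, so no stochastic
  integral is involved.\<close>

definition stationary_langevin ::
  "'w measure \<Rightarrow> (real^'d::finite \<Rightarrow> real) \<Rightarrow> real \<Rightarrow>
   (real \<Rightarrow> 'w \<Rightarrow> real^'d) \<Rightarrow> (real \<Rightarrow> 'w \<Rightarrow> real^'d) \<Rightarrow> bool" where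
  "stationary_langevin M V \<epsilon> B Y \<longleftrightarrow>
     brownian_motion M B \<and>
     (\<forall>t\<ge>0. Y t \<in> borel_measurable M) \<and>
     (\<forall>\<omega>\<in>space M. continuous_on {0..} (\<lambda>t. Y t \<omega>)) \<and>
     distr M borel (Y 0) = gibbs V \<and>
     prob_space.indep_set M
       (sets (vimage_algebra (space M) (Y 0) borel))
       (sets (vimage_algebra (space M) (\<lambda>\<omega>. \<lambda>t\<in>{0..}. B t \<omega>) (Pi\<^sub>M {0..} (\<lambda>_. borel)))) \<and>
     (AE \<omega> in M. \<forall>t\<ge>0. Y t \<omega> =
        Y 0 \<omega> - (1 / \<epsilon>) *\<^sub>R (LINT u:{0..t}|lborel. grad V (Y u \<omega>)) + sqrt (2 / \<epsilon>) *\<^sub>R B t \<omega>)"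


section \<open>Asymptotic variances\<close>

text \<open>For \<open>l = 0\<close> the time average is continuous, for \<open>l > 0\<close> it is sampled with
  step \<open>h = l \<epsilon>\<close>.\<close>

definition scaled_average ::
  "(real \<Rightarrow> 'w \<Rightarrow> real^'d::finite) \<Rightarrow> (real^'d \<Rightarrow> real) \<Rightarrow> real \<Rightarrow> real \<Rightarrow> 'w \<Rightarrow> real" where
  "scaled_average Y f l \<epsilon> \<omega> =
     (if l = 0 then \<epsilon> powr (-1/2) * (LINT t:{0..1}|lborel. f (Y t \<omega>))
      else let h = l * \<epsilon>; n = nat \<lfloor>1 / h\<rfloor>
           in \<epsilon> powr (-1/2) * h * (\<Sum>i<n. f (Y (real i * h) \<omega>)))"

text \<open>The processes for different \<open>\<epsilon>\<close> may live on different probability spaces.\<close>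

definition scaled_variance ::
  "(real \<Rightarrow> 'w measure) \<Rightarrow> (real \<Rightarrow> real \<Rightarrow> 'w \<Rightarrow> real^'d::finite) \<Rightarrow>
   (real^'d \<Rightarrow> real) \<Rightarrow> real \<Rightarrow> real \<Rightarrow> real" where
  "scaled_variance M Y f l \<epsilon> = prob_space.variance (M \<epsilon>) (scaled_average (Y \<epsilon>) f l \<epsilon>)"

definition asymptotic_variance ::
  "(real \<Rightarrow> 'w measure) \<Rightarrow> (real \<Rightarrow> real \<Rightarrow> 'w \<Rightarrow> real^'d::finite) \<Rightarrow>
   (real^'d \<Rightarrow> real) \<Rightarrow> real \<Rightarrow> real" where
  "asymptotic_variance M Y f l = Lim (at_right 0) (scaled_variance M Y f l)"

end

theory Submission
  imports Defs
begin

text \<open>The Euler scheme with step \<open>h\<close> is reversible with respect to the Gibbs measure up to an error of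
  order \<open>h\<close> to the power \<open>3/2\<close> per step: the logarithm of the ratio in the detailed balance equation is
  the remainder of a trapezoidal rule for \<open>V y - V x\<close> plus \<open>h / 4\<close> times a difference of squared
  gradient norms. Over the \<open>O(1 / h)\<close> steps of a bounded time interval this error vanishes in the limit,
  while the scheme driven by the increments of \<open>B\<close> converges pathwise to \<open>Y\<close>. Hence \<open>Y\<close> is stationary,
  the covariance \<open>\<rho> t\<close> of \<open>f Y\<close> at lag \<open>\<epsilon> t\<close> depends on \<open>t\<close> only, and every quadratic form with
  coefficients \<open>\<rho> (t\<^sub>i + t\<^sub>j)\<close> is nonnegative, being a limit of squared norms. A bounded function
  with this property is completely monotone, so \<open>\<rho>\<close> is the Laplace transform of a finite measure \<open>\<nu>\<close>.

  Two Euler schemes driven by the same noise approach each other at rate \<open>K / 2\<close>, so \<open>\<rho>\<close> decays at that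
  rate for Lipschitz \<open>f\<close>. Log-convexity turns this into \<open>\<rho> t \<le> \<rho> 0 * exp (- K t / 2)\<close>, a bound
  that passes to all square integrable \<open>f\<close> and makes the variances converge to \<open>l\<close> times the sum of
  \<open>\<rho> (k l)\<close> over all integers \<open>k\<close>, with \<open>\<rho>\<close> extended evenly, respectively to \<open>2\<close> times the integral
  of \<open>\<rho>\<close>. Inserting \<open>\<nu>\<close> leaves geometric series, and monotonicity in \<open>l\<close> is that of \<open>u coth u\<close>.\<close>

section \<open>Positive definite functions and Laplace transforms\<close>

text \<open>The measure is the spectral measure of \<open>f\<close> for the generator of the
  diffusion. As \<open>Y\<close> is given only through its equation, symmetry, invariance and
  contraction are read off from the Euler kernel, the object with an explicit transition density.
  The power 3/2 arises because one step has length of order sqrt h: the trapezoidal remainder is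
  cubic in that length, and a difference of squared gradient norms across a step is of order sqrt h
  before its factor h. The number of steps times h^(3/2) is then of order sqrt h. The bound on the
  third derivatives enters here. Contraction alone bounds the covariance by a constant containing
  the Lipschitz constant of the observable, which is lost in an L2 limit. Log-convexity and
  boundedness replace that constant by the value at lag 0, which is continuous in L2. The same
  principle, applied to shifted quadratic forms, gives complete monotonicity. Only the positivity of
  the rate \<open>K / 2\<close> matters. Measuring time in units of \<open>\<epsilon>\<close> makes
  one \<open>\<rho>\<close> serve all \<open>\<epsilon>\<close>.\<close>

definition psd_function :: "(real \<Rightarrow> real) \<Rightarrow> bool" where
  "psd_function C \<longleftrightarrow> (\<forall>(n::nat) a t. (\<forall>i<n. 0 \<le> t i) \<longrightarrow>
     0 \<le> (\<Sum>i<n. \<Sum>j<n. a i * a j * C (t i + t j)))"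

lemma sum_lessThan_add:
  fixes f :: "nat \<Rightarrow> 'a::comm_monoid_add"
  shows "(\<Sum>i<n + m. f i) = (\<Sum>i<n. f i) + (\<Sum>i<m. f (n + i))"
  by (induction m) (auto simp: add.assoc)

lemma psd_nonneg: "psd_function C \<Longrightarrow> 0 \<le> t \<Longrightarrow> 0 \<le> C t"
  unfolding psd_function_def
  by (drule spec[of _ 1], drule spec[of _ "\<lambda>_. 1"], drule spec[of _ "\<lambda>_. t / 2"]) simp

text \<open>The discriminant inequality, in a form without division so that a form degenerate in one
  variable is covered.\<close>

lemma binary_form_nonneg_imp:
  fixes a b c :: real
  assumes "\<And>x y. 0 \<le> a * x\<^sup>2 + 2 * b * x * y + c * y\<^sup>2"
  shows "b\<^sup>2 \<le> a * c"
proof (cases "a = 0")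
  case True
  have "b = 0"
  proof (rule ccontr)
    assume b: "b \<noteq> 0"
    \<comment> \<open>For \<open>a = 0\<close> and y = 1 the form is affine in x, and this x makes
      its value -1.\<close>
    have "0 \<le> 2 * b * (-(c+1)/(2*b)) + c"
      using assms[of "-(c+1)/(2*b)" 1] True by (simp del: divide_minus_left)
    with b show False by simp
  qed
  then show ?thesis using True by simp
next
  case False
  have "0 \<le> a" using assms[of 1 0] by simp
  with False have a: "0 < a" by simp
  have "0 \<le> a * (a * c - b\<^sup>2)"
    using assms[of "-b" a] by (simp add: algebra_simps power2_eq_square)
  with a show ?thesis by (simp add: zero_le_mult_iff)
qed

text \<open>If \<open>F t\<close> exceeded \<open>F 0\<close> by a factor r > 1, each doubling of
  the argument would at least square that factor, and \<open>F\<close> would outgrow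
  \<open>B\<close>.\<close>

lemma log_convex_bounded_le:
  fixes F :: "real \<Rightarrow> real"
  assumes nn: "\<And>t. 0 \<le> t \<Longrightarrow> 0 \<le> F t" and bd: "\<And>t. 0 \<le> t \<Longrightarrow> F t \<le> B"
    and lc: "\<And>t. 0 \<le> t \<Longrightarrow> (F t)\<^sup>2 \<le> F 0 * F (2 * t)" and t: "0 \<le> t"
  shows "F t \<le> F 0"
proof (cases "F 0 = 0")
  case True
  then show ?thesis using lc[OF t] by simp
next
  case False
  with nn[of 0] have F0: "0 < F 0" by simp
  show ?thesis
  proof (rule ccontr)
    assume "\<not> F t \<le> F 0"
    define r where "r = F t / F 0"
    have r: "1 < r" using F0 \<open>\<not> F t \<le> F 0\<close> by (simp add: r_def)
    have grow: "r ^ (2 ^ n) * F 0 \<le> F (2 ^ n * t)" for n :: nat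
    proof (induction n)
      case 0
      then show ?case using F0 by (simp add: r_def)
    next
      case (Suc n)
      have "(r ^ (2 ^ n) * F 0)\<^sup>2 \<le> (F (2 ^ n * t))\<^sup>2"
        using Suc r F0 by (intro power_mono) auto
      also have "\<dots> \<le> F 0 * F (2 * (2 ^ n * t))" using t by (intro lc) auto
      also have "(r ^ (2 ^ n) * F 0)\<^sup>2 = F 0 * (r ^ (2 ^ Suc n) * F 0)"
        by (simp add: power_even_eq power_mult_distrib power2_eq_square)
      finally have "F 0 * (r ^ (2 ^ Suc n) * F 0) \<le> F 0 * F (2 ^ Suc n * t)"
        by (simp add: mult.assoc)
      then show ?case using F0 by simp
    qed
    obtain n :: nat where n: "B / F 0 < r ^ n" using real_arch_pow[OF r] by blast
    have "B < r ^ n * F 0" using n F0 by (simp add: field_simps)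
    also have "\<dots> \<le> r ^ (2 ^ n) * F 0"
      using r F0 by (intro mult_right_mono power_increasing) (auto intro: less_imp_le[OF less_exp])
    also have "\<dots> \<le> B" using grow[of n] bd[of "2 ^ n * t"] t by simp
    finally show False by simp
  qed
qed

context
  fixes C :: "real \<Rightarrow> real"
  assumes psd: "psd_function C"
begin

text \<open>Positivity for the 2n points \<open>t i + u\<close> and \<open>t i + v\<close>, weighted
  by \<open>x * a i\<close> and \<open>y * a i\<close>, is a nonnegative binary form in x and y;
  this is its discriminant inequality. Having it for the whole form \<open>F\<close>, not only for
  \<open>C\<close>, is what later makes differences of \<open>C\<close> positive definite.\<close>

lemma psd_shift_cauchy_schwarz:
  fixes a t :: "nat \<Rightarrow> real"
  assumes t: "\<And>i. i < n \<Longrightarrow> 0 \<le> t i" and u: "0 \<le> u" and v: "0 \<le> v"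
  defines "F \<equiv> \<lambda>u. \<Sum>i<n. \<Sum>j<n. a i * a j * C (t i + t j + u)"
  shows "(F (u + v))\<^sup>2 \<le> F (2 * u) * F (2 * v)"
proof (rule binary_form_nonneg_imp)
  fix x y :: real
  define a' where "a' k = (if k < n then x * a k else y * a (k - n))" for k
  define t' where "t' k = (if k < n then t k + u else t (k - n) + v)" for k
  have "0 \<le> (\<Sum>i<n + n. \<Sum>j<n + n. a' i * a' j * C (t' i + t' j))"
    using psd t u v unfolding psd_function_def by (auto simp: t'_def)
  also have "\<dots> = (\<Sum>i<n. \<Sum>j<n. x * a i * (x * a j) * C (t i + u + (t j + u)))
      + (\<Sum>i<n. \<Sum>j<n. x * a i * (y * a j) * C (t i + u + (t j + v)))
      + (\<Sum>i<n. \<Sum>j<n. y * a i * (x * a j) * C (t i + v + (t j + u)))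
      + (\<Sum>i<n. \<Sum>j<n. y * a i * (y * a j) * C (t i + v + (t j + v)))"
    by (simp add: sum_lessThan_add a'_def t'_def sum.distrib)
  also have "\<dots> = F (2 * u) * x\<^sup>2 + 2 * F (u + v) * x * y + F (2 * v) * y\<^sup>2"
    unfolding F_def sum_distrib_left sum_distrib_right sum.distrib[symmetric]
    by (intro sum.cong refl) (simp add: algebra_simps power2_eq_square)
  finally show "0 \<le> F (2 * u) * x\<^sup>2 + 2 * F (u + v) * x * y + F (2 * v) * y\<^sup>2" .
qed

lemma psd_midpoint: "0 \<le> t \<Longrightarrow> (C t)\<^sup>2 \<le> C 0 * C (2 * t)"
  using psd_shift_cauchy_schwarz[where n = 1 and t = "\<lambda>_. 0" and a = "\<lambda>_. 1" and u = 0 and v = t] by simp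

text \<open>Multiplication by \<open>exp (k * t)\<close> preserves log-convexity, since exponentials
  are the case of equality. The product is bounded by \<open>A\<close>, hence by its own value at 0:
  the constant \<open>A\<close>, however large, is exchanged for \<open>C 0\<close>.\<close>

lemma psd_exp_decay:
  assumes "\<And>t. 0 \<le> t \<Longrightarrow> C t \<le> A * exp (- k * t)" and "0 \<le> t"
  shows "C t \<le> C 0 * exp (- k * t)"
proof -
  have "C t * exp (k * t) \<le> C 0 * exp (k * 0)"
  proof (rule log_convex_bounded_le[where F = "\<lambda>t. C t * exp (k * t)" and B = A])
    fix t :: real assume t: "0 \<le> t"
    show "0 \<le> C t * exp (k * t)" using psd_nonneg[OF psd t] by simp
    have "C t * exp (k * t) \<le> A * exp (- k * t) * exp (k * t)"
      using assms(1)[OF t] by (intro mult_right_mono) auto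
    then show "C t * exp (k * t) \<le> A" by (simp add: exp_minus mult.assoc)
    show "(C t * exp (k * t))\<^sup>2 \<le> C 0 * exp (k * 0) * (C (2 * t) * exp (k * (2 * t)))"
    proof -
      have "exp (k * (2 * t)) = (exp (k * t))\<^sup>2" by (metis exp_double mult.left_commute)
      then show ?thesis
        using mult_right_mono[OF psd_midpoint[OF t], of "(exp (k * t))\<^sup>2"]
        by (simp add: power_mult_distrib mult.assoc)
    qed
  qed (use assms in auto)
  then show ?thesis by (simp add: exp_minus field_simps)
qed

end

section \<open>Complete monotonicity and the Hausdorff moment formula\<close>

text \<open>The sign is opposite to that of the usual forward difference, so that all iterates are
  nonnegative for a completely monotone function.\<close>

definition forward_drop :: "real \<Rightarrow> (real \<Rightarrow> real) \<Rightarrow> real \<Rightarrow> real" where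
  "forward_drop d C t = C t - C (t + d)"

text \<open>For fixed points and weights, the form shifted by u is a nonnegative, bounded function
  of u with the log-convexity of \<open>log_convex_bounded_le\<close>, so it is largest at u = 0.
  Its drop from 0 to \<open>d\<close> is the quadratic form of
  \<open>forward_drop d C\<close>.\<close>

lemma psd_forward_drop:
  assumes psd: "psd_function C" and bd: "\<And>t. 0 \<le> t \<Longrightarrow> \<bar>C t\<bar> \<le> B" and d: "0 \<le> d"
  shows "psd_function (forward_drop d C)"
  unfolding psd_function_def
proof (intro allI impI)
  fix n :: nat and a t :: "nat \<Rightarrow> real" assume "\<forall>i<n. 0 \<le> t i"
  then have t: "\<And>i. i < n \<Longrightarrow> 0 \<le> t i" by auto
  define F where "F u = (\<Sum>i<n. \<Sum>j<n. a i * a j * C (t i + t j + u))" for u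
  have "F d \<le> F 0"
  proof (rule log_convex_bounded_le[where F = F])
    fix u :: real assume u: "0 \<le> u"
    have "0 \<le> (\<Sum>i<n. \<Sum>j<n. a i * a j * C ((t i + u / 2) + (t j + u / 2)))"
      using psd[unfolded psd_function_def, rule_format, of n "\<lambda>i. t i + u / 2" a] t u by auto
    moreover have "(t i + u / 2) + (t j + u / 2) = t i + t j + u" for i j by simp
    ultimately show "0 \<le> F u" by (simp add: F_def)
    show "F u \<le> (\<Sum>i<n. \<Sum>j<n. \<bar>a i * a j\<bar> * B)" unfolding F_def
    proof (intro sum_mono)
      fix i j assume "i \<in> {..<n}" "j \<in> {..<n}"
      then have "\<bar>C (t i + t j + u)\<bar> \<le> B" using t u by (intro bd add_nonneg_nonneg) auto
      then have "\<bar>a i * a j\<bar> * \<bar>C (t i + t j + u)\<bar> \<le> \<bar>a i * a j\<bar> * B"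
        by (rule mult_left_mono) simp
      then show "a i * a j * C (t i + t j + u) \<le> \<bar>a i * a j\<bar> * B"
        by (metis abs_ge_self abs_mult order_trans)
    qed
    show "(F u)\<^sup>2 \<le> F 0 * F (2 * u)"
      using psd_shift_cauchy_schwarz[OF psd t, where u = 0 and v = u and a = a] u by (simp add: F_def)
  qed fact
  then show "0 \<le> (\<Sum>i<n. \<Sum>j<n. a i * a j * forward_drop d C (t i + t j))"
    by (simp add: F_def forward_drop_def right_diff_distrib sum_subtractf)
qed

lemma iterated_forward_drop_nonneg:
  assumes "psd_function C" and "\<And>t. 0 \<le> t \<Longrightarrow> \<bar>C t\<bar> \<le> B" and "0 \<le> d" "0 \<le> t"
  shows "0 \<le> (forward_drop d ^^ k) C t"
proof -
  \<comment> \<open>The growing bound makes \<open>psd_forward_drop\<close> applicable again at the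
    next stage.\<close>
  have "psd_function ((forward_drop d ^^ k) C) \<and> (\<forall>t\<ge>0. \<bar>(forward_drop d ^^ k) C t\<bar> \<le> 2 ^ k * B)"
  proof (induction k)
    case 0
    then show ?case using assms by simp
  next
    case (Suc k)
    let ?D = "(forward_drop d ^^ k) C"
    have "\<bar>forward_drop d ?D t\<bar> \<le> 2 ^ Suc k * B" if "0 \<le> t" for t
    proof -
      have "\<bar>?D t - ?D (t + d)\<bar> \<le> \<bar>?D t\<bar> + \<bar>?D (t + d)\<bar>" by simp
      also have "\<dots> \<le> 2 ^ k * B + 2 ^ k * B" using Suc that assms(3) by (intro add_mono) auto
      finally show ?thesis by (simp add: forward_drop_def mult_ac)
    qed
    then show ?case using psd_forward_drop[of ?D, OF _ _ assms(3)] Suc by auto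
  qed
  then show ?thesis using psd_nonneg assms(4) by blast
qed

text \<open>With S the shift by \<open>d\<close> and D = 1 - S, this is the binomial expansion of (D
  + S)^N = 1. For s = 0, after division by \<open>C 0\<close>, it says that the Hausdorff weights
  have total mass 1.\<close>

lemma sum_binomial_forward_drop:
  "(\<Sum>k\<le>N. real (N choose k) * (forward_drop d ^^ (N - k)) C (s + real k * d)) = C s"
proof (induction N arbitrary: s)
  case (Suc N)
  let ?D = "\<lambda>m. (forward_drop d ^^ m) C"
  have *: "?D (Suc m) u + ?D m (u + d) = ?D m u" for m u
    by (simp add: forward_drop_def)
  have "(\<Sum>k\<le>Suc N. real (Suc N choose k) * ?D (Suc N - k) (s + real k * d))
     = ?D (Suc N) s + (\<Sum>k\<le>N. real (Suc N choose Suc k) * ?D (N - k) (s + real (Suc k) * d))"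
    by (subst sum.atMost_Suc_shift) (simp add: del: binomial_Suc_Suc)
  also have "(\<Sum>k\<le>N. real (Suc N choose Suc k) * ?D (N - k) (s + real (Suc k) * d))
     = (\<Sum>k\<le>N. real (N choose k) * ?D (N - k) (s + real k * d + d))
       + (\<Sum>k\<le>N. real (N choose Suc k) * ?D (N - k) (s + real (Suc k) * d))"
    by (simp add: sum.distrib[symmetric] algebra_simps)
  also have "(\<Sum>k\<le>N. real (N choose Suc k) * ?D (N - k) (s + real (Suc k) * d))
     = (\<Sum>k\<le>N. real (N choose k) * ?D (Suc N - k) (s + real k * d)) - ?D (Suc N) s"
  proof -
    have "(\<Sum>k\<le>Suc N. real (N choose k) * ?D (Suc N - k) (s + real k * d))
        = ?D (Suc N) s + (\<Sum>k\<le>N. real (N choose Suc k) * ?D (N - k) (s + real (Suc k) * d))"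
      by (subst sum.atMost_Suc_shift) simp
    then show ?thesis by (simp add: binomial_eq_0)
  qed
  also have "?D (Suc N) s + ((\<Sum>k\<le>N. real (N choose k) * ?D (N - k) (s + real k * d + d))
       + ((\<Sum>k\<le>N. real (N choose k) * ?D (Suc N - k) (s + real k * d)) - ?D (Suc N) s))
     = (\<Sum>k\<le>N. real (N choose k) * ?D (N - k) (s + real k * d))"
  proof -
    have "(\<Sum>k\<le>N. real (N choose k) * ?D (N - k) (s + real k * d))
      = (\<Sum>k\<le>N. real (N choose k) * (?D (Suc (N - k)) (s + real k * d) + ?D (N - k) (s + real k * d + d)))"
      by (simp only: *)
    also have "\<dots> = (\<Sum>k\<le>N. real (N choose k) * (?D (Suc N - k) (s + real k * d) + ?D (N - k) (s + real k * d + d)))"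
      by (intro sum.cong refl) (simp add: Suc_diff_le)
    finally show ?thesis by (simp add: distrib_left sum.distrib)
  qed
  finally show ?case using Suc by simp
qed simp

text \<open>The binomial moments of the Hausdorff weights are exact. The product of
  \<open>N choose k\<close> and \<open>k choose n\<close> equals that of \<open>N choose n\<close>
  and \<open>(N - n) choose (k - n)\<close>, which leaves the preceding identity started at
  \<open>n * d\<close> with \<open>N - n\<close> in place of \<open>N\<close>.\<close>

lemma sum_choose_binomial_forward_drop:
  assumes "n \<le> N"
  shows "(\<Sum>k\<le>N. real (k choose n) * (real (N choose k) * (forward_drop d ^^ (N - k)) C (real k * d)))
    = real (N choose n) * C (real n * d)"
proof -
  let ?D = "\<lambda>m. (forward_drop d ^^ m) C"
  have "(\<Sum>k\<le>N. real (k choose n) * (real (N choose k) * ?D (N - k) (real k * d)))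
    = (\<Sum>k\<in>{n..N}. real (k choose n) * (real (N choose k) * ?D (N - k) (real k * d)))"
    by (rule sum.mono_neutral_right) (auto simp: binomial_eq_0)
  also have "\<dots> = (\<Sum>k\<in>{n..N}. real (N choose n) * (real ((N - n) choose (k - n)) * ?D (N - k) (real k * d)))"
  proof (intro sum.cong refl)
    fix k assume "k \<in> {n..N}"
    then have "(N choose k) * (k choose n) = (N choose n) * ((N - n) choose (k - n))"
      by (intro choose_mult) auto
    then have "real (N choose k) * real (k choose n) = real (N choose n) * real ((N - n) choose (k - n))"
      by (metis of_nat_mult)
    then show "real (k choose n) * (real (N choose k) * ?D (N - k) (real k * d))
       = real (N choose n) * (real ((N - n) choose (k - n)) * ?D (N - k) (real k * d))"
      by (metis mult.assoc mult.commute)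
  qed
  also have "\<dots> = (\<Sum>k\<le>N - n. real (N choose n) * (real ((N - n) choose k) * ?D (N - n - k) (real n * d + real k * d)))"
    using assms
    by (intro sum.reindex_bij_witness[where i = "\<lambda>k. k + n" and j = "\<lambda>k. k - n"])
       (auto simp: algebra_simps of_nat_diff)
  also have "\<dots> = real (N choose n) * C (real n * d)"
    unfolding sum_distrib_left[symmetric] by (simp only: sum_binomial_forward_drop)
  finally show ?thesis .
qed

text \<open>Turns binomial moments into power moments. The quotient is the product of the factors (k
  - i) / (N - i) for i < n, each within n / N of k / N. All factors lie in [0, 1], so the n errors
  add up.\<close>

lemma choose_ratio_approx:
  assumes "k \<le> N" "n \<le> N" "0 < N"
  shows "\<bar>real (k choose n) / real (N choose n) - (real k / real N) ^ n\<bar> \<le> (real n)\<^sup>2 / real N"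
proof -
  have choose: "real (m choose n) = (\<Prod>i<n. real (m - i) / real (n - i))" for m
  proof (cases "n \<le> m")
    case True
    then show ?thesis by (simp add: binomial_altdef_of_nat atLeast0LessThan)
  next
    case False
    \<comment> \<open>For n > m the factor with index m vanishes, in agreement with the binomial
      coefficient.\<close>
    then have "\<exists>i<n. m - i = 0" by (intro exI[of _ m]) auto
    then have "(\<Prod>i<n. real (m - i) / real (n - i)) = 0" by (intro prod_zero) auto
    with False show ?thesis by (simp add: binomial_eq_0)
  qed
  have "real (k choose n) / real (N choose n) = (\<Prod>i<n. real (k - i) / real (N - i))"
    unfolding choose prod_dividef[symmetric] by (intro prod.cong) auto
  moreover have "(real k / real N) ^ n = (\<Prod>i<n. real k / real N)" by simp
  moreover have "real (k - i) / real (N - i) \<le> 1" "real k / real N \<le> 1" for i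
    using assms by (auto simp: divide_le_eq_1)
  ultimately have "\<bar>real (k choose n) / real (N choose n) - (real k / real N) ^ n\<bar>
     \<le> (\<Sum>i<n. \<bar>real (k - i) / real (N - i) - real k / real N\<bar>)"
    using norm_prod_diff[of "{..<n}" "\<lambda>i. real (k - i) / real (N - i)" "\<lambda>_. real k / real N"]
    by simp
  also have "\<dots> \<le> (\<Sum>i<n. real n / real N)"
  proof (intro sum_mono)
    fix i assume i: "i \<in> {..<n}"
    show "\<bar>real (k - i) / real (N - i) - real k / real N\<bar> \<le> real n / real N"
    proof (cases "i \<le> k")
      case True
      have N: "0 < real N" "0 < real N - real i" using assms i by auto
      have "real k / real N - (real k - real i) / (real N - real i)
        = real i * (real N - real k) / (real N * (real N - real i))"
        using N by (simp add: field_simps)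
      moreover have "real i * (real N - real k) / (real N * (real N - real i)) \<le> real i / real N"
        using N assms True by (simp add: field_simps mult_left_mono)
      moreover have "0 \<le> real i * (real N - real k) / (real N * (real N - real i))"
        using N assms by simp
      moreover have "real i / real N \<le> real n / real N" using i N by (intro divide_right_mono) auto
      moreover have "real (k - i) = real k - real i" "real (N - i) = real N - real i"
        using True assms i by (auto simp: of_nat_diff)
      ultimately show ?thesis by (simp add: abs_le_iff)
    next
      \<comment> \<open>Here truncated subtraction makes the first quotient 0, and k < i < n bounds
        the second.\<close>
      case False
      then show ?thesis using i assms by (simp add: divide_right_mono)
    qed
  qed
  also have "\<dots> = (real n)\<^sup>2 / real N" by (simp add: power2_eq_square)
  finally show ?thesis .
qed

section \<open>From moments on the unit interval to a Laplace transform\<close>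

text \<open>The clamp makes \<open>y powr t\<close> bounded and, for t > 0, continuous on the whole
  line, as weak convergence of real distributions demands. Since \<open>0 powr 0\<close> is 0, the
  exponent 0 gives the indicator of the positive reals, not the constant 1.\<close>

definition unit_powr :: "real \<Rightarrow> real \<Rightarrow> real" where
  "unit_powr t y = max 0 (min 1 y) powr t"

lemma unit_powr_bounds: "0 \<le> unit_powr t y" "0 \<le> t \<Longrightarrow> unit_powr t y \<le> 1"
  unfolding unit_powr_def by (auto intro!: powr_le1)

lemma isCont_unit_powr: "0 < t \<Longrightarrow> isCont (unit_powr t) y"
  unfolding unit_powr_def isCont_def
  by (rule tendsto_powr') (auto intro!: tendsto_intros always_eventually)

lemma borel_measurable_unit_powr [measurable]: "unit_powr t \<in> borel_measurable borel"
  unfolding unit_powr_def by measurable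

text \<open>Hausdorff's approximants for the step \<open>1 / 2 ^ j\<close>: the iterated differences of \<open>C\<close> are the
  weights of a discrete measure. Choosing the number \<open>8 ^ j\<close> of nodes of larger order than the
  square of the relevant exponents \<open>t * 2 ^ j\<close> makes its moments converge to \<open>C t\<close>.\<close>

lemma approximating_measures:
  assumes psd: "psd_function C" and bd: "\<And>t. 0 \<le> t \<Longrightarrow> \<bar>C t\<bar> \<le> B" and C0: "0 < C 0"
  shows "\<exists>\<rho>::real measure. real_distribution \<rho> \<and> measure \<rho> {0..1} = 1 \<and>
    (\<forall>n. 0 < n \<and> n \<le> 8 ^ j \<longrightarrow>
      \<bar>(LINT y|\<rho>. unit_powr (real n / 2 ^ j) y) - C (real n / 2 ^ j) / C 0\<bar> \<le> (real n)\<^sup>2 / 8 ^ j)"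
proof -
  define N :: nat where "N = 8 ^ j"
  define d :: real where "d = 1 / 2 ^ j"
  define w where "w k = real (N choose k) * (forward_drop d ^^ (N - k)) C (real k * d) / C 0" for k
  define P where "P = point_measure {..N} (\<lambda>k. ennreal (w k))"
  \<comment> \<open>With the nodes at this power of k / N, the moment of order n / 2^j is the n-th
    power moment of k / N.\<close>
  define X where "X k = (real k / real N) powr (2 ^ j)" for k
  define \<rho> where "\<rho> = distr P borel X"
  have N: "0 < N" and d: "0 < d" by (auto simp: N_def d_def)
  have w: "0 \<le> w k" for k
    unfolding w_def using iterated_forward_drop_nonneg[OF psd bd, of d "real k * d"] C0 d by simp
  have sum_w: "(\<Sum>k\<le>N. w k) = 1"
    using sum_binomial_forward_drop[of N d C 0] C0 by (simp add: w_def sum_divide_distrib[symmetric])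
  have space_P: "space P = {..N}" by (simp add: P_def space_point_measure)
  interpret P: prob_space P
    by standard (simp add: space_P, simp add: P_def emeasure_point_measure_finite w sum_ennreal sum_w)
  have X_meas [measurable]: "X \<in> borel_measurable P" by (simp add: P_def)
  have X01: "0 \<le> X k" "k \<le> N \<Longrightarrow> X k \<le> 1" for k
    using N by (auto simp: X_def intro!: powr_le1)
  interpret \<rho>: prob_space \<rho> unfolding \<rho>_def by (rule P.prob_space_distr) simp
  have "real_distribution \<rho>" by standard (auto simp: \<rho>_def)
  moreover have "measure \<rho> {0..1} = 1"
  proof -
    have "X -` {0..1} \<inter> space P = space P" using X01 space_P by auto
    then show ?thesis unfolding \<rho>_def by (subst measure_distr) (auto simp: P.prob_space)
  qed
  moreover have "\<bar>(LINT y|\<rho>. unit_powr (real n / 2 ^ j) y) - C (real n / 2 ^ j) / C 0\<bar> \<le> (real n)\<^sup>2 / 8 ^ j"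
    if n: "0 < n" "n \<le> 8 ^ j" for n
  proof -
    have "(LINT y|\<rho>. unit_powr (real n / 2 ^ j) y) = (LINT k|P. unit_powr (real n / 2 ^ j) (X k))"
      unfolding \<rho>_def by (rule integral_distr) auto
    also have "\<dots> = (\<Sum>k\<le>N. w k * unit_powr (real n / 2 ^ j) (X k))"
      by (simp add: P_def lebesgue_integral_point_measure_finite w)
    also have "\<dots> = (\<Sum>k\<le>N. w k * (real k / real N) ^ n)"
    proof (intro sum.cong refl arg_cong2[where f = "(*)"])
      fix k assume "k \<in> {..N}"
      then have "unit_powr (real n / 2 ^ j) (X k) = X k powr (real n / 2 ^ j)"
        using X01[of k] by (simp add: unit_powr_def)
      also have "\<dots> = (real k / real N) powr real n" by (simp add: X_def powr_powr)
      also have "\<dots> = (real k / real N) ^ n"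
        using N n by (cases "k = 0") (auto simp: powr_realpow)
      finally show "unit_powr (real n / 2 ^ j) (X k) = (real k / real N) ^ n" .
    qed
    finally have 1: "(LINT y|\<rho>. unit_powr (real n / 2 ^ j) y) = (\<Sum>k\<le>N. w k * (real k / real N) ^ n)" .
    have nN: "n \<le> N" using n by (simp add: N_def)
    have "C (real n / 2 ^ j) / C 0 = (\<Sum>k\<le>N. w k * (real (k choose n) / real (N choose n)))"
    proof -
      have "real (N choose n) * C (real n * d) / C 0 = (\<Sum>k\<le>N. real (k choose n) * w k)"
        unfolding sum_choose_binomial_forward_drop[OF nN, symmetric] w_def
        by (simp add: sum_divide_distrib)
      then have "C (real n * d) / C 0 = (\<Sum>k\<le>N. real (k choose n) * w k) / real (N choose n)"
        using nN by (simp add: field_simps)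
      then show ?thesis by (simp add: d_def sum_divide_distrib mult_ac)
    qed
    then have "\<bar>(LINT y|\<rho>. unit_powr (real n / 2 ^ j) y) - C (real n / 2 ^ j) / C 0\<bar>
      = \<bar>\<Sum>k\<le>N. w k * ((real k / real N) ^ n - real (k choose n) / real (N choose n))\<bar>"
      unfolding 1 by (simp add: right_diff_distrib sum_subtractf)
    also have "\<dots> \<le> (\<Sum>k\<le>N. w k * ((real n)\<^sup>2 / real N))"
    proof (rule order_trans[OF sum_abs], intro sum_mono)
      fix k assume "k \<in> {..N}"
      then have "\<bar>(real k / real N) ^ n - real (k choose n) / real (N choose n)\<bar> \<le> (real n)\<^sup>2 / real N"
        using choose_ratio_approx[OF _ nN N, of k] by (simp add: abs_minus_commute)
      then show "\<bar>w k * ((real k / real N) ^ n - real (k choose n) / real (N choose n))\<bar>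
         \<le> w k * ((real n)\<^sup>2 / real N)"
        unfolding abs_mult abs_of_nonneg[OF w] by (rule mult_left_mono) (rule w)
    qed
    also have "\<dots> = (real n)\<^sup>2 / 8 ^ j"
      by (simp only: sum_distrib_right[symmetric] sum_w) (simp add: N_def)
    finally show ?thesis .
  qed
  ultimately show ?thesis by blast
qed

lemma dyadic_approximation:
  fixes t :: real
  assumes "0 < t"
  shows "(\<lambda>q::nat. real (nat \<lceil>t * 2 ^ q\<rceil>) / 2 ^ q) \<longlonglongrightarrow> t"
proof (rule tendsto_sandwich)
  show "\<forall>\<^sub>F q in sequentially. t \<le> real (nat \<lceil>t * 2 ^ q\<rceil>) / 2 ^ q"
    by (simp add: pos_le_divide_eq real_nat_ceiling_ge)
  show "\<forall>\<^sub>F q in sequentially. real (nat \<lceil>t * 2 ^ q\<rceil>) / 2 ^ q \<le> t + (1 / 2) ^ q"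
  proof (rule always_eventually, rule allI)
    fix q :: nat
    have "0 \<le> \<lceil>t * 2 ^ q\<rceil>" using mult_pos_pos[OF assms, of "2 ^ q"] by (simp only: zero_le_ceiling) simp
    then have "real (nat \<lceil>t * 2 ^ q\<rceil>) \<le> t * 2 ^ q + 1" by simp
    then show "real (nat \<lceil>t * 2 ^ q\<rceil>) / 2 ^ q \<le> t + (1 / 2) ^ q"
      by (simp add: divide_le_eq power_divide distrib_right)
  qed
  show "(\<lambda>q. t + (1 / 2) ^ q) \<longlonglongrightarrow> t"
    using tendsto_add[OF tendsto_const LIMSEQ_power_zero[of "1/2::real"], of t] by simp
qed simp

text \<open>The second alternative of the last assumption is the case of exponent 0, approached from
  the right: for y <= 0 all terms are 0, and so is the limit.\<close>

lemma (in real_distribution) unit_powr_dominated: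
  assumes "u \<longlonglongrightarrow> t" "\<And>q. 0 < u q" and y: "0 < t \<or> (\<forall>y. unit_powr t y = indicator {0<..} y)"
  shows "(\<lambda>q. LINT y|M. unit_powr (u q) y) \<longlonglongrightarrow> (LINT y|M. unit_powr t y)"
proof (rule integral_dominated_convergence[where w = "\<lambda>_. 1"])
  show "AE y in M. (\<lambda>q. unit_powr (u q) y) \<longlonglongrightarrow> unit_powr t y"
  proof (rule AE_I2)
    fix y :: real
    have u0: "u q \<noteq> 0" for q using assms(2)[of q] by simp
    show "(\<lambda>q. unit_powr (u q) y) \<longlonglongrightarrow> unit_powr t y"
    proof (cases "0 < y")
      case True
      then have "0 < max 0 (min 1 y)" by simp
      then show ?thesis unfolding unit_powr_def using assms(1) by (intro tendsto_intros) auto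
    next
      case False
      then show ?thesis using y u0 by (auto simp: unit_powr_def)
    qed
  qed
  show "AE y in M. norm (unit_powr (u q) y) \<le> 1" for q
    using unit_powr_bounds assms(2)[of q] by (simp add: less_imp_le)
qed auto

text \<open>Measures on [0, 1] form a tight sequence, so a subsequence converges weakly. The moments
  of the limit are identified at dyadic exponents, which belong to all fine enough grids, and then
  at t > 0 by continuity. The clamp in \<open>unit_powr\<close> takes care of any limit mass outside
  [0, 1].\<close>

lemma psd_moment_measure:
  assumes psd: "psd_function C" and bd: "\<And>t. 0 \<le> t \<Longrightarrow> \<bar>C t\<bar> \<le> B" and C0: "0 < C 0"
    and cont: "continuous_on {0..} C"
  shows "\<exists>M. real_distribution M \<and> (\<forall>t>0. C t = C 0 * (LINT y|M. unit_powr t y))"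
proof -
  obtain \<rho> where \<rho>: "\<And>j. real_distribution (\<rho> j)" "\<And>j. measure (\<rho> j) {0..1} = 1"
    "\<And>j n. 0 < n \<Longrightarrow> n \<le> 8 ^ j \<Longrightarrow>
      \<bar>(LINT y|\<rho> j. unit_powr (real n / 2 ^ j) y) - C (real n / 2 ^ j) / C 0\<bar> \<le> (real n)\<^sup>2 / 8 ^ j"
    using approximating_measures[OF psd bd C0] by metis
  interpret \<rho>: real_distribution "\<rho> j" for j by fact
  have "tight \<rho>"
    unfolding tight_def
  proof (intro conjI allI impI)
    fix e :: real assume e: "0 < e"
    have "1 - e < measure (\<rho> j) {-1<..1}" for j
    proof -
      have "measure (\<rho> j) {0..1} \<le> measure (\<rho> j) {-1<..1}"
        by (intro \<rho>.finite_measure_mono) auto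
      then show ?thesis using \<rho>(2)[of j] e by simp
    qed
    then show "\<exists>a b. a < b \<and> (\<forall>n. 1 - e < measure (\<rho> n) {a<..b})"
      by (intro exI[of _ "-1"] exI[of _ 1]) auto
  qed (rule \<rho>(1))
  then obtain r M where r: "strict_mono (r :: nat \<Rightarrow> nat)" and M: "real_distribution M"
    and conv: "weak_conv_m (\<rho> \<circ> id \<circ> r) M"
    using tight_imp_convergent_subsubsequence[OF _ strict_mono_id] by blast
  interpret M: real_distribution M by fact
  have dyadic: "C (real n / 2 ^ q) = C 0 * (LINT y|M. unit_powr (real n / 2 ^ q) y)" if n: "0 < n" for n q
  proof -
    define t :: real where "t = real n / 2 ^ q"
    have t: "0 < t" using n by (simp add: t_def)
    have "(\<lambda>k. LINT y|(\<rho> \<circ> id \<circ> r) k. unit_powr t y) \<longlonglongrightarrow> (LINT y|M. unit_powr t y)"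
    proof (rule weak_conv_imp_integral_bdd_continuous_conv[where B = 1])
      show "real_distribution ((\<rho> \<circ> id \<circ> r) k)" for k using \<rho>(1) by simp
    qed (use t conv M isCont_unit_powr unit_powr_bounds in \<open>auto simp: less_imp_le o_def\<close>)
    moreover have "(\<lambda>k. LINT y|(\<rho> \<circ> id \<circ> r) k. unit_powr t y) \<longlonglongrightarrow> C t / C 0"
    proof -
      have "(\<lambda>j. (LINT y|\<rho> j. unit_powr t y) - C t / C 0) \<longlonglongrightarrow> 0"
      proof (rule Lim_null_comparison)
        show "\<forall>\<^sub>F j in sequentially. norm ((LINT y|\<rho> j. unit_powr t y) - C t / C 0) \<le> t\<^sup>2 * (1 / 2) ^ j"
          using eventually_ge_at_top[of "q + n"]
        proof eventually_elim
          case (elim j)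
          \<comment> \<open>The same exponent on the finer grid: t = m / 2^j. The error m^2 / 8^j is
            then t^2 / 2^j, and j >= q + n guarantees m <= 8^j.\<close>
          define m where "m = n * 2 ^ (j - q)"
          have p: "(2::real) ^ j = 2 ^ q * 2 ^ (j - q)" using elim by (simp add: power_add[symmetric])
          have tm: "t = real m / 2 ^ j" by (simp add: t_def m_def p)
          have "n \<le> 2 ^ n" by (rule less_imp_le[OF less_exp])
          also have "\<dots> \<le> 2 ^ j" using elim by (intro power_increasing) auto
          finally have "m \<le> 2 ^ j * 2 ^ j" unfolding m_def by (intro mult_mono power_increasing) auto
          also have "\<dots> \<le> 8 ^ j" by (simp add: power_mult_distrib[symmetric] power_mono)
          finally have m: "m \<le> 8 ^ j" .
          have "0 < m" using n by (simp add: m_def)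
          from \<rho>(3)[OF this m] have "norm ((LINT y|\<rho> j. unit_powr t y) - C t / C 0) \<le> (real m)\<^sup>2 / 8 ^ j"
            by (simp add: tm)
          also have "real m = t * 2 ^ j" by (simp add: tm)
          also have "(t * 2 ^ j)\<^sup>2 / 8 ^ j = t\<^sup>2 * (1 / 2) ^ j"
          proof -
            have "(8::real) ^ j = 2 ^ j * 2 ^ j * 2 ^ j" by (simp add: power_mult_distrib[symmetric])
            then show ?thesis by (simp add: power_mult_distrib power2_eq_square power_divide)
          qed
          finally show ?case .
        qed
        show "(\<lambda>j. t\<^sup>2 * (1 / 2) ^ j) \<longlonglongrightarrow> 0"
          using tendsto_mult[OF tendsto_const LIMSEQ_power_zero[of "1/2::real"], of "t\<^sup>2"] by simp
      qed
      then have "(\<lambda>j. LINT y|\<rho> j. unit_powr t y) \<longlonglongrightarrow> C t / C 0" by (simp add: LIM_zero_iff)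
      from LIMSEQ_subseq_LIMSEQ[OF this r] show ?thesis by (simp add: o_def)
    qed
    ultimately have "C t / C 0 = (LINT y|M. unit_powr t y)" using LIMSEQ_unique by blast
    then show ?thesis using C0 by (simp add: t_def field_simps)
  qed
  have "C t = C 0 * (LINT y|M. unit_powr t y)" if t: "0 < t" for t
  proof -
    define u where "u q = real (nat \<lceil>t * 2 ^ q\<rceil>) / 2 ^ q" for q
    have u: "u \<longlonglongrightarrow> t" unfolding u_def using t by (rule dyadic_approximation)
    have n: "0 < nat \<lceil>t * 2 ^ q\<rceil>" for q using t by simp
    then have upos: "0 < u q" for q unfolding u_def by simp
    have Cu: "C (u q) = C 0 * (LINT y|M. unit_powr (u q) y)" for q
      unfolding u_def by (rule dyadic) fact
    have "(\<lambda>q. C (u q)) \<longlonglongrightarrow> C t"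
      using cont u t upos by (intro continuous_on_tendsto_compose[OF cont u]) (auto simp: less_imp_le)
    moreover have "(\<lambda>q. C (u q)) \<longlonglongrightarrow> C 0 * (LINT y|M. unit_powr t y)"
      unfolding Cu using t upos by (intro tendsto_intros M.unit_powr_dominated u) auto
    ultimately show ?thesis by (rule LIMSEQ_unique)
  qed
  with M show ?thesis by blast
qed

text \<open>The substitution y = exp (-x) turns moments into Laplace transforms. The two ends need
  care: mass at y <= 0, which would sit at x = infinity, is cut off by the density, and mass at x =
  0 is excluded by the decay of \<open>C\<close>.\<close>

lemma psd_laplace_representation:
  assumes psd: "psd_function C" and bd: "\<And>t. 0 \<le> t \<Longrightarrow> \<bar>C t\<bar> \<le> B"
    and cont: "continuous_on {0..} C" and lim: "(C \<longlongrightarrow> 0) at_top"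
  shows "\<exists>\<nu>::real measure. finite_measure \<nu> \<and> sets \<nu> = sets borel \<and> (AE x in \<nu>. 0 < x) \<and>
    (\<forall>t\<ge>0. C t = (LINT x|\<nu>. exp (- t * x)))"
proof (cases "C 0 = 0")
  case True
  have "C t = 0" if "0 \<le> t" for t using psd_midpoint[OF psd that] True by simp
  moreover have "finite_measure (null_measure borel :: real measure)" by (rule finite_measureI) simp
  moreover have "AE x in null_measure borel. (0::real) < x" by (rule AE_I[of _ _ UNIV]) auto
  ultimately show ?thesis
    by (intro exI[of _ "null_measure borel"]) auto
next
  case False
  with psd_nonneg[OF psd, of 0] have C0: "0 < C 0" by simp
  obtain M where M: "real_distribution M" and CM: "\<And>t. 0 < t \<Longrightarrow> C t = C 0 * (LINT y|M. unit_powr t y)"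
    using psd_moment_measure[OF psd bd C0 cont] by blast
  interpret M: real_distribution M by fact
  have intg: "integrable M (unit_powr t)" if "0 \<le> t" for t
    using unit_powr_bounds that by (intro M.integrable_const_bound[of _ 1]) auto
  define D where "D = density M (\<lambda>y. ennreal (C 0 * indicator {0<..} y))"
  define \<nu> where "\<nu> = distr D borel (\<lambda>y. - ln (min 1 y))"
  have sets_D [measurable_cong]: "sets D = sets borel" by (simp add: D_def)
  \<comment> \<open>Letting the exponent tend to 0 and using continuity of \<open>C\<close> at 0:
    nothing is lost by removing y <= 0, so the representation includes t = 0.\<close>
  have C0_eq: "C 0 = C 0 * (LINT y|M. unit_powr 0 y)"
  proof -
    define u where "u q = inverse (real (Suc q))" for q
    have u: "u \<longlonglongrightarrow> 0" "\<And>q. 0 < u q"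
      unfolding u_def by (rule LIMSEQ_inverse_real_of_nat) simp
    have "(\<lambda>q. C (u q)) \<longlonglongrightarrow> C 0"
      using u by (intro continuous_on_tendsto_compose[OF cont u(1)]) (auto simp: less_imp_le)
    moreover have "(\<lambda>q. C (u q)) \<longlonglongrightarrow> C 0 * (LINT y|M. unit_powr 0 y)"
      unfolding CM[OF u(2)] using u
      by (intro tendsto_intros M.unit_powr_dominated) (auto simp: unit_powr_def indicator_def)
    ultimately show ?thesis by (rule LIMSEQ_unique)
  qed
  have rep: "C t = (LINT x|\<nu>. exp (- t * x))" if t: "0 \<le> t" for t
  proof -
    have "(LINT x|\<nu>. exp (- t * x)) = (LINT y|D. exp (- t * (- ln (min 1 y))))"
      unfolding \<nu>_def by (rule integral_distr) auto
    also have "\<dots> = (LINT y|M. (C 0 * indicator {0<..} y) * exp (- t * (- ln (min 1 y))))"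
      unfolding D_def using C0 by (subst integral_density) auto
    also have "\<dots> = (LINT y|M. C 0 * unit_powr t y)"
      by (intro Bochner_Integration.integral_cong refl)
         (auto simp: unit_powr_def indicator_def powr_def max_def min_def)
    also have "\<dots> = C t" using CM[of t] C0_eq t by (cases "t = 0") auto
    finally show ?thesis by simp
  qed
  have fin: "finite_measure \<nu>"
  proof -
    have "emeasure D (space D) = (\<integral>\<^sup>+y. ennreal (C 0 * indicator {0<..} y) \<partial>M)"
      unfolding D_def by (simp add: emeasure_density cong: nn_integral_cong)
    also have "\<dots> \<le> (\<integral>\<^sup>+y. ennreal (C 0) \<partial>M)"
      using C0 by (intro nn_integral_mono) (auto simp: indicator_def)
    also have "\<dots> < \<infinity>" using M.emeasure_space_1 by (simp add: M.space_eq_univ)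
    finally have "finite_measure D" by (intro finite_measureI) auto
    then show ?thesis unfolding \<nu>_def by (rule finite_measure.finite_measure_distr) auto
  qed
  interpret \<nu>: finite_measure \<nu> by fact
  have sets_\<nu>: "sets \<nu> = sets borel" by (simp add: \<nu>_def)
  have "AE x in \<nu>. 0 \<le> x"
    unfolding \<nu>_def
  proof (subst AE_distr_iff)
    show "AE y in D. 0 \<le> - ln (min 1 y)"
      unfolding D_def by (subst AE_density) (auto simp: indicator_def min_def)
  qed auto
  moreover have "AE x in \<nu>. x \<noteq> 0"
  proof -
    \<comment> \<open>An atom at 0 contributes its full mass to the transform at each t, whereas
      \<open>C\<close> tends to 0.\<close>
    have "measure \<nu> {0} \<le> C t" if t: "0 \<le> t" for t
    proof -
      have "measure \<nu> {0} = (LINT x|\<nu>. indicator {0} x)"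
        by (simp add: sets_\<nu>)
      also have "\<dots> \<le> (LINT x|\<nu>. exp (- t * x))"
      proof (rule integral_mono_AE)
        show "integrable \<nu> (indicator {0::real} :: real \<Rightarrow> real)" 
          by (intro integrable_real_indicator) (simp_all add: sets_\<nu> \<nu>.emeasure_finite less_top[symmetric])
        show "integrable \<nu> (\<lambda>x. exp (- t * x))"
          using \<open>AE x in \<nu>. 0 \<le> x\<close> t
          by (intro \<nu>.integrable_const_bound[of _ 1]) (auto simp: sets_\<nu> \<nu>_def elim!: eventually_mono)
      qed (auto simp: indicator_def)
      also have "\<dots> = C t" using rep[OF t] by simp
      finally show ?thesis .
    qed
    then have "measure \<nu> {0} \<le> 0"
      by (intro tendsto_lowerbound[OF lim]) (auto intro: eventually_mono[OF eventually_ge_at_top[of 0]])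
    then have "measure \<nu> {0} = 0" by (simp add: measure_le_0_iff)
    then have "emeasure \<nu> {0} = 0" by (simp add: \<nu>.emeasure_eq_measure)
    then show ?thesis by (intro AE_I[of _ _ "{0}"]) (auto simp: sets_\<nu>)
  qed
  ultimately have "AE x in \<nu>. 0 < x" by eventually_elim auto
  with fin sets_\<nu> rep show ?thesis by blast
qed

section \<open>Differentiability along lines and the trapezoidal rule\<close>

text \<open>The increment is built up one coordinate at a time. All intermediate points are
  dominated componentwise by the increment v, so they stay within norm v of x, where the partial
  derivatives are close to those at x; the mean value inequality handles each coordinate.\<close>

lemma continuous_partials_has_derivative:
  fixes f :: "real^'d::finite \<Rightarrow> real" and D :: "'d \<Rightarrow> real^'d \<Rightarrow> real"
  assumes D: "\<And>i x. ((\<lambda>h. f (x + h *\<^sub>R axis i 1)) has_real_derivative D i x) (at 0)"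
    and cont: "\<And>i. continuous_on UNIV (D i)"
  shows "(f has_derivative (\<lambda>v. \<Sum>i\<in>UNIV. v $ i * D i x)) (at x)"
proof -
  have line: "((\<lambda>h. f (x + h *\<^sub>R axis i 1)) has_real_derivative D i (x + h *\<^sub>R axis i 1)) (at h)" for x i h
  proof -
    have "(\<lambda>k. f ((x + h *\<^sub>R axis i 1) + k *\<^sub>R axis i 1)) = (\<lambda>k. f (x + (h + k) *\<^sub>R axis i 1))"
      by (simp add: algebra_simps)
    with D[of "x + h *\<^sub>R axis i 1" i]
    have "((\<lambda>k. f (x + (h + k) *\<^sub>R axis i 1)) has_real_derivative D i (x + h *\<^sub>R axis i 1)) (at 0)"
      by simp
    then show ?thesis
      using DERIV_shift[of "\<lambda>h. f (x + h *\<^sub>R axis i 1)" "D i (x + h *\<^sub>R axis i 1)" 0 h] by (simp add: add.commute)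
  qed
  have step: "\<bar>f (z + r *\<^sub>R axis k 1) - f z - r * D k x\<bar> \<le> e * \<bar>r\<bar>"
    if "\<And>s. \<bar>s\<bar> \<le> \<bar>r\<bar> \<Longrightarrow> \<bar>D k (z + s *\<^sub>R axis k 1) - D k x\<bar> \<le> e" for z r k e
  proof -
    have "norm ((\<lambda>h. f (z + h *\<^sub>R axis k 1) - h * D k x) r - (\<lambda>h. f (z + h *\<^sub>R axis k 1) - h * D k x) 0)
        \<le> e * norm (r - 0)"
    proof (rule field_differentiable_bound[where S = "cball 0 \<bar>r\<bar>" and f' = "\<lambda>s. D k (z + s *\<^sub>R axis k 1) - D k x"])
      fix s :: real assume s: "s \<in> cball 0 \<bar>r\<bar>"
      show "((\<lambda>h. f (z + h *\<^sub>R axis k 1) - h * D k x) has_field_derivative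
          D k (z + s *\<^sub>R axis k 1) - D k x) (at s within cball 0 \<bar>r\<bar>)"
        by (rule DERIV_subset) (auto intro!: derivative_eq_intros line)
      show "norm (D k (z + s *\<^sub>R axis k 1) - D k x) \<le> e" using s by (simp add: that)
    qed auto
    then show ?thesis by simp
  qed
  show ?thesis
  proof (rule has_derivativeI)
    show "bounded_linear (\<lambda>v. \<Sum>i\<in>UNIV. v $ i * D i x)"
      by (intro bounded_linear_sum bounded_linear_mult_left bounded_linear_vec_nth
            bounded_linear_compose[OF bounded_linear_mult_left])
    show "((\<lambda>y. (f y - f x - (\<Sum>i\<in>UNIV. (y - x) $ i * D i x)) /\<^sub>R norm (y - x)) \<longlongrightarrow> 0) (at x)"
    proof (rule tendstoI)
      fix e :: real assume e: "0 < e"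
      \<comment> \<open>The coordinates of v sum to at most the dimension times norm v; the extra 2
        makes the final inequality strict.\<close>
      define e' where "e' = e / (2 * real CARD('d))"
      have e': "0 < e'" using e by (simp add: e'_def)
      have "\<exists>\<delta>>0. \<forall>y. dist y x < \<delta> \<longrightarrow> dist (D i y) (D i x) < e'" for i
        using cont[of i] e' by (auto simp: continuous_on_iff)
      then obtain \<delta> where \<delta>: "\<And>i. 0 < \<delta> i" "\<And>i y. dist y x < \<delta> i \<Longrightarrow> dist (D i y) (D i x) < e'" by metis
      define d where "d = Min (range \<delta>)"
      have d: "0 < d" and d_le: "d \<le> \<delta> i" for i using \<delta>(1) by (auto simp: d_def)
      have near: "\<bar>D i y - D i x\<bar> \<le> e'" if "norm (y - x) < d" for i y
        using \<delta>(2)[of y i] that d_le[of i] by (simp add: dist_norm)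
      have part: "\<bar>f (x + (\<chi> i. if i \<in> S then v $ i else 0)) - f x - (\<Sum>i\<in>S. v $ i * D i x)\<bar>
          \<le> e' * (\<Sum>i\<in>S. \<bar>v $ i\<bar>)" if v: "norm v < d" and "finite S" for v :: "real^'d" and S
        using \<open>finite S\<close>
      proof induction
        case empty
        have "(\<chi> i. 0) = (0::real^'d)" by (simp add: vec_eq_iff)
        then show ?case by simp
      next
        case (insert k S)
        define p where "p = (\<chi> i. if i \<in> S then v $ i else 0)"
        have "(\<chi> i. if i \<in> insert k S then v $ i else 0) = p + v $ k *\<^sub>R axis k 1"
          using insert by (auto simp: p_def vec_eq_iff axis_def)
        moreover have "\<bar>f (x + p + v $ k *\<^sub>R axis k 1) - f (x + p) - v $ k * D k x\<bar> \<le> e' * \<bar>v $ k\<bar>"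
        proof (rule step, rule near)
          fix s assume s: "\<bar>s\<bar> \<le> \<bar>v $ k\<bar>"
          have "norm (p + s *\<^sub>R axis k 1) \<le> norm v"
          proof (rule norm_le_componentwise_cart)
            fix i show "norm ((p + s *\<^sub>R axis k 1) $ i) \<le> norm (v $ i)"
              using insert s by (auto simp: p_def axis_def)
          qed
          then show "norm (x + p + s *\<^sub>R axis k 1 - x) < d" using v by (simp add: add.assoc)
        qed
        moreover have "\<bar>f (x + p) - f x - (\<Sum>i\<in>S. v $ i * D i x)\<bar> \<le> e' * (\<Sum>i\<in>S. \<bar>v $ i\<bar>)"
          using insert by (simp add: p_def)
        ultimately show ?case using insert by (simp add: add.assoc distrib_left)
      qed
      have "dist ((f y - f x - (\<Sum>i\<in>UNIV. (y - x) $ i * D i x)) /\<^sub>R norm (y - x)) 0 < e"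
        if y: "y \<noteq> x" "norm (y - x) < d" for y
      proof -
        have n: "0 < norm (y - x)" using y by simp
        have "\<bar>f y - f x - (\<Sum>i\<in>UNIV. (y - x) $ i * D i x)\<bar> \<le> e' * (\<Sum>i\<in>UNIV. \<bar>(y - x) $ i\<bar>)"
          using part[OF y(2), of UNIV] by (simp add: vec_lambda_eta del: vector_minus_component)
        also have "\<dots> \<le> e' * (\<Sum>i\<in>(UNIV::'d set). norm (y - x))"
          using e' by (intro mult_left_mono sum_mono component_le_norm_cart) auto
        also have "\<dots> = e / 2 * norm (y - x)" by (simp add: e'_def)
        also have "\<dots> < e * norm (y - x)" using e n by simp
        finally show ?thesis using n by (simp add: field_simps)
      qed
      then show "\<forall>\<^sub>F y in at x. dist ((f y - f x - (\<Sum>i\<in>UNIV. (y - x) $ i * D i x)) /\<^sub>R norm (y - x)) 0 < e"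
        unfolding eventually_at dist_norm using d by (intro exI[of _ d]) auto
    qed
  qed
qed

lemma Ck_continuous: "Ck k f \<Longrightarrow> continuous_on UNIV f"
  by (cases k) auto

lemma Ck_Suc_has_derivative:
  assumes "Ck (Suc k) f"
  shows "(f has_derivative (\<lambda>v. \<Sum>i\<in>UNIV. v $ i * pdiff i f x)) (at x)"
proof (rule continuous_partials_has_derivative)
  show "((\<lambda>h. f (x + h *\<^sub>R axis i 1)) has_real_derivative pdiff i f x) (at 0)" for i x
    using assms by (auto simp: pdiff_def DERIV_deriv_iff_field_differentiable)
  show "continuous_on UNIV (pdiff i f)" for i
    using assms Ck_continuous by auto
qed

lemma Ck_Suc_line_derivative:
  assumes "Ck (Suc k) f"
  shows "((\<lambda>t. f (x + t *\<^sub>R v)) has_real_derivative (\<Sum>i\<in>UNIV. v $ i * pdiff i f (x + t *\<^sub>R v))) (at t)"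
proof -
  have "((\<lambda>t. f (x + t *\<^sub>R v)) has_derivative
      (\<lambda>h. \<Sum>i\<in>UNIV. (h *\<^sub>R v) $ i * pdiff i f (x + t *\<^sub>R v))) (at t)"
    by (rule has_derivative_compose[OF _ Ck_Suc_has_derivative[OF assms], unfolded o_def])
       (auto intro!: derivative_eq_intros)
  then show ?thesis
    by (rule has_derivative_imp_has_field_derivative) (simp add: sum_distrib_left mult_ac)
qed

context
  fixes V :: "real^'d::finite \<Rightarrow> real"
  assumes C3: "Ck 3 V"
begin

lemma C3_line_derivatives:
  fixes x v :: "real^'d"
  defines "\<phi>1 \<equiv> \<lambda>t. \<Sum>i\<in>UNIV. v $ i * pdiff i V (x + t *\<^sub>R v)"
    and "\<phi>2 \<equiv> \<lambda>t. \<Sum>i\<in>UNIV. v $ i * (\<Sum>j\<in>UNIV. v $ j * pdiff j (pdiff i V) (x + t *\<^sub>R v))"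
    and "\<phi>3 \<equiv> \<lambda>t. \<Sum>i\<in>UNIV. v $ i * (\<Sum>j\<in>UNIV. v $ j *
      (\<Sum>k\<in>UNIV. v $ k * pdiff k (pdiff j (pdiff i V)) (x + t *\<^sub>R v)))"
  shows "((\<lambda>t. V (x + t *\<^sub>R v)) has_real_derivative \<phi>1 t) (at t)"
    and "(\<phi>1 has_real_derivative \<phi>2 t) (at t)"
    and "(\<phi>2 has_real_derivative \<phi>3 t) (at t)"
proof -
  have c: "Ck (Suc 2) V" "Ck (Suc 1) (pdiff i V)" "Ck (Suc 0) (pdiff j (pdiff i V))" for i j
    using C3 by (auto simp: numeral_eq_Suc)
  show "((\<lambda>t. V (x + t *\<^sub>R v)) has_real_derivative \<phi>1 t) (at t)"
    unfolding \<phi>1_def by (rule Ck_Suc_line_derivative[OF c(1)])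
  show "(\<phi>1 has_real_derivative \<phi>2 t) (at t)"
    unfolding \<phi>1_def \<phi>2_def by (intro DERIV_sum DERIV_cmult Ck_Suc_line_derivative[OF c(2)])
  show "(\<phi>2 has_real_derivative \<phi>3 t) (at t)"
    unfolding \<phi>2_def \<phi>3_def by (intro DERIV_sum DERIV_cmult Ck_Suc_line_derivative[OF c(3)])
qed

lemma grad_inner: "grad V x \<bullet> v = (\<Sum>i\<in>UNIV. v $ i * pdiff i V x)"
  by (simp add: inner_vec_def grad_def mult.commute)

text \<open>Along the segment, V is expanded to third and its slope to second order. In the
  trapezoidal combination the terms of order one and two cancel, leaving third derivatives at two
  intermediate points with weights 1/6 and -1/4. The cubed dimension comes from estimating each of
  the three sums by its number of terms.\<close>

lemma trapezoid_bound:
  assumes C: "\<And>x i j k. \<bar>pdiff i (pdiff j (pdiff k V)) x\<bar> \<le> C"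
  shows "\<bar>V y - V x - (grad V x + grad V y) \<bullet> (y - x) / 2\<bar> \<le> C * real CARD('d) ^ 3 * norm (y - x) ^ 3"
proof -
  define v where "v = y - x"
  define \<phi>1 where "\<phi>1 t = (\<Sum>i\<in>UNIV. v $ i * pdiff i V (x + t *\<^sub>R v))" for t
  define \<phi>2 where "\<phi>2 t = (\<Sum>i\<in>UNIV. v $ i * (\<Sum>j\<in>UNIV. v $ j * pdiff j (pdiff i V) (x + t *\<^sub>R v)))" for t
  define \<phi>3 where "\<phi>3 t = (\<Sum>i\<in>UNIV. v $ i * (\<Sum>j\<in>UNIV. v $ j *
      (\<Sum>k\<in>UNIV. v $ k * pdiff k (pdiff j (pdiff i V)) (x + t *\<^sub>R v))))" for t
  define \<phi> where "\<phi> t = V (x + t *\<^sub>R v)" for t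
  note der = C3_line_derivatives[where x = x and v = v, folded \<phi>1_def \<phi>2_def \<phi>3_def \<phi>_def]
  have bound: "\<bar>\<phi>3 t\<bar> \<le> C * real CARD('d) ^ 3 * norm v ^ 3" for t
  proof -
    have sum_bound: "\<bar>\<Sum>i\<in>UNIV. v $ i * a i\<bar> \<le> real CARD('d) * norm v * A"
      if "\<And>i. \<bar>a i\<bar> \<le> A" for a :: "'d \<Rightarrow> real" and A
    proof -
      have "\<bar>\<Sum>i\<in>UNIV. v $ i * a i\<bar> \<le> (\<Sum>i\<in>(UNIV::'d set). norm v * A)"
        using that by (intro order_trans[OF sum_abs] sum_mono)
          (auto simp: abs_mult intro!: mult_mono component_le_norm_cart)
      then show ?thesis by simp
    qed
    have "\<bar>\<phi>3 t\<bar> \<le> real CARD('d) * norm v * (real CARD('d) * norm v * (real CARD('d) * norm v * C))"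
      unfolding \<phi>3_def by (intro sum_bound C)
    then show ?thesis by (simp add: power3_eq_cube mult_ac)
  qed
  define B where "B = C * real CARD('d) ^ 3 * norm v ^ 3"
  obtain s where s: "\<phi> 1 = \<phi> 0 + \<phi>1 0 + \<phi>2 0 / 2 + \<phi>3 s / 6"
  proof -
    have "\<forall>m t. m < 3 \<and> 0 \<le> t \<and> t \<le> 1 \<longrightarrow>
        (([\<phi>, \<phi>1, \<phi>2, \<phi>3] ! m) has_real_derivative ([\<phi>, \<phi>1, \<phi>2, \<phi>3] ! Suc m) t) (at t)"
      using der by (auto simp: less_Suc_eq numeral_3_eq_3)
    from Maclaurin[OF _ _ _ this, of \<phi>] show ?thesis
      by (auto simp: numeral_3_eq_3 fact_numeral intro: that)
  qed
  obtain r where r: "\<phi>1 1 = \<phi>1 0 + \<phi>2 0 + \<phi>3 r / 2"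
  proof -
    have "\<forall>m t. m < 2 \<and> 0 \<le> t \<and> t \<le> 1 \<longrightarrow>
        (([\<phi>1, \<phi>2, \<phi>3] ! m) has_real_derivative ([\<phi>1, \<phi>2, \<phi>3] ! Suc m) t) (at t)"
      using der by (auto simp: less_Suc_eq numeral_2_eq_2)
    from Maclaurin[OF _ _ _ this, of \<phi>1] show ?thesis
      by (auto simp: numeral_2_eq_2 intro: that)
  qed
  have "\<phi> 1 - \<phi> 0 - (\<phi>1 0 + \<phi>1 1) / 2 = \<phi>3 s / 6 - \<phi>3 r / 4"
    using s r by (simp add: field_simps)
  moreover have "\<bar>\<phi>3 s\<bar> \<le> B" "\<bar>\<phi>3 r\<bar> \<le> B" using bound by (auto simp: B_def)
  ultimately have "\<bar>\<phi> 1 - \<phi> 0 - (\<phi>1 0 + \<phi>1 1) / 2\<bar> \<le> B" by linarith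
  moreover have "\<phi> 1 = V y" "\<phi> 0 = V x" "\<phi>1 0 = grad V x \<bullet> v" "\<phi>1 1 = grad V y \<bullet> v"
    by (simp_all add: \<phi>_def \<phi>1_def grad_inner v_def)
  ultimately show ?thesis by (simp add: B_def v_def inner_add_left)
qed

context
  fixes K :: real
  assumes convex: "\<And>v x. K * (norm v)\<^sup>2 \<le> (\<Sum>i\<in>UNIV. \<Sum>j\<in>UNIV. v $ i * pdiff i (pdiff j V) x * v $ j)"
begin

lemma second_line_derivative_ge:
  "K * (norm v)\<^sup>2 \<le> (\<Sum>i\<in>UNIV. v $ i * (\<Sum>j\<in>UNIV. v $ j * pdiff j (pdiff i V) x))"
proof -
  have "(\<Sum>i\<in>UNIV. v $ i * (\<Sum>j\<in>UNIV. v $ j * pdiff j (pdiff i V) x))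
      = (\<Sum>j\<in>UNIV. \<Sum>i\<in>UNIV. v $ j * pdiff j (pdiff i V) x * v $ i)"
    by (subst sum.swap) (simp add: sum_distrib_left mult_ac)
  then show ?thesis using convex[of v x] by simp
qed

lemma grad_strongly_monotone: "K * (norm (y - x))\<^sup>2 \<le> (grad V y - grad V x) \<bullet> (y - x)"
proof -
  define v where "v = y - x"
  define \<phi>1 where "\<phi>1 t = (\<Sum>i\<in>UNIV. v $ i * pdiff i V (x + t *\<^sub>R v))" for t
  define \<phi>2 where "\<phi>2 t = (\<Sum>i\<in>UNIV. v $ i * (\<Sum>j\<in>UNIV. v $ j * pdiff j (pdiff i V) (x + t *\<^sub>R v)))" for t
  have "\<exists>z>0. z < 1 \<and> \<phi>1 1 - \<phi>1 0 = (1 - 0) * \<phi>2 z"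
    by (intro MVT2) (auto simp: C3_line_derivatives(2)[where x = x and v = v, folded \<phi>1_def \<phi>2_def])
  then obtain z where "\<phi>1 1 - \<phi>1 0 = \<phi>2 z" by auto
  then have "K * (norm v)\<^sup>2 \<le> \<phi>1 1 - \<phi>1 0" using second_line_derivative_ge[of v] by (simp add: \<phi>2_def)
  then show ?thesis unfolding inner_diff_left grad_inner by (simp add: \<phi>1_def v_def)
qed

lemma quadratic_lower_bound: "V x + grad V x \<bullet> (y - x) + K / 2 * (norm (y - x))\<^sup>2 \<le> V y"
proof -
  define v where "v = y - x"
  define \<phi>1 where "\<phi>1 t = (\<Sum>i\<in>UNIV. v $ i * pdiff i V (x + t *\<^sub>R v))" for t
  define \<phi>2 where "\<phi>2 t = (\<Sum>i\<in>UNIV. v $ i * (\<Sum>j\<in>UNIV. v $ j * pdiff j (pdiff i V) (x + t *\<^sub>R v)))" for t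
  define \<phi> where "\<phi> t = V (x + t *\<^sub>R v)" for t
  note der = C3_line_derivatives(1,2)[where x = x and v = v, folded \<phi>1_def \<phi>2_def \<phi>_def]
  obtain r where r: "\<phi> 1 = \<phi> 0 + \<phi>1 0 + \<phi>2 r / 2"
  proof -
    have "\<forall>m t. m < 2 \<and> 0 \<le> t \<and> t \<le> 1 \<longrightarrow>
        (([\<phi>, \<phi>1, \<phi>2] ! m) has_real_derivative ([\<phi>, \<phi>1, \<phi>2] ! Suc m) t) (at t)"
      using der by (auto simp: less_Suc_eq numeral_2_eq_2)
    from Maclaurin[OF _ _ _ this, of \<phi>] show ?thesis
      by (auto simp: numeral_2_eq_2 intro: that)
  qed
  moreover have "K * (norm v)\<^sup>2 \<le> \<phi>2 r" using second_line_derivative_ge[of v] by (simp add: \<phi>2_def)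
  ultimately show ?thesis unfolding grad_inner by (simp add: \<phi>_def \<phi>1_def v_def)
qed

end

end

section \<open>Almost reversibility of the Euler kernel\<close>

text \<open>The parameter is the variance of each coordinate. The product form is the one in which
  \<open>brownian_motion\<close> gives its increments.\<close>

definition gauss :: "real \<Rightarrow> real^'d::finite \<Rightarrow> real" where
  "gauss \<tau> w = (\<Prod>i\<in>UNIV. normal_density 0 (sqrt \<tau>) (w $ i))"

definition gauss_noise :: "real \<Rightarrow> (real^'d::finite) measure" where
  "gauss_noise \<tau> = density lborel (\<lambda>w. ennreal (gauss \<tau> w))"

lemma borel_measurable_gauss [measurable]: "gauss \<tau> \<in> borel_measurable borel"
  unfolding gauss_def by measurable

lemma gauss_nonneg: "0 \<le> gauss \<tau> w"
  unfolding gauss_def by (intro prod_nonneg) auto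

lemma sets_gauss_noise [simp, measurable_cong]: "sets (gauss_noise \<tau>) = sets borel"
  by (simp add: gauss_noise_def)

lemma space_gauss_noise [simp]: "space (gauss_noise \<tau>) = UNIV"
  by (simp add: gauss_noise_def)

lemma nn_integral_gauss:
  assumes "0 < \<tau>"
  shows "(\<integral>\<^sup>+w. ennreal (gauss \<tau> (w::real^'d::finite)) \<partial>lborel) = 1"
proof -
  have 1: "(\<integral>\<^sup>+x. ennreal (normal_density 0 (sqrt \<tau>) x) \<partial>lborel) = 1"
    using assms by (subst nn_integral_eq_integral) (auto simp: integrable_normal_density integral_normal_density)
  have "(\<integral>\<^sup>+w. ennreal (gauss \<tau> (w::real^'d)) \<partial>lborel)
      = (\<integral>\<^sup>+w. (\<Prod>b\<in>Basis. ennreal (normal_density 0 (sqrt \<tau>) ((w::real^'d) \<bullet> b))) \<partial>lborel)"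
  proof (intro nn_integral_cong)
    fix w :: "real^'d"
    have "(\<Prod>b\<in>Basis. ennreal (normal_density 0 (sqrt \<tau>) (w \<bullet> b)))
        = (\<Prod>i\<in>UNIV. ennreal (normal_density 0 (sqrt \<tau>) (w \<bullet> axis i 1)))"
    proof -
      have "(Basis :: (real^'d) set) = range (\<lambda>i. axis i 1)" by (auto simp: Basis_vec_def)
      moreover have "inj (\<lambda>i. axis i 1 :: real^'d)" by (auto simp: inj_on_def axis_eq_axis)
      ultimately show ?thesis
        using prod.reindex[of "\<lambda>i. axis i 1 :: real^'d" UNIV "\<lambda>b. ennreal (normal_density 0 (sqrt \<tau>) (w \<bullet> b))"]
        by (simp only: o_def)
    qed
    then show "ennreal (gauss \<tau> w) = (\<Prod>b\<in>Basis. ennreal (normal_density 0 (sqrt \<tau>) (w \<bullet> b)))"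
      by (simp add: gauss_def prod_ennreal inner_axis)
  qed
  also have "\<dots> = (\<Prod>b\<in>(Basis::(real^'d) set). (\<integral>\<^sup>+x. ennreal (normal_density 0 (sqrt \<tau>) x) \<partial>lborel))"
    by (rule nn_integral_lborel_prod) auto
  finally show ?thesis by (simp add: 1)
qed

lemma prob_space_gauss_noise: "0 < \<tau> \<Longrightarrow> prob_space (gauss_noise \<tau> :: (real^'d::finite) measure)"
  by (rule prob_spaceI) (simp add: gauss_noise_def emeasure_density nn_integral_gauss)

lemma gauss_exp:
  assumes "0 < \<tau>"
  shows "gauss \<tau> (w::real^'d::finite) = (1 / sqrt (2 * pi * \<tau>)) ^ CARD('d) * exp (- (norm w)\<^sup>2 / (2 * \<tau>))"
proof -
  have "gauss \<tau> w = (\<Prod>i\<in>(UNIV::'d set). 1 / sqrt (2 * pi * \<tau>)) * (\<Prod>i\<in>UNIV. exp (- (w $ i)\<^sup>2 / (2 * \<tau>)))"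
    using assms unfolding gauss_def normal_density_def prod.distrib[symmetric] by simp
  also have "(\<Prod>i\<in>UNIV. exp (- (w $ i)\<^sup>2 / (2 * \<tau>))) = exp (\<Sum>i\<in>UNIV. - (w $ i)\<^sup>2 / (2 * \<tau>))"
    by (simp add: exp_sum)
  also have "(\<Sum>i\<in>UNIV. - (w $ i)\<^sup>2 / (2 * \<tau>)) = - (norm w)\<^sup>2 / (2 * \<tau>)"
    by (simp add: norm_vec_def L2_set_def sum_nonneg sum_divide_distrib[symmetric] sum_negf)
  finally show ?thesis by simp
qed

text \<open>Doubling the variance absorbs an exponential weight at the cost of a factor independent
  of h. Polynomial moments, dominated by that weight, thereby reduce to the normalization of a
  Gaussian.\<close>

lemma gauss_times_exp:
  assumes "0 < h"
  shows "gauss (2 * h) (w::real^'d::finite) * exp ((norm w)\<^sup>2 / (8 * h)) = sqrt 2 ^ CARD('d) * gauss (4 * h) w"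
proof -
  have "exp (- (norm w)\<^sup>2 / (2 * (2 * h))) * exp ((norm w)\<^sup>2 / (8 * h)) = exp (- (norm w)\<^sup>2 / (2 * (4 * h)))"
    unfolding exp_add[symmetric] using assms by (simp add: field_simps)
  moreover have "1 / sqrt (2 * pi * (2 * h)) = sqrt 2 * (1 / sqrt (2 * pi * (4 * h)))"
  proof -
    have "sqrt (2 * pi * (4 * h)) = sqrt 2 * sqrt (2 * pi * (2 * h))"
      unfolding real_sqrt_mult[symmetric] by simp
    then show ?thesis by (simp only:) (simp add: divide_simps)
  qed
  ultimately show ?thesis
    unfolding gauss_exp[OF mult_pos_pos[OF zero_less_numeral assms]]
    by (simp only: power_mult_distrib mult.assoc)
qed

lemma nn_integral_exp_neg_square:
  assumes "0 < a"
  shows "(\<integral>\<^sup>+x. ennreal (exp (- a * (norm (x::real^'d::finite))\<^sup>2)) \<partial>lborel) < \<infinity>"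
proof -
  define \<tau> where "\<tau> = 1 / (2 * a)"
  have \<tau>: "0 < \<tau>" using assms by (simp add: \<tau>_def)
  have "exp (- a * (norm x)\<^sup>2) = sqrt (2 * pi * \<tau>) ^ CARD('d) * gauss \<tau> x" for x :: "real^'d"
    using \<tau> assms by (simp add: gauss_exp power_divide power_one_over \<tau>_def)
  then have "(\<integral>\<^sup>+x. ennreal (exp (- a * (norm (x::real^'d))\<^sup>2)) \<partial>lborel)
      = ennreal (sqrt (2 * pi * \<tau>) ^ CARD('d)) * (\<integral>\<^sup>+x. ennreal (gauss \<tau> (x::real^'d)) \<partial>lborel)"
    using \<tau> by (subst nn_integral_cmult[symmetric]) (auto simp: ennreal_mult gauss_nonneg)
  then show ?thesis using \<tau> by (simp add: nn_integral_gauss)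
qed

lemma cube_le_exp_square:
  fixes a :: real
  assumes "0 < a"
  shows "\<exists>\<kappa>>0. \<forall>r\<ge>0. (1 + r) ^ 3 \<le> \<kappa> * exp (a * r\<^sup>2)"
proof (intro exI conjI allI impI)
  show "0 < 8 * (1 + 2 / a\<^sup>2)" using assms by (simp add: add_pos_nonneg)
  fix r :: real assume r: "0 \<le> r"
  have "(1 + r) ^ 3 \<le> 8 * (1 + r ^ 4)"
  proof (cases "r \<le> 1")
    case True
    then have "(1 + r) ^ 3 \<le> 2 ^ 3" using r by (intro power_mono) auto
    also have "\<dots> \<le> 8 * (1 + r ^ 4)" using r by simp
    finally show ?thesis .
  next
    case False
    then have "(1 + r) ^ 3 \<le> (2 * r) ^ 3" by (intro power_mono) auto
    also have "\<dots> = 8 * r ^ 3" by (simp add: power_mult_distrib)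
    also have "r ^ 3 \<le> r ^ 4" using False by (intro power_increasing) auto
    finally show ?thesis by simp
  qed
  \<comment> \<open>Up to the factor 2 / a^2, the fourth power is the quadratic Taylor term of
    \<open>exp (a * r^2)\<close>.\<close>
  also have "r ^ 4 = 2 / a\<^sup>2 * ((a * r\<^sup>2)\<^sup>2 / 2)" using assms by (simp add: power_mult_distrib)
  also have "(a * r\<^sup>2)\<^sup>2 / 2 \<le> exp (a * r\<^sup>2)"
    using exp_lower_Taylor_quadratic[of "a * r\<^sup>2"] assms r
    by (smt (verit, best) mult_nonneg_nonneg zero_le_power2)
  also have "1 \<le> exp (a * r\<^sup>2)" using assms by simp
  finally show "(1 + r) ^ 3 \<le> 8 * (1 + 2 / a\<^sup>2) * exp (a * r\<^sup>2)"
    using assms by (simp add: algebra_simps divide_right_mono)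
qed

text \<open>The law of w / sqrt h does not depend on h, whence one constant for all steps. The third
  power is the one that occurs in \<open>log_ratio_bound\<close>.\<close>

lemma gauss_noise_third_moment:
  "\<exists>c::real. \<forall>h>0. (\<integral>\<^sup>+w. ennreal ((1 + norm (w::real^'d::finite) / sqrt h) ^ 3) \<partial>gauss_noise (2 * h)) \<le> ennreal c"
proof -
  \<comment> \<open>The rate 1/8 is the one in \<open>gauss_times_exp\<close> for r = norm w / sqrt
    h.\<close>
  obtain \<kappa> :: real where \<kappa>: "0 < \<kappa>" "\<And>r. 0 \<le> r \<Longrightarrow> (1 + r) ^ 3 \<le> \<kappa> * exp (1 / 8 * r\<^sup>2)"
    using cube_le_exp_square[of "1 / 8"] by auto
  have "(\<integral>\<^sup>+w. ennreal ((1 + norm (w::real^'d) / sqrt h) ^ 3) \<partial>gauss_noise (2 * h)) \<le> ennreal (\<kappa> * sqrt 2 ^ CARD('d))"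
    if h: "0 < h" for h
  proof -
    have "(\<integral>\<^sup>+w. ennreal ((1 + norm (w::real^'d) / sqrt h) ^ 3) \<partial>gauss_noise (2 * h))
        = (\<integral>\<^sup>+w. ennreal (gauss (2 * h) w) * ennreal ((1 + norm (w::real^'d) / sqrt h) ^ 3) \<partial>lborel)"
      unfolding gauss_noise_def by (rule nn_integral_density) auto
    also have "\<dots> \<le> (\<integral>\<^sup>+w. ennreal (\<kappa> * sqrt 2 ^ CARD('d)) * ennreal (gauss (4 * h) (w::real^'d)) \<partial>lborel)"
    proof (intro nn_integral_mono)
      fix w :: "real^'d"
      have "(norm w / sqrt h)\<^sup>2 = (norm w)\<^sup>2 / h" using h by (simp add: power_divide)
      then have "(1 + norm w / sqrt h) ^ 3 \<le> \<kappa> * exp ((norm w)\<^sup>2 / (8 * h))"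
        using \<kappa>(2)[of "norm w / sqrt h"] h by (simp add: mult.commute)
      then have "gauss (2 * h) w * (1 + norm w / sqrt h) ^ 3 \<le> gauss (2 * h) w * (\<kappa> * exp ((norm w)\<^sup>2 / (8 * h)))"
        by (rule mult_left_mono[OF _ gauss_nonneg])
      also have "\<dots> = \<kappa> * (gauss (2 * h) w * exp ((norm w)\<^sup>2 / (8 * h)))" by simp
      also have "\<dots> = \<kappa> * sqrt 2 ^ CARD('d) * gauss (4 * h) w" unfolding gauss_times_exp[OF h] by simp
      finally show "ennreal (gauss (2 * h) w) * ennreal ((1 + norm w / sqrt h) ^ 3)
          \<le> ennreal (\<kappa> * sqrt 2 ^ CARD('d)) * ennreal (gauss (4 * h) w)"
        using h \<kappa>(1) by (simp add: ennreal_mult[symmetric] gauss_nonneg ennreal_leI)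
    qed
    also have "\<dots> = ennreal (\<kappa> * sqrt 2 ^ CARD('d)) * 1"
      using h by (subst nn_integral_cmult) (auto simp: nn_integral_gauss)
    finally show ?thesis by simp
  qed
  then show ?thesis by blast
qed

lemma nn_integral_lborel_shift:
  fixes f :: "'a::euclidean_space \<Rightarrow> ennreal"
  assumes [measurable]: "f \<in> borel_measurable borel"
  shows "(\<integral>\<^sup>+y. f (c + y) \<partial>lborel) = (\<integral>\<^sup>+y. f y \<partial>lborel)"
proof -
  have "(\<integral>\<^sup>+y. f y \<partial>lborel) = (\<integral>\<^sup>+y. f y \<partial>distr lborel borel ((+) c))"
    by (simp add: lborel_distr_plus)
  also have "\<dots> = (\<integral>\<^sup>+y. f (c + y) \<partial>lborel)" by (rule nn_integral_distr) auto
  finally show ?thesis by simp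
qed

lemma integral_lborel_shift:
  fixes f :: "'a::euclidean_space \<Rightarrow> real"
  assumes [measurable]: "f \<in> borel_measurable borel"
  shows "(LINT y|lborel. f (c + y)) = (LINT y|lborel. f y)"
proof -
  have "(LINT y|lborel. f y) = (LINT y|distr lborel borel ((+) c). f y)"
    by (simp add: lborel_distr_plus)
  also have "\<dots> = (LINT y|lborel. f (c + y))" by (rule integral_distr) auto
  finally show ?thesis by simp
qed

text \<open>A bound linear in the logarithm R of the ratio, with no smallness of R required. The sum
  a + b on the right serves both signs of R and becomes a symmetric density in the
  application.\<close>

lemma abs_exp_diff_le:
  fixes R a b :: real
  assumes "a = exp R * b" "0 \<le> b"
  shows "\<bar>a - b\<bar> \<le> \<bar>R\<bar> * (a + b)"
proof -
  have 1: "\<bar>exp R - 1\<bar> \<le> \<bar>R\<bar> * (exp R + 1)"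
  proof (cases "0 \<le> R")
    case True
    have "1 - R \<le> exp (- R)" using exp_ge_add_one_self[of "-R"] by simp
    then have "(1 - R) * exp R \<le> exp (- R) * exp R" by (rule mult_right_mono) simp
    then have "exp R - 1 \<le> R * exp R" by (simp add: exp_minus algebra_simps)
    also have "\<dots> \<le> R * (exp R + 1)" using True by (simp add: algebra_simps)
    finally show ?thesis using True by simp
  next
    case False
    have "1 - exp R \<le> - R" using exp_ge_add_one_self[of R] by linarith
    also have "\<dots> \<le> - R * (exp R + 1)" using False by (simp add: algebra_simps mult_nonpos_nonneg)
    finally show ?thesis using False by simp
  qed
  have "a - b = (exp R - 1) * b" using assms by (simp add: algebra_simps)
  then have "\<bar>a - b\<bar> = \<bar>exp R - 1\<bar> * b" using assms by (simp add: abs_mult)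
  also have "\<dots> \<le> \<bar>R\<bar> * (exp R + 1) * b" using 1 assms by (intro mult_right_mono) auto
  finally show ?thesis using assms by (simp add: algebra_simps)
qed

section \<open>The Gibbs measure of one fixed potential\<close>

text \<open>Consequences of admissibility at one time s; the third derivatives survive only in
  \<open>trapezoid\<close>. Taking 1 <= L lets powers of L be merged, and K / 4 is what remains of
  the convexity constant K / 2 after a linear term has been absorbed.\<close>

locale langevin_potential =
  fixes V :: "real^'d::finite \<Rightarrow> real" and K L C c :: real
  assumes prob_gibbs: "prob_space (gibbs V)"
    and continuous_V: "continuous_on UNIV V"
    and K_pos: "0 < K" and L_ge_1: "1 \<le> L" and C_nonneg: "0 \<le> C"
    and grad_lipschitz: "\<And>x y. norm (grad V x - grad V y) \<le> L * norm (x - y)"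
    and grad_growth: "\<And>x. norm (grad V x) \<le> L * (1 + norm x)"
    and trapezoid: "\<And>x y. \<bar>V y - V x - (grad V x + grad V y) \<bullet> (y - x) / 2\<bar> \<le> C * norm (y - x) ^ 3"
    and grad_monotone: "\<And>x y. K * (norm (y - x))\<^sup>2 \<le> (grad V y - grad V x) \<bullet> (y - x)"
    and V_lower: "\<And>x. c + K / 4 * (norm x)\<^sup>2 \<le> V x"
begin

abbreviation "\<pi> \<equiv> gibbs V"

sublocale gibbs: prob_space \<pi> by (rule prob_gibbs)

lemma sets_gibbs [simp, measurable_cong]: "sets \<pi> = sets borel"
  by (simp add: gibbs_def)

lemma space_gibbs [simp]: "space \<pi> = UNIV"
  by (simp add: gibbs_def)

lemma V_measurable [measurable]: "V \<in> borel_measurable borel"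
  using continuous_V by (rule borel_measurable_continuous_onI)

lemma continuous_grad: "continuous_on S (grad V)"
proof (rule continuous_onI)
  fix x :: "real^'d" and e :: real assume e: "0 < e"
  have "dist (grad V y) (grad V x) \<le> e" if "dist y x < e / L" for y
  proof -
    have "L * norm (y - x) \<le> L * (e / L)" using that L_ge_1 by (intro mult_left_mono) (auto simp: dist_norm)
    then show ?thesis using grad_lipschitz[of y x] L_ge_1 by (simp add: dist_norm)
  qed
  then show "\<exists>d>0. \<forall>x'\<in>S. dist x' x < d \<longrightarrow> dist (grad V x') (grad V x) \<le> e"
    using e L_ge_1 by (intro exI[of _ "e / L"]) auto
qed

lemma grad_measurable [measurable]: "grad V \<in> borel_measurable borel"
  by (rule borel_measurable_continuous_onI) (rule continuous_grad)

definition gibbs_density :: "real^'d \<Rightarrow> real" where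
  "gibbs_density x = exp (- V x) / (LINT y|lborel. exp (- V y))"

lemma gibbs_eq: "\<pi> = density lborel (\<lambda>x. ennreal (gibbs_density x))"
  by (simp add: gibbs_def gibbs_density_def)

lemma gibbs_density_measurable [measurable]: "gibbs_density \<in> borel_measurable borel"
  unfolding gibbs_density_def by measurable

text \<open>If the integral were 0, be it by the default for a non-integrable function, division by
  0 would make the density vanish, contradicting that the Gibbs measure has mass 1.\<close>

lemma normalization_pos: "0 < (LINT y|lborel. exp (- V y))"
proof (rule ccontr)
  assume "\<not> 0 < (LINT y|lborel. exp (- V y))"
  moreover have "0 \<le> (LINT y|lborel. exp (- V y))" by (rule integral_nonneg_AE) auto
  ultimately have "gibbs_density x = 0" for x by (simp add: gibbs_density_def)
  then have "emeasure \<pi> (space \<pi>) = 0" by (simp add: gibbs_eq emeasure_density)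
  then show False using gibbs.emeasure_space_1 by simp
qed

lemma gibbs_density_nonneg: "0 \<le> gibbs_density x"
  using normalization_pos by (simp add: gibbs_density_def)

lemma gibbs_third_moment: "(\<integral>\<^sup>+x. ennreal ((1 + norm x) ^ 3) \<partial>\<pi>) < \<infinity>"
proof -
  define Z where "Z = (LINT y|lborel. exp (- V y))"
  have Z: "0 < Z" using normalization_pos by (simp add: Z_def)
  \<comment> \<open>Half of the Gaussian decay K / 4 pays for the cube, and the other half keeps the
    integral finite.\<close>
  obtain \<kappa> where \<kappa>: "0 < \<kappa>" "\<And>r. 0 \<le> r \<Longrightarrow> (1 + r) ^ 3 \<le> \<kappa> * exp (K / 8 * r\<^sup>2)"
    using cube_le_exp_square[of "K / 8"] K_pos by auto
  have "(\<integral>\<^sup>+x. ennreal ((1 + norm x) ^ 3) \<partial>\<pi>) = (\<integral>\<^sup>+x. ennreal (gibbs_density x) * ennreal ((1 + norm x) ^ 3) \<partial>lborel)"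
    unfolding gibbs_eq by (rule nn_integral_density) auto
  also have "\<dots> \<le> (\<integral>\<^sup>+x. ennreal (\<kappa> * exp (- c) / Z) * ennreal (exp (- (K / 8) * (norm (x::real^'d))\<^sup>2)) \<partial>lborel)"
  proof (rule nn_integral_mono)
    fix x :: "real^'d"
    have "gibbs_density x \<le> exp (- (c + K / 4 * (norm x)\<^sup>2)) / Z"
      unfolding gibbs_density_def Z_def[symmetric] using Z V_lower[of x] by (intro divide_right_mono) auto
    then have "gibbs_density x * (1 + norm x) ^ 3
        \<le> (exp (- (c + K / 4 * (norm x)\<^sup>2)) / Z) * (\<kappa> * exp (K / 8 * (norm x)\<^sup>2))"
      using \<kappa>(2)[of "norm x"] Z by (intro mult_mono) auto
    also have "\<dots> = \<kappa> / Z * (exp (- (c + K / 4 * (norm x)\<^sup>2)) * exp (K / 8 * (norm x)\<^sup>2))" by simp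
    also have "\<dots> = \<kappa> / Z * (exp (- c) * exp (- (K / 8) * (norm x)\<^sup>2))"
      unfolding exp_add[symmetric] by (simp add: algebra_simps)
    finally have "gibbs_density x * (1 + norm x) ^ 3 \<le> \<kappa> * exp (- c) / Z * exp (- (K / 8) * (norm x)\<^sup>2)"
      by simp
    then show "ennreal (gibbs_density x) * ennreal ((1 + norm x) ^ 3)
        \<le> ennreal (\<kappa> * exp (- c) / Z) * ennreal (exp (- (K / 8) * (norm x)\<^sup>2))"
      using \<kappa>(1) Z gibbs_density_nonneg by (simp add: ennreal_mult[symmetric] ennreal_leI)
  qed
  also have "\<dots> = ennreal (\<kappa> * exp (- c) / Z) * (\<integral>\<^sup>+x. ennreal (exp (- (K / 8) * (norm (x::real^'d))\<^sup>2)) \<partial>lborel)"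
    by (rule nn_integral_cmult) auto
  also have "\<dots> < \<infinity>"
    using nn_integral_exp_neg_square[of "K / 8", where 'd = 'd] K_pos by (simp add: ennreal_mult_less_top)
  finally show ?thesis .
qed

lemma integrable_norm_gibbs: "integrable \<pi> (\<lambda>x. norm x)"
proof (rule integrableI_bounded)
  have "(\<integral>\<^sup>+x. ennreal (norm (norm x)) \<partial>\<pi>) \<le> (\<integral>\<^sup>+x. ennreal ((1 + norm x) ^ 3) \<partial>\<pi>)"
  proof (intro nn_integral_mono ennreal_leI)
    fix x :: "real^'d"
    have "(1 + norm x) ^ 1 \<le> (1 + norm x) ^ 3" by (intro power_increasing) auto
    then show "norm (norm x) \<le> (1 + norm x) ^ 3" by simp
  qed
  then show "(\<integral>\<^sup>+x. ennreal (norm (norm x)) \<partial>\<pi>) < \<infinity>" using gibbs_third_moment by (rule le_less_trans)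
qed auto

section \<open>The Euler kernel and approximate detailed balance\<close>

text \<open>Time is measured in units of \<open>\<epsilon>\<close>: a step h has drift
  \<open>h *\<^sub>R grad V x\<close> and noise of variance 2 h per coordinate, and
  \<open>\<epsilon>\<close> disappears.\<close>

definition euler_step :: "real \<Rightarrow> real^'d \<Rightarrow> real^'d \<Rightarrow> real^'d" where
  "euler_step h x w = x - h *\<^sub>R grad V x + w"

lemma euler_step_measurable [measurable]:
  "case_prod (euler_step h) \<in> borel_measurable (borel \<Otimes>\<^sub>M borel)"
  "euler_step h x \<in> borel_measurable borel"
  unfolding euler_step_def by measurable

definition euler_op :: "real \<Rightarrow> (real^'d \<Rightarrow> real) \<Rightarrow> real^'d \<Rightarrow> real" where
  "euler_op h b x = (LINT w|gauss_noise (2 * h). b (euler_step h x w))"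

lemma euler_op_measurable [measurable]:
  assumes [measurable]: "b \<in> borel_measurable borel" and "0 < h"
  shows "euler_op h b \<in> borel_measurable borel"
proof -
  interpret N: prob_space "gauss_noise (2 * h) :: (real^'d) measure"
    using assms by (intro prob_space_gauss_noise) simp
  show ?thesis unfolding euler_op_def euler_step_def by measurable
qed

lemma euler_op_integrable:
  fixes b :: "real^'d \<Rightarrow> real"
  assumes [measurable]: "b \<in> borel_measurable borel" and "0 < h" and "\<And>x. \<bar>b x\<bar> \<le> B"
  shows "integrable (gauss_noise (2 * h)) (\<lambda>w. b (euler_step h x w))"
proof -
  interpret N: prob_space "gauss_noise (2 * h) :: (real^'d) measure"
    using assms by (intro prob_space_gauss_noise) simp
  show ?thesis using assms by (intro N.integrable_const_bound[of _ B]) auto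
qed

lemma euler_op_bounded:
  fixes b :: "real^'d \<Rightarrow> real"
  assumes [measurable]: "b \<in> borel_measurable borel" and "0 < h" and "\<And>x. \<bar>b x\<bar> \<le> B"
  shows "\<bar>euler_op h b x\<bar> \<le> B"
proof -
  interpret N: prob_space "gauss_noise (2 * h) :: (real^'d) measure"
    using assms by (intro prob_space_gauss_noise) simp
  have "\<bar>euler_op h b x\<bar> \<le> (LINT w|gauss_noise (2 * h). \<bar>b (euler_step h x w)\<bar>)"
    unfolding euler_op_def by (rule integral_abs_bound)
  also have "\<dots> \<le> (LINT w|(gauss_noise (2 * h) :: (real^'d) measure). B)"
    using assms by (intro integral_mono integrable_abs euler_op_integrable) auto
  finally show ?thesis using N.prob_space by simp
qed

text \<open>The joint density of the first two states of the Euler chain started from the Gibbs measure.\<close>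

definition flow :: "real \<Rightarrow> real^'d \<Rightarrow> real^'d \<Rightarrow> real" where
  "flow h x y = gibbs_density x * gauss (2 * h) (y - x + h *\<^sub>R grad V x)"

definition log_ratio :: "real \<Rightarrow> real^'d \<Rightarrow> real^'d \<Rightarrow> real" where
  "log_ratio h x y = V y - V x - (grad V x + grad V y) \<bullet> (y - x) / 2
     - h / 4 * ((norm (grad V x))\<^sup>2 - (norm (grad V y))\<^sup>2)"

lemma flow_measurable [measurable]: "case_prod (flow h) \<in> borel_measurable (borel \<Otimes>\<^sub>M borel)"
  unfolding flow_def by measurable

lemma log_ratio_measurable [measurable]: "case_prod (log_ratio h) \<in> borel_measurable (borel \<Otimes>\<^sub>M borel)"
  unfolding log_ratio_def by measurable

lemma flow_nonneg: "0 \<le> flow h x y"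
  by (simp add: flow_def gibbs_density_nonneg gauss_nonneg)

lemma log_ratio_swap: "log_ratio h y x = - log_ratio h x y"
proof -
  have "x - y = - (y - x)" by simp
  then have "(grad V y + grad V x) \<bullet> (x - y) = - ((grad V x + grad V y) \<bullet> (y - x))"
    by (metis add.commute inner_minus_right)
  then show ?thesis unfolding log_ratio_def by (simp add: field_simps)
qed

text \<open>The normalizing constants and the squares of norm (y - x) cancel between the two
  directions. The cross terms, divided by 4 h, leave the trapezoidal sum of gradients, and the
  squares of the drift leave the gradient norms with factor h / 4.\<close>

lemma flow_ratio:
  assumes "0 < h"
  shows "flow h x y = exp (log_ratio h x y) * flow h y x"
proof -
  let ?g = "grad V"
  define A where "A = (norm (y - x + h *\<^sub>R ?g x))\<^sup>2"
  define B where "B = (norm (x - y + h *\<^sub>R ?g y))\<^sup>2"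
  have "A - B = 2 * h * ((?g x + ?g y) \<bullet> (y - x)) + h\<^sup>2 * ((norm (?g x))\<^sup>2 - (norm (?g y))\<^sup>2)"
    unfolding A_def B_def power2_norm_eq_inner
    by (simp add: inner_add_left inner_add_right inner_diff_left inner_diff_right inner_commute
        algebra_simps power2_eq_square)
  then have "(A - B) / (4 * h) = (?g x + ?g y) \<bullet> (y - x) / 2 + h / 4 * ((norm (?g x))\<^sup>2 - (norm (?g y))\<^sup>2)"
    using assms by (simp add: add_divide_distrib power2_eq_square)
  then have "log_ratio h x y = V y - V x - (A / (4 * h) - B / (4 * h))"
    unfolding log_ratio_def by (simp add: diff_divide_distrib)
  then have "exp (- V x) * exp (- A / (2 * (2 * h))) = exp (log_ratio h x y) * (exp (- V y) * exp (- B / (2 * (2 * h))))"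
    unfolding exp_add[symmetric] by simp
  then show ?thesis
    using assms unfolding flow_def gibbs_density_def
    by (simp add: gauss_exp A_def[symmetric] B_def[symmetric])
qed

text \<open>With E = L (1 + norm x) (1 + norm w / sqrt h), the step has length at most sqrt h E and
  both gradients are of order E. The trapezoidal remainder is then at most C (sqrt h E)^3, and the
  gradient term carries h * sqrt h * E^2, where E >= 1 allows E^3. The bound is a product, so that x
  and w can be integrated separately.\<close>

lemma log_ratio_bound:
  assumes h: "0 < h" "h \<le> 1"
  shows "\<bar>log_ratio h x (euler_step h x w)\<bar>
    \<le> (L ^ 3 * (C + L * (2 + L))) * (h * sqrt h) * ((1 + norm x) ^ 3 * (1 + norm w / sqrt h) ^ 3)"
proof -
  let ?g = "grad V"
  define s where "s = sqrt h"
  have s: "0 < s" "s \<le> 1" "s * s = h" using h by (auto simp: s_def)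
  define r where "r = norm w / s"
  have r: "0 \<le> r" "norm w = s * r" using s by (auto simp: r_def)
  define y where "y = euler_step h x w"
  define E where "E = L * (1 + norm x) * (1 + r)"
  have LX: "1 \<le> L * (1 + norm x)" using mult_mono[of 1 L 1 "1 + norm x"] L_ge_1 by simp
  have E1: "L * (1 + norm x) \<le> E"
    using mult_left_mono[of 1 "1 + r" "L * (1 + norm x)"] LX r by (simp add: E_def)
  then have E: "1 \<le> E" using LX by simp
  have yx: "norm (y - x) \<le> s * E"
  proof -
    have "y - x = - (h *\<^sub>R ?g x) + w" by (simp add: y_def euler_step_def)
    then have "norm (y - x) \<le> norm (h *\<^sub>R ?g x) + norm w" by (metis norm_minus_cancel norm_triangle_ineq)
    also have "\<dots> \<le> s * s * (L * (1 + norm x)) + s * r"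
      using grad_growth[of x] h s r by (simp add: mult_left_mono)
    also have "\<dots> \<le> s * (L * (1 + norm x)) + s * (L * (1 + norm x) * r)"
    proof (intro add_mono)
      show "s * s * (L * (1 + norm x)) \<le> s * (L * (1 + norm x))"
        using s LX by (intro mult_right_mono) (auto simp: mult_left_le)
      show "s * r \<le> s * (L * (1 + norm x) * r)"
        using s LX r by (intro mult_left_mono) (auto simp: mult_le_cancel_right1)
    qed
    also have "\<dots> = s * E" by (simp add: E_def algebra_simps)
    finally show ?thesis .
  qed
  have "\<bar>V y - V x - (?g x + ?g y) \<bullet> (y - x) / 2\<bar> \<le> C * (s * E) ^ 3"
    using yx C_nonneg by (intro order_trans[OF trapezoid] mult_left_mono power_mono) auto
  moreover have "\<bar>h / 4 * ((norm (?g x))\<^sup>2 - (norm (?g y))\<^sup>2)\<bar> \<le> L * (2 + L) * (s * E) ^ 3"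
  proof -
    have gx: "norm (?g x) \<le> E" using grad_growth[of x] E1 by simp
    have gyx: "norm (?g y - ?g x) \<le> L * (s * E)"
      using yx L_ge_1 by (intro order_trans[OF grad_lipschitz] mult_left_mono) auto
    have LE: "L * (s * E) \<le> L * E" using s E L_ge_1 by (intro mult_left_mono) (auto simp: mult_left_le_one_le)
    have gy: "norm (?g y) \<le> E + L * E"
      using norm_triangle_ineq[of "?g x" "?g y - ?g x"] gx gyx LE by simp
    have "\<bar>(norm (?g x))\<^sup>2 - (norm (?g y))\<^sup>2\<bar> = \<bar>norm (?g x) - norm (?g y)\<bar> * (norm (?g x) + norm (?g y))"
      by (simp add: power2_eq_square square_diff_square_factored abs_mult)
    also have "\<dots> \<le> (L * (s * E)) * (E + (E + L * E))"
      using gx gy gyx norm_triangle_ineq3[of "?g y" "?g x"]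
      by (intro mult_mono add_mono) (auto simp: abs_minus_commute intro: order_trans)
    also have "\<dots> = L * (2 + L) * s * E ^ 2" by (simp add: algebra_simps power2_eq_square)
    finally have "h / 4 * \<bar>(norm (?g x))\<^sup>2 - (norm (?g y))\<^sup>2\<bar> \<le> h / 4 * (L * (2 + L) * s * E ^ 2)"
      using h by (intro mult_left_mono) auto
    also have "\<dots> \<le> h * (L * (2 + L) * s * E ^ 3)"
    proof (intro mult_mono)
      show "E\<^sup>2 \<le> E ^ 3" using E by (intro power_increasing) auto
    qed (use h s E L_ge_1 in auto)
    also have "\<dots> = L * (2 + L) * (s * E) ^ 3"
      by (simp add: s(3)[symmetric] power_mult_distrib power3_eq_cube)
    finally show ?thesis using h by (simp add: abs_mult)
  qed
  ultimately have "\<bar>log_ratio h x y\<bar> \<le> C * (s * E) ^ 3 + L * (2 + L) * (s * E) ^ 3"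
    unfolding log_ratio_def by linarith
  also have "\<dots> = (L ^ 3 * (C + L * (2 + L))) * (h * s) * ((1 + norm x) ^ 3 * (1 + r) ^ 3)"
    by (simp add: E_def s(3)[symmetric] power_mult_distrib power3_eq_cube algebra_simps)
  finally show ?thesis by (simp add: y_def s_def r_def)
qed

text \<open>For fixed x, translating y by the drift turns the second factor of \<open>flow\<close>
  into the density of the noise.\<close>

lemma nn_integral_flow:
  assumes [measurable]: "case_prod F \<in> borel_measurable (borel \<Otimes>\<^sub>M borel)" and h: "0 < h"
  shows "(\<integral>\<^sup>+x. \<integral>\<^sup>+y. F x y * ennreal (flow h x y) \<partial>lborel \<partial>lborel)
    = (\<integral>\<^sup>+x. \<integral>\<^sup>+w. F x (euler_step h x w) \<partial>gauss_noise (2 * h) \<partial>\<pi>)"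
proof -
  have "(\<integral>\<^sup>+y. F x y * ennreal (flow h x y) \<partial>lborel)
      = ennreal (gibbs_density x) * (\<integral>\<^sup>+w. F x (euler_step h x w) \<partial>gauss_noise (2 * h))" for x
  proof -
    have "(\<integral>\<^sup>+y. F x y * ennreal (flow h x y) \<partial>lborel)
      = (\<integral>\<^sup>+w. F x (x - h *\<^sub>R grad V x + w) * ennreal (flow h x (x - h *\<^sub>R grad V x + w)) \<partial>lborel)"
      by (rule nn_integral_lborel_shift[symmetric]) measurable
    also have "\<dots> = (\<integral>\<^sup>+w. ennreal (gibbs_density x) * (ennreal (gauss (2 * h) w) * F x (euler_step h x w)) \<partial>lborel)"
      by (intro nn_integral_cong)
         (simp add: flow_def euler_step_def ennreal_mult gibbs_density_nonneg gauss_nonneg mult_ac)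
    also have "\<dots> = ennreal (gibbs_density x) * (\<integral>\<^sup>+w. ennreal (gauss (2 * h) w) * F x (euler_step h x w) \<partial>lborel)"
      by (rule nn_integral_cmult) measurable
    also have "(\<integral>\<^sup>+w. ennreal (gauss (2 * h) w) * F x (euler_step h x w) \<partial>lborel)
       = (\<integral>\<^sup>+w. F x (euler_step h x w) \<partial>gauss_noise (2 * h))"
      unfolding gauss_noise_def by (rule nn_integral_density[symmetric]) measurable
    finally show ?thesis .
  qed
  moreover have "(\<integral>\<^sup>+x. \<integral>\<^sup>+w. F x (euler_step h x w) \<partial>gauss_noise (2 * h) \<partial>\<pi>)
      = (\<integral>\<^sup>+x. ennreal (gibbs_density x) * (\<integral>\<^sup>+w. F x (euler_step h x w) \<partial>gauss_noise (2 * h)) \<partial>lborel)"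
  proof -
    interpret N: prob_space "gauss_noise (2 * h) :: (real^'d) measure"
      using h by (intro prob_space_gauss_noise) simp
    show ?thesis unfolding gibbs_eq by (rule nn_integral_density) measurable
  qed
  ultimately show ?thesis by simp
qed

end

context langevin_potential
begin

lemma nn_integral_flow_pair:
  assumes [measurable]: "case_prod F \<in> borel_measurable (borel \<Otimes>\<^sub>M borel)" and h: "0 < h"
  shows "(\<integral>\<^sup>+p. (case p of (x, y) \<Rightarrow> F x y * ennreal (flow h x y)) \<partial>(lborel \<Otimes>\<^sub>M lborel))
    = (\<integral>\<^sup>+x. \<integral>\<^sup>+w. F x (euler_step h x w) \<partial>gauss_noise (2 * h) \<partial>\<pi>)"
proof -
  have "(\<lambda>p. case p of (x, y) \<Rightarrow> F x y * ennreal (flow h x y)) \<in> borel_measurable (lborel \<Otimes>\<^sub>M lborel)"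
    by measurable
  from lborel.nn_integral_fst[OF this] show ?thesis
    using nn_integral_flow[OF assms] by simp
qed

lemma flow_integrable:
  assumes "0 < h"
  shows "integrable (lborel \<Otimes>\<^sub>M lborel) (\<lambda>p. flow h (fst p) (snd p))"
proof -
  interpret N: prob_space "gauss_noise (2 * h) :: (real^'d) measure"
    using assms by (intro prob_space_gauss_noise) simp
  have "(\<integral>\<^sup>+p. ennreal (flow h (fst p) (snd p)) \<partial>(lborel \<Otimes>\<^sub>M lborel)) = 1"
    using nn_integral_flow_pair[OF _ assms, of "\<lambda>_ _. 1"] N.emeasure_space_1 gibbs.emeasure_space_1
    by (simp add: case_prod_beta')
  then show ?thesis
    by (intro integrableI_bounded) (auto simp: flow_nonneg case_prod_beta'[symmetric])
qed

text \<open>The L1 distance between the joint density and its transpose. By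
  \<open>abs_exp_diff_le\<close> it is at most the integral of the absolute log ratio against both
  densities; exchanging x and y identifies the two parts, hence the factor 2 in D, and the moments
  of the Gibbs measure and of the noise factorize.\<close>

lemma flow_asymmetry:
  "\<exists>D\<ge>0. \<forall>h. 0 < h \<and> h \<le> 1 \<longrightarrow>
    (\<integral>\<^sup>+p. ennreal \<bar>flow h (fst p) (snd p) - flow h (snd p) (fst p)\<bar> \<partial>(lborel \<Otimes>\<^sub>M lborel)) \<le> ennreal (D * (h * sqrt h))"
proof -
  define c1 where "c1 = L ^ 3 * (C + L * (2 + L))"
  have c1: "0 \<le> c1" using L_ge_1 C_nonneg by (simp add: c1_def)
  obtain c2 where c2: "\<And>h. 0 < h \<Longrightarrow>
      (\<integral>\<^sup>+w. ennreal ((1 + norm (w::real^'d) / sqrt h) ^ 3) \<partial>gauss_noise (2 * h)) \<le> ennreal c2"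
    using gauss_noise_third_moment[where 'd = 'd] by blast
  obtain m where m: "0 \<le> m" "(\<integral>\<^sup>+x. ennreal ((1 + norm x) ^ 3) \<partial>\<pi>) = ennreal m"
    using gibbs_third_moment by (cases "\<integral>\<^sup>+x. ennreal ((1 + norm x) ^ 3) \<partial>\<pi>") auto
  \<comment> \<open>A negative \<open>c2\<close> is read as 0 by \<open>ennreal\<close>, which the
    maximum reproduces.\<close>
  define D where "D = 2 * c1 * m * max 0 c2"
  have "(\<integral>\<^sup>+p. ennreal \<bar>flow h (fst p) (snd p) - flow h (snd p) (fst p)\<bar> \<partial>(lborel \<Otimes>\<^sub>M lborel)) \<le> ennreal (D * (h * sqrt h))"
    if h: "0 < h" "h \<le> 1" for h
  proof -
    let ?F = "\<lambda>x y. ennreal \<bar>log_ratio h x y\<bar> * ennreal (flow h x y)"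
    let ?I = "\<integral>\<^sup>+p. (case p of (x, y) \<Rightarrow> ?F x y) \<partial>(lborel \<Otimes>\<^sub>M lborel)"
    have F_meas [measurable]: "case_prod ?F \<in> borel_measurable (borel \<Otimes>\<^sub>M borel)" by measurable
    have "(\<integral>\<^sup>+p. ennreal \<bar>flow h (fst p) (snd p) - flow h (snd p) (fst p)\<bar> \<partial>(lborel \<Otimes>\<^sub>M lborel))
      \<le> (\<integral>\<^sup>+p. (case p of (x, y) \<Rightarrow> ?F x y) + (case p of (x, y) \<Rightarrow> ?F y x) \<partial>(lborel \<Otimes>\<^sub>M lborel))"
    proof (intro nn_integral_mono)
      fix p :: "(real^'d) \<times> (real^'d)"
      obtain x y where p: "p = (x, y)" by (cases p)
      have "\<bar>flow h x y - flow h y x\<bar> \<le> \<bar>log_ratio h x y\<bar> * (flow h x y + flow h y x)"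
        using flow_ratio[OF h(1)] flow_nonneg by (rule abs_exp_diff_le)
      also have "\<dots> = \<bar>log_ratio h x y\<bar> * flow h x y + \<bar>log_ratio h y x\<bar> * flow h y x"
        by (simp add: log_ratio_swap[of h y x] distrib_left)
      finally show "ennreal \<bar>flow h (fst p) (snd p) - flow h (snd p) (fst p)\<bar>
          \<le> (case p of (x, y) \<Rightarrow> ?F x y) + (case p of (x, y) \<Rightarrow> ?F y x)"
        by (simp add: p ennreal_mult[symmetric] flow_nonneg ennreal_plus[symmetric] ennreal_leI del: ennreal_plus)
    qed
    also have "\<dots> = ?I + (\<integral>\<^sup>+p. (case p of (x, y) \<Rightarrow> ?F y x) \<partial>(lborel \<Otimes>\<^sub>M lborel))"
      by (rule nn_integral_add) measurable
    also have "(\<integral>\<^sup>+p. (case p of (x, y) \<Rightarrow> ?F y x) \<partial>(lborel \<Otimes>\<^sub>M lborel)) = ?I"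
    proof -
      have "?I = (\<integral>\<^sup>+p. (case p of (x, y) \<Rightarrow> ?F x y) \<partial>distr (lborel \<Otimes>\<^sub>M lborel) (lborel \<Otimes>\<^sub>M lborel) (\<lambda>(x, y). (y, x)))"
        by (subst lborel_pair.distr_pair_swap[symmetric]) (rule refl)
      also have "\<dots> = (\<integral>\<^sup>+p. (case p of (x, y) \<Rightarrow> ?F y x) \<partial>(lborel \<Otimes>\<^sub>M lborel))"
        by (subst nn_integral_distr) (auto simp: case_prod_beta')
      finally show ?thesis by simp
    qed
    also have "?I = (\<integral>\<^sup>+x. \<integral>\<^sup>+w. ennreal \<bar>log_ratio h x (euler_step h x w)\<bar> \<partial>gauss_noise (2 * h) \<partial>\<pi>)"
      by (rule nn_integral_flow_pair[OF _ h(1)]) measurable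
    also have "\<dots> \<le> (\<integral>\<^sup>+x. ennreal (c1 * (h * sqrt h)) * (ennreal ((1 + norm x) ^ 3) * ennreal c2) \<partial>\<pi>)"
    proof (intro nn_integral_mono)
      fix x :: "real^'d"
      have "(\<integral>\<^sup>+w. ennreal \<bar>log_ratio h x (euler_step h x w)\<bar> \<partial>gauss_noise (2 * h))
        \<le> (\<integral>\<^sup>+w. ennreal (c1 * (h * sqrt h) * (1 + norm x) ^ 3) * ennreal ((1 + norm (w::real^'d) / sqrt h) ^ 3) \<partial>gauss_noise (2 * h))"
      proof (intro nn_integral_mono)
        fix w :: "real^'d"
        show "ennreal \<bar>log_ratio h x (euler_step h x w)\<bar>
            \<le> ennreal (c1 * (h * sqrt h) * (1 + norm x) ^ 3) * ennreal ((1 + norm w / sqrt h) ^ 3)"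
          using log_ratio_bound[OF h, of x w] h c1
          by (simp add: ennreal_mult[symmetric] c1_def[symmetric] mult.assoc ennreal_leI)
      qed
      also have "\<dots> = ennreal (c1 * (h * sqrt h) * (1 + norm x) ^ 3) *
          (\<integral>\<^sup>+w. ennreal ((1 + norm (w::real^'d) / sqrt h) ^ 3) \<partial>gauss_noise (2 * h))"
        by (rule nn_integral_cmult) measurable
      also have "\<dots> \<le> ennreal (c1 * (h * sqrt h) * (1 + norm x) ^ 3) * ennreal c2"
        by (intro mult_left_mono c2 h) auto
      also have "\<dots> = ennreal (c1 * (h * sqrt h)) * (ennreal ((1 + norm x) ^ 3) * ennreal c2)"
      proof -
        have "ennreal (c1 * (h * sqrt h) * (1 + norm x) ^ 3) = ennreal (c1 * (h * sqrt h)) * ennreal ((1 + norm x) ^ 3)"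
          using h c1 by (intro ennreal_mult) auto
        then show ?thesis by (simp only: mult.assoc)
      qed
      finally show "(\<integral>\<^sup>+w. ennreal \<bar>log_ratio h x (euler_step h x w)\<bar> \<partial>gauss_noise (2 * h))
          \<le> ennreal (c1 * (h * sqrt h)) * (ennreal ((1 + norm x) ^ 3) * ennreal c2)" .
    qed
    also have "\<dots> = ennreal (c1 * (h * sqrt h)) * (ennreal m * ennreal c2)"
      by (subst nn_integral_cmult, measurable, subst nn_integral_multc, measurable) (simp add: m)
    also have "\<dots> = ennreal (c1 * (h * sqrt h) * (m * max 0 c2))"
    proof -
      have "ennreal c2 = ennreal (max 0 c2)" by (simp add: max_def ennreal_neg)
      then show ?thesis using h c1 m by (simp add: ennreal_mult)
    qed
    finally have "(\<integral>\<^sup>+p. ennreal \<bar>flow h (fst p) (snd p) - flow h (snd p) (fst p)\<bar> \<partial>(lborel \<Otimes>\<^sub>M lborel))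
       \<le> ennreal (c1 * (h * sqrt h) * (m * max 0 c2)) + ennreal (c1 * (h * sqrt h) * (m * max 0 c2))"
      by (simp add: add_mono)
    also have "\<dots> = ennreal (D * (h * sqrt h))"
      using h c1 m by (subst ennreal_plus[symmetric]) (auto simp: D_def algebra_simps)
    finally show ?thesis .
  qed
  moreover have "0 \<le> D" using c1 m by (simp add: D_def)
  ultimately show ?thesis by blast
qed

lemma euler_op_pairing:
  assumes [measurable]: "u \<in> borel_measurable borel" "v \<in> borel_measurable borel" and h: "0 < h"
    and A: "\<And>x. \<bar>u x\<bar> \<le> A" and B: "\<And>x. \<bar>v x\<bar> \<le> B"
  shows "integrable (lborel \<Otimes>\<^sub>M lborel) (\<lambda>p. u (fst p) * v (snd p) * flow h (fst p) (snd p))"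
    and "(LINT x|\<pi>. u x * euler_op h v x) = (LINT p|(lborel \<Otimes>\<^sub>M lborel). u (fst p) * v (snd p) * flow h (fst p) (snd p))"
proof -
  have A0: "0 \<le> A" using A[of undefined] abs_ge_zero order_trans by blast
  have uv: "\<bar>u x * v y\<bar> \<le> A * B" for x y
    unfolding abs_mult by (intro mult_mono A B A0) auto
  show int: "integrable (lborel \<Otimes>\<^sub>M lborel) (\<lambda>p. u (fst p) * v (snd p) * flow h (fst p) (snd p))"
  proof (rule Bochner_Integration.integrable_bound[OF integrable_mult_right[OF flow_integrable[OF h], of "A * B"]])
    show "AE p in lborel \<Otimes>\<^sub>M lborel. norm (u (fst p) * v (snd p) * flow h (fst p) (snd p)) \<le> norm (A * B * flow h (fst p) (snd p))"
      using uv by (intro AE_I2) (simp add: abs_mult[of _ "flow _ _ _"] mult_right_mono order_trans[OF _ abs_ge_self])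
  qed measurable
  have inner: "(LINT y|lborel. u x * v y * flow h x y) = gibbs_density x * (u x * euler_op h v x)" for x
  proof -
    have "(LINT y|lborel. u x * v y * flow h x y)
        = (LINT w|lborel. u x * v (x - h *\<^sub>R grad V x + w) * flow h x (x - h *\<^sub>R grad V x + w))"
      by (rule integral_lborel_shift[symmetric]) measurable
    also have "\<dots> = (LINT w|lborel. gibbs_density x * u x * (gauss (2 * h) w * v (euler_step h x w)))"
      by (intro Bochner_Integration.integral_cong refl) (simp add: flow_def euler_step_def mult_ac)
    also have "\<dots> = gibbs_density x * u x * (LINT w|lborel. gauss (2 * h) w * v (euler_step h x w))"
      by simp
    also have "(LINT w|lborel. gauss (2 * h) w * v (euler_step h x w)) = euler_op h v x"
      unfolding euler_op_def gauss_noise_def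
      by (subst integral_density) (auto simp: gauss_nonneg)
    finally show ?thesis by (simp add: mult.assoc)
  qed
  have "(LINT x|\<pi>. u x * euler_op h v x) = (LINT x|lborel. gibbs_density x * (u x * euler_op h v x))"
    unfolding gibbs_eq using h by (subst integral_density) (auto simp: gibbs_density_nonneg)
  also have "\<dots> = (LINT x|lborel. LINT y|lborel. u x * v y * flow h x y)" by (simp add: inner)
  also have "\<dots> = (LINT p|(lborel \<Otimes>\<^sub>M lborel). u (fst p) * v (snd p) * flow h (fst p) (snd p))"
    using lborel_pair.integral_fst'[OF int] by simp
  finally show "(LINT x|\<pi>. u x * euler_op h v x) = (LINT p|(lborel \<Otimes>\<^sub>M lborel). u (fst p) * v (snd p) * flow h (fst p) (snd p))" .
qed

text \<open>The L1 bound on the asymmetry of \<open>flow\<close>, tested against the bounded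
  function u(x) v(y). The constant is uniform in u and v, so it can be used along iterates.\<close>

lemma euler_op_almost_symmetric:
  "\<exists>D\<ge>0. \<forall>h u v A B. 0 < h \<and> h \<le> 1 \<and> u \<in> borel_measurable borel \<and> v \<in> borel_measurable borel \<and>
      (\<forall>x. \<bar>u x\<bar> \<le> A) \<and> (\<forall>x. \<bar>v x\<bar> \<le> B) \<longrightarrow>
    \<bar>(LINT x|\<pi>. u x * euler_op h v x) - (LINT x|\<pi>. euler_op h u x * v x)\<bar> \<le> D * (h * sqrt h) * A * B"
proof -
  obtain D where D: "0 \<le> D" "\<And>h. 0 < h \<Longrightarrow> h \<le> 1 \<Longrightarrow>
    (\<integral>\<^sup>+p. ennreal \<bar>flow h (fst p) (snd p) - flow h (snd p) (fst p)\<bar> \<partial>(lborel \<Otimes>\<^sub>M lborel)) \<le> ennreal (D * (h * sqrt h))"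
    using flow_asymmetry by blast
  have "\<bar>(LINT x|\<pi>. u x * euler_op h v x) - (LINT x|\<pi>. euler_op h u x * v x)\<bar> \<le> D * (h * sqrt h) * A * B"
    if h: "0 < h" "h \<le> 1" and [measurable]: "u \<in> borel_measurable borel" "v \<in> borel_measurable borel"
      and A: "\<And>x. \<bar>u x\<bar> \<le> A" and B: "\<And>x. \<bar>v x\<bar> \<le> B" for h u v A B
  proof -
    let ?M = "lborel \<Otimes>\<^sub>M lborel :: ((real^'d) \<times> (real^'d)) measure"
    have A0: "0 \<le> A" and B0: "0 \<le> B"
      using A[of undefined] B[of undefined] abs_ge_zero order_trans by blast+
    note uv = euler_op_pairing[of u v h A B, OF _ _ h(1) A B]
    note vu = euler_op_pairing[of v u h B A, OF _ _ h(1) B A]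
    have int1: "integrable ?M (\<lambda>p. u (fst p) * v (snd p) * flow h (fst p) (snd p))" by (rule uv) measurable
    have int2: "integrable ?M (\<lambda>p. v (fst p) * u (snd p) * flow h (fst p) (snd p))" by (rule vu) measurable
    from lborel_pair.integrable_product_swap[OF int2]
    have int3: "integrable ?M (\<lambda>p. u (fst p) * v (snd p) * flow h (snd p) (fst p))"
      by (simp add: case_prod_beta' mult.commute mult.left_commute)
    have int4: "integrable ?M (\<lambda>p. flow h (fst p) (snd p) - flow h (snd p) (fst p))"
      using flow_integrable[OF h(1)] lborel_pair.integrable_product_swap[OF flow_integrable[OF h(1)]]
      by (simp add: case_prod_beta')
    have "(LINT x|\<pi>. euler_op h u x * v x) = (LINT p|?M. v (fst p) * u (snd p) * flow h (fst p) (snd p))"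
      using vu(2) by (simp add: mult.commute)
    also have "\<dots> = (LINT p|?M. u (fst p) * v (snd p) * flow h (snd p) (fst p))"
      using lborel_pair.integral_product_swap[OF borel_measurable_integrable[OF int2]]
      by (simp add: case_prod_beta' mult_ac)
    finally have "(LINT x|\<pi>. u x * euler_op h v x) - (LINT x|\<pi>. euler_op h u x * v x)
       = (LINT p|?M. u (fst p) * v (snd p) * (flow h (fst p) (snd p) - flow h (snd p) (fst p)))"
      using uv(2) int1 int3 by (simp add: right_diff_distrib)
    also have "\<bar>\<dots>\<bar> \<le> (LINT p|?M. A * B * \<bar>flow h (fst p) (snd p) - flow h (snd p) (fst p)\<bar>)"
    proof (rule order_trans[OF integral_abs_bound], rule integral_mono)
      show "integrable ?M (\<lambda>p. \<bar>u (fst p) * v (snd p) * (flow h (fst p) (snd p) - flow h (snd p) (fst p))\<bar>)"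
        using int1 int3 by (simp add: right_diff_distrib)
      show "integrable ?M (\<lambda>p. A * B * \<bar>flow h (fst p) (snd p) - flow h (snd p) (fst p)\<bar>)" using int4 by simp
      fix p :: "(real^'d) \<times> (real^'d)"
      show "\<bar>u (fst p) * v (snd p) * (flow h (fst p) (snd p) - flow h (snd p) (fst p))\<bar>
          \<le> A * B * \<bar>flow h (fst p) (snd p) - flow h (snd p) (fst p)\<bar>"
        unfolding abs_mult by (intro mult_right_mono mult_mono A B A0) auto
    qed
    also have "\<dots> = A * B * (LINT p|?M. \<bar>flow h (fst p) (snd p) - flow h (snd p) (fst p)\<bar>)" by simp
    also have "\<dots> \<le> A * B * (D * (h * sqrt h))"
    proof (intro mult_left_mono)
      have "ennreal (LINT p|?M. \<bar>flow h (fst p) (snd p) - flow h (snd p) (fst p)\<bar>) \<le> ennreal (D * (h * sqrt h))"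
        using D(2)[OF h] int4 by (subst nn_integral_eq_integral[symmetric]) auto
      then show "(LINT p|?M. \<bar>flow h (fst p) (snd p) - flow h (snd p) (fst p)\<bar>) \<le> D * (h * sqrt h)"
        using D(1) h by (simp add: ennreal_le_iff)
    qed (use A0 B0 in auto)
    finally show ?thesis by (simp add: mult_ac)
  qed
  with D(1) show ?thesis by blast
qed

lemma euler_op_iterate:
  fixes b :: "real^'d \<Rightarrow> real"
  assumes "b \<in> borel_measurable borel" and "0 < h" and "\<And>x. \<bar>b x\<bar> \<le> B"
  shows "(euler_op h ^^ n) b \<in> borel_measurable borel" and "\<bar>(euler_op h ^^ n) b x\<bar> \<le> B"
proof -
  have "(euler_op h ^^ n) b \<in> borel_measurable borel \<and> (\<forall>x. \<bar>(euler_op h ^^ n) b x\<bar> \<le> B)"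
  proof (induction n)
    case 0
    then show ?case using assms by simp
  next
    case (Suc n)
    then show ?case
      using assms(2) euler_op_measurable[of "(euler_op h ^^ n) b" h]
        euler_op_bounded[of "(euler_op h ^^ n) b" h B] by auto
  qed
  then show "(euler_op h ^^ n) b \<in> borel_measurable borel" "\<bar>(euler_op h ^^ n) b x\<bar> \<le> B" by auto
qed

lemma euler_op_const: "0 < h \<Longrightarrow> (euler_op h ^^ n) (\<lambda>_. a) = (\<lambda>_. a)"
proof (induction n)
  case (Suc n)
  interpret N: prob_space "gauss_noise (2 * h) :: (real^'d) measure"
    using Suc by (intro prob_space_gauss_noise) simp
  show ?case using Suc N.prob_space by (simp add: euler_op_def)
qed simp

text \<open>One application of the kernel at a time is moved from v to u. The kernel does not
  increase sup norms, so each move costs the same and the errors add up to n times one of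
  them.\<close>

lemma euler_op_iterate_almost_symmetric:
  "\<exists>D\<ge>0. \<forall>n h u v A B. 0 < h \<and> h \<le> 1 \<and> u \<in> borel_measurable borel \<and> v \<in> borel_measurable borel \<and>
      (\<forall>x. \<bar>u x\<bar> \<le> A) \<and> (\<forall>x. \<bar>v x\<bar> \<le> B) \<longrightarrow>
    \<bar>(LINT x|\<pi>. u x * (euler_op h ^^ n) v x) - (LINT x|\<pi>. (euler_op h ^^ n) u x * v x)\<bar>
      \<le> real n * (D * (h * sqrt h) * A * B)"
proof -
  obtain D where D: "0 \<le> D" "\<And>h u v A B. 0 < h \<Longrightarrow> h \<le> 1 \<Longrightarrow> u \<in> borel_measurable borel \<Longrightarrow>
      v \<in> borel_measurable borel \<Longrightarrow> (\<And>x. \<bar>u x\<bar> \<le> A) \<Longrightarrow> (\<And>x. \<bar>v x\<bar> \<le> B) \<Longrightarrow>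
    \<bar>(LINT x|\<pi>. u x * euler_op h v x) - (LINT x|\<pi>. euler_op h u x * v x)\<bar> \<le> D * (h * sqrt h) * A * B"
    using euler_op_almost_symmetric by blast
  have "\<bar>(LINT x|\<pi>. u x * (euler_op h ^^ n) v x) - (LINT x|\<pi>. (euler_op h ^^ n) u x * v x)\<bar>
      \<le> real n * (D * (h * sqrt h) * A * B)"
    if h: "0 < h" "h \<le> 1" and meas: "u \<in> borel_measurable borel" "v \<in> borel_measurable borel"
      and A: "\<And>x. \<bar>u x\<bar> \<le> A" and B: "\<And>x. \<bar>v x\<bar> \<le> B" for n h u v A B
    using meas(1) A
  proof (induction n arbitrary: u)
    case (Suc n)
    note vn = euler_op_iterate[OF meas(2) h(1) B, of n]
    have "\<bar>(LINT x|\<pi>. u x * euler_op h ((euler_op h ^^ n) v) x) - (LINT x|\<pi>. euler_op h u x * (euler_op h ^^ n) v x)\<bar>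
        \<le> D * (h * sqrt h) * A * B"
      by (rule D(2)[OF h Suc.prems(1) vn(1) Suc.prems(2) vn(2)])
    moreover have "\<bar>(LINT x|\<pi>. euler_op h u x * (euler_op h ^^ n) v x) - (LINT x|\<pi>. (euler_op h ^^ n) (euler_op h u) x * v x)\<bar>
        \<le> real n * (D * (h * sqrt h) * A * B)"
      by (rule Suc.IH[OF euler_op_measurable[OF Suc.prems(1) h(1)] euler_op_bounded[OF Suc.prems(1) h(1) Suc.prems(2)]])
    moreover have "(euler_op h ^^ n) (euler_op h u) = (euler_op h ^^ Suc n) u"
      by (simp add: funpow_swap1)
    ultimately show ?case by (simp add: algebra_simps)
  qed simp
  with D(1) show ?thesis by blast
qed

section \<open>Contraction of the Euler chain\<close>

text \<open>Synchronous coupling: both chains use the same noise, which cancels in the difference.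
  Strong monotonicity of the gradient contributes -2 h K to the squared distance and the Lipschitz
  bound h^2 L^2, of which h <= K / L^2 lets at most h K survive; the square root of exp (- h K) is
  the stated factor.\<close>

lemma euler_op_lipschitz:
  fixes b :: "real^'d \<Rightarrow> real"
  assumes meas: "b \<in> borel_measurable borel" and B: "\<And>x. \<bar>b x\<bar> \<le> B"
    and lip: "\<And>x y. \<bar>b x - b y\<bar> \<le> \<Lambda> * norm (x - y)" and h: "0 < h" "h \<le> K / L\<^sup>2"
  shows "\<bar>euler_op h b x - euler_op h b y\<bar> \<le> \<Lambda> * exp (- (h * K / 2)) * norm (x - y)"
proof -
  interpret N: prob_space "gauss_noise (2 * h) :: (real^'d) measure"
    using h by (intro prob_space_gauss_noise) simp
  have \<Lambda>: "0 \<le> \<Lambda>"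
  proof -
    have "0 \<le> \<bar>b (axis undefined 1) - b 0\<bar>" by simp
    also have "\<dots> \<le> \<Lambda> * norm (axis undefined 1 - 0 :: real^'d)" by (rule lip)
    finally show ?thesis by (simp add: norm_axis_1)
  qed
  have contract: "norm (euler_step h x w - euler_step h y w) \<le> exp (- (h * K / 2)) * norm (x - y)" for w
  proof (rule power2_le_imp_le)
    let ?d = "grad V x - grad V y"
    have "(norm (euler_step h x w - euler_step h y w))\<^sup>2 = (norm ((x - y) - h *\<^sub>R ?d))\<^sup>2"
      by (simp add: euler_step_def algebra_simps)
    also have "\<dots> = (norm (x - y))\<^sup>2 - 2 * h * (?d \<bullet> (x - y)) + h * (h * (norm ?d)\<^sup>2)"
      unfolding power2_norm_eq_inner
      by (simp add: inner_diff_left inner_diff_right inner_commute algebra_simps)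
    also have "\<dots> \<le> (norm (x - y))\<^sup>2 - 2 * h * (K * (norm (x - y))\<^sup>2) + h * (K * (norm (x - y))\<^sup>2)"
    proof (intro add_mono diff_mono mult_left_mono grad_monotone order_refl)
      have "h * (norm ?d)\<^sup>2 \<le> K / L\<^sup>2 * (L * norm (x - y))\<^sup>2"
        using h K_pos grad_lipschitz by (intro mult_mono power_mono) auto
      then show "h * (norm ?d)\<^sup>2 \<le> K * (norm (x - y))\<^sup>2"
        using L_ge_1 by (simp add: power_mult_distrib)
    qed (use h in auto)
    also have "\<dots> = (1 - h * K) * (norm (x - y))\<^sup>2" by (simp add: algebra_simps)
    also have "\<dots> \<le> exp (- (h * K)) * (norm (x - y))\<^sup>2"
      using exp_ge_add_one_self[of "- (h * K)"] by (intro mult_right_mono) auto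
    also have "exp (- (h * K)) = (exp (- (h * K / 2)))\<^sup>2" by (simp add: exp_double[symmetric])
    finally show "(norm (euler_step h x w - euler_step h y w))\<^sup>2 \<le> (exp (- (h * K / 2)) * norm (x - y))\<^sup>2"
      by (simp add: power_mult_distrib)
  qed simp
  have int: "integrable (gauss_noise (2 * h)) (\<lambda>w. b (euler_step h x w))" for x
    by (rule euler_op_integrable[OF meas h(1) B])
  have "euler_op h b x - euler_op h b y = (LINT w|gauss_noise (2 * h). b (euler_step h x w) - b (euler_step h y w))"
    unfolding euler_op_def using int by simp
  also have "\<bar>\<dots>\<bar> \<le> (LINT w|(gauss_noise (2 * h) :: (real^'d) measure). \<Lambda> * exp (- (h * K / 2)) * norm (x - y))"
  proof (rule order_trans[OF integral_abs_bound], rule integral_mono)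
    fix w :: "real^'d"
    have "\<bar>b (euler_step h x w) - b (euler_step h y w)\<bar> \<le> \<Lambda> * (exp (- (h * K / 2)) * norm (x - y))"
      using contract \<Lambda> by (intro order_trans[OF lip] mult_left_mono)
    then show "\<bar>b (euler_step h x w) - b (euler_step h y w)\<bar> \<le> \<Lambda> * exp (- (h * K / 2)) * norm (x - y)"
      by simp
  qed (use int in auto)
  finally show ?thesis using N.prob_space by simp
qed

lemma euler_op_iterate_lipschitz:
  fixes b :: "real^'d \<Rightarrow> real"
  assumes meas: "b \<in> borel_measurable borel" and B: "\<And>x. \<bar>b x\<bar> \<le> B"
    and lip: "\<And>x y. \<bar>b x - b y\<bar> \<le> \<Lambda> * norm (x - y)" and h: "0 < h" "h \<le> K / L\<^sup>2"
  shows "\<bar>(euler_op h ^^ n) b x - (euler_op h ^^ n) b y\<bar> \<le> \<Lambda> * exp (- (real n * h * K / 2)) * norm (x - y)"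
proof (induction n arbitrary: x y)
  case 0
  then show ?case using lip by simp
next
  case (Suc n)
  have eq: "\<Lambda> * exp (- (real n * h * K / 2)) * exp (- (h * K / 2)) = \<Lambda> * exp (- (real (Suc n) * h * K / 2))"
    unfolding mult.assoc exp_add[symmetric] by (simp add: field_simps)
  show ?case
    using euler_op_lipschitz[OF euler_op_iterate[OF meas h(1) B] Suc.IH h]
    by (simp only: eq funpow.simps o_apply)
qed

text \<open>As b has mean 0, the iterate may be replaced by its difference from its value at the
  origin, which the contracted Lipschitz constant bounds by a multiple of norm x. Exact invariance
  of the Gibbs measure under the scheme is thereby avoided.\<close>

lemma euler_op_decay:
  fixes b :: "real^'d \<Rightarrow> real"
  assumes meas: "b \<in> borel_measurable borel" and B: "\<And>x. \<bar>b x\<bar> \<le> B"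
    and lip: "\<And>x y. \<bar>b x - b y\<bar> \<le> \<Lambda> * norm (x - y)" and h: "0 < h" "h \<le> K / L\<^sup>2"
    and mean: "(LINT x|\<pi>. b x) = 0"
  shows "\<bar>LINT x|\<pi>. b x * (euler_op h ^^ n) b x\<bar> \<le> B * \<Lambda> * (LINT x|\<pi>. norm x) * exp (- (real n * h * K / 2))"
proof -
  let ?b = "(euler_op h ^^ n) b"
  note bn = euler_op_iterate[OF meas h(1) B, of n]
  have B0: "0 \<le> B" using B[of undefined] abs_ge_zero order_trans by blast
  have int: "integrable \<pi> b" using meas B by (intro gibbs.integrable_const_bound[of _ B]) auto
  have int': "integrable \<pi> (\<lambda>x. b x * ?b x)"
    using meas bn B by (intro gibbs.integrable_const_bound[of _ "B * B"])
      (auto simp: abs_mult intro!: mult_mono B0)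
  have "(LINT x|\<pi>. b x * ?b x) = (LINT x|\<pi>. b x * (?b x - ?b 0))"
    using int int' mean by (simp add: right_diff_distrib)
  also have "\<bar>\<dots>\<bar> \<le> (LINT x|\<pi>. B * (\<Lambda> * exp (- (real n * h * K / 2)) * norm x))"
  proof (rule order_trans[OF integral_abs_bound], rule integral_mono)
    show "integrable \<pi> (\<lambda>x. \<bar>b x * (?b x - ?b 0)\<bar>)" using int int' by (simp add: right_diff_distrib)
    show "\<bar>b x * (?b x - ?b 0)\<bar> \<le> B * (\<Lambda> * exp (- (real n * h * K / 2)) * norm x)" for x
      unfolding abs_mult using euler_op_iterate_lipschitz[OF meas B lip h, of n x 0]
      by (intro mult_mono B B0) auto
  qed (use integrable_norm_gibbs in auto)
  also have "\<dots> = B * \<Lambda> * (LINT x|\<pi>. norm x) * exp (- (real n * h * K / 2))" by simp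
  finally show ?thesis .
qed

end

section \<open>The Euler scheme driven by a Brownian motion\<close>

text \<open>The noise sequence is an argument, so that the chain becomes a random variable on a product space;
  splitting off the first coordinate there gives the Markov property.\<close>

primrec (in langevin_potential) euler_chain :: "real \<Rightarrow> real^'d \<Rightarrow> (nat \<Rightarrow> real^'d) \<Rightarrow> nat \<Rightarrow> real^'d" where
  "euler_chain h x z 0 = x"
| "euler_chain h x z (Suc n) = euler_step h (euler_chain h x z n) (z n)"

section \<open>Pathwise convergence for one fixed noise path\<close>

context langevin_potential
begin

context
  fixes \<epsilon> :: real and y w :: "real \<Rightarrow> real^'d"
  assumes eps: "0 < \<epsilon>" and y_cont: "continuous_on {0..} y"
    and y_eq: "\<And>t. 0 \<le> t \<Longrightarrow> y t = y 0 - (1 / \<epsilon>) *\<^sub>R (LINT u:{0..t}|lborel. grad V (y u)) + w t"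
begin

lemma langevin_increment:
  assumes "0 \<le> r" "r \<le> t"
  shows "y t - y r = - ((1 / \<epsilon>) *\<^sub>R integral {r..t} (\<lambda>u. grad V (y u))) + (w t - w r)"
proof -
  have cont: "continuous_on {0..t} (\<lambda>u. grad V (y u))" for t
    by (intro continuous_on_compose2[OF continuous_grad[of UNIV] continuous_on_subset[OF y_cont]]) auto
  have eq: "(LINT u:{0..t}|lborel. grad V (y u)) = integral {0..t} (\<lambda>u. grad V (y u))" for t
    by (rule set_borel_integral_eq_integral) (rule borel_integrable_atLeastAtMost'[OF cont])
  have "integral {0..t} (\<lambda>u. grad V (y u)) = integral {0..r} (\<lambda>u. grad V (y u)) + integral {r..t} (\<lambda>u. grad V (y u))"
    using assms
    by (intro Henstock_Kurzweil_Integration.integral_combine[symmetric] integrable_continuous_real cont) auto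
  then have yt: "y t = y 0 - (1 / \<epsilon>) *\<^sub>R (integral {0..r} (\<lambda>u. grad V (y u)) + integral {r..t} (\<lambda>u. grad V (y u))) + w t"
    using y_eq[of t] assms unfolding eq by simp
  have yr: "y r = y 0 - (1 / \<epsilon>) *\<^sub>R integral {0..r} (\<lambda>u. grad V (y u)) + w r"
    using y_eq[of r] assms unfolding eq by simp
  show ?thesis unfolding yt yr scaleR_add_right by simp
qed

text \<open>The scheme freezes the gradient at x, while the path stays within \<omega> of
  \<open>y r\<close> during the step. The interval has length \<open>\<epsilon> * h\<close>, which
  cancels the 1 / \<epsilon> in front of the drift; the noise is common to both and drops
  out.\<close>

lemma euler_chain_step_error:
  assumes "0 < h" "0 \<le> r" and mod: "\<And>u. r \<le> u \<Longrightarrow> u \<le> r + \<epsilon> * h \<Longrightarrow> norm (y u - y r) \<le> \<omega>"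
  shows "norm (y (r + \<epsilon> * h) - euler_step h x (w (r + \<epsilon> * h) - w r)) \<le> (1 + h * L) * norm (y r - x) + h * L * \<omega>"
proof -
  let ?t = "r + \<epsilon> * h"
  have eh: "0 < \<epsilon> * h" using eps assms by simp
  have cont: "continuous_on {r..?t} (\<lambda>u. grad V (y u))"
    using assms by (intro continuous_on_compose2[OF continuous_grad[of UNIV] continuous_on_subset[OF y_cont]]) auto
  have I: "integral {r..?t} (\<lambda>u. grad V (y u) - grad V x) = integral {r..?t} (\<lambda>u. grad V (y u)) - (\<epsilon> * h) *\<^sub>R grad V x"
    using eh by (subst Henstock_Kurzweil_Integration.integral_diff)
      (auto intro!: integrable_continuous_real cont)
  have "y ?t = y r - (1 / \<epsilon>) *\<^sub>R integral {r..?t} (\<lambda>u. grad V (y u)) + (w ?t - w r)"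
    using langevin_increment[of r ?t] assms eh by (simp add: algebra_simps)
  then have "y ?t - euler_step h x (w ?t - w r) = (y r - x) - (1 / \<epsilon>) *\<^sub>R integral {r..?t} (\<lambda>u. grad V (y u) - grad V x)"
    unfolding I scaleR_diff_right using eps by (simp add: euler_step_def)
  then have "norm (y ?t - euler_step h x (w ?t - w r))
      \<le> norm (y r - x) + norm ((1 / \<epsilon>) *\<^sub>R integral {r..?t} (\<lambda>u. grad V (y u) - grad V x))"
    using norm_triangle_ineq4 by metis
  also have "norm ((1 / \<epsilon>) *\<^sub>R integral {r..?t} (\<lambda>u. grad V (y u) - grad V x)) \<le> h * (L * (\<omega> + norm (y r - x)))"
  proof -
    have "norm (integral {r..?t} (\<lambda>u. grad V (y u) - grad V x)) \<le> L * (\<omega> + norm (y r - x)) * (?t - r)"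
    proof (rule integral_bound)
      show "continuous_on {r..?t} (\<lambda>u. grad V (y u) - grad V x)" by (intro continuous_intros cont)
      fix u assume u: "u \<in> {r..?t}"
      have "norm (y u - x) \<le> norm (y u - y r) + norm (y r - x)"
        using norm_triangle_ineq[of "y u - y r" "y r - x"] by simp
      also have "\<dots> \<le> \<omega> + norm (y r - x)" using mod u by simp
      finally show "norm (grad V (y u) - grad V x) \<le> L * (\<omega> + norm (y r - x))"
        using L_ge_1 by (intro order_trans[OF grad_lipschitz] mult_left_mono) auto
    qed (use eh in auto)
    then have "norm (integral {r..?t} (\<lambda>u. grad V (y u) - grad V x)) \<le> \<epsilon> * (h * (L * (\<omega> + norm (y r - x))))"
      by (simp add: mult_ac)
    then show ?thesis using eps by (simp add: divide_le_eq mult_ac)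
  qed
  finally show ?thesis by (simp add: algebra_simps)
qed

text \<open>A discrete Gronwall argument: the one-step recursion gives k h L \<omega> (1 + h L)^k
  after k steps, and k h <= T. The horizon T is in units of \<open>\<epsilon>\<close>, the modulus
  \<omega> in the time of the path.\<close>

lemma euler_chain_error:
  assumes h: "0 < h" and \<omega>: "0 \<le> \<omega>"
    and mod: "\<And>r u. 0 \<le> r \<Longrightarrow> r \<le> u \<Longrightarrow> u \<le> r + \<epsilon> * h \<Longrightarrow> u \<le> \<epsilon> * T \<Longrightarrow> norm (y u - y r) \<le> \<omega>"
    and n: "real n * h \<le> T"
  shows "norm (y (real n * (\<epsilon> * h)) - euler_chain h (y 0) (\<lambda>i. w (real (Suc i) * (\<epsilon> * h)) - w (real i * (\<epsilon> * h))) n)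
    \<le> T * L * \<omega> * exp (T * L)"
proof -
  let ?z = "\<lambda>i. w (real (Suc i) * (\<epsilon> * h)) - w (real i * (\<epsilon> * h))"
  let ?e = "\<lambda>k. norm (y (real k * (\<epsilon> * h)) - euler_chain h (y 0) ?z k)"
  have hL: "0 \<le> h * L" using h L_ge_1 by simp
  have "?e k \<le> real k * (h * L * \<omega>) * (1 + h * L) ^ k" if "k \<le> n" for k
    using that
  proof (induction k)
    case (Suc k)
    have eq: "real k * (\<epsilon> * h) + \<epsilon> * h = real (Suc k) * (\<epsilon> * h)" by (simp add: algebra_simps)
    have step_le: "real (Suc k) * (\<epsilon> * h) \<le> \<epsilon> * T"
    proof -
      have "real (Suc k) * h \<le> real n * h" using Suc.prems h by (intro mult_right_mono) auto
      then have "\<epsilon> * (real (Suc k) * h) \<le> \<epsilon> * T" using n eps by (intro mult_left_mono) auto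
      then show ?thesis by (simp add: mult_ac)
    qed
    have k0: "0 \<le> real k * (\<epsilon> * h)" using h eps by simp
    have near: "norm (y u - y (real k * (\<epsilon> * h))) \<le> \<omega>"
      if "real k * (\<epsilon> * h) \<le> u" "u \<le> real k * (\<epsilon> * h) + \<epsilon> * h" for u
    proof -
      have "u \<le> \<epsilon> * T" using that(2) step_le unfolding eq by (rule order_trans)
      then show ?thesis by (rule mod[OF k0 that])
    qed
    from euler_chain_step_error[OF h k0 near, of "euler_chain h (y 0) ?z k"]
    have "?e (Suc k) \<le> (1 + h * L) * ?e k + h * L * \<omega>"
      unfolding eq by simp
    also have "\<dots> \<le> (1 + h * L) * (real k * (h * L * \<omega>) * (1 + h * L) ^ k) + h * L * \<omega> * (1 + h * L) ^ Suc k"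
    proof (rule add_mono)
      show "(1 + h * L) * ?e k \<le> (1 + h * L) * (real k * (h * L * \<omega>) * (1 + h * L) ^ k)"
        using Suc.IH Suc.prems hL by (intro mult_left_mono) simp_all
      have "1 \<le> (1 + h * L) ^ Suc k" using hL by (intro one_le_power) simp
      from mult_left_mono[OF this, of "h * L * \<omega>"] show "h * L * \<omega> \<le> h * L * \<omega> * (1 + h * L) ^ Suc k"
        using hL \<omega> by simp
    qed
    also have "\<dots> = real (Suc k) * (h * L * \<omega>) * (1 + h * L) ^ Suc k" by (simp add: algebra_simps)
    finally show ?case .
  qed simp
  then have "?e n \<le> real n * (h * L * \<omega>) * (1 + h * L) ^ n" by simp
  also have "\<dots> \<le> (T * L * \<omega>) * exp (T * L)"
  proof (rule mult_mono)
    show "real n * (h * L * \<omega>) \<le> T * L * \<omega>"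
      using mult_right_mono[OF n, of "L * \<omega>"] L_ge_1 \<omega> by (simp add: mult_ac)
    have "(1 + h * L) ^ n \<le> exp (h * L) ^ n" using hL by (intro power_mono) (auto simp: exp_ge_add_one_self)
    also have "\<dots> = exp (real n * h * L)" by (simp add: exp_of_nat_mult[symmetric] mult_ac)
    also have "\<dots> \<le> exp (T * L)" using n L_ge_1 by (simp add: mult_right_mono)
    finally show "(1 + h * L) ^ n \<le> exp (T * L)" .
    have "0 \<le> T" using n h order_trans[of 0 "real n * h" T] by simp
    then show "0 \<le> T * L * \<omega>" using L_ge_1 \<omega> by simp
  qed (use hL in auto)
  finally show ?thesis .
qed

lemma euler_chain_tendsto:
  assumes h: "\<And>N. 0 < h N" "h \<longlonglongrightarrow> 0" and nh: "(\<lambda>N. real (n N) * h N) \<longlonglongrightarrow> t"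
  shows "(\<lambda>N. euler_chain (h N) (y 0)
      (\<lambda>i. w (real (Suc i) * (\<epsilon> * h N)) - w (real i * (\<epsilon> * h N))) (n N)) \<longlonglongrightarrow> y (\<epsilon> * t)"
proof -
  let ?X = "\<lambda>N. euler_chain (h N) (y 0)
      (\<lambda>i. w (real (Suc i) * (\<epsilon> * h N)) - w (real i * (\<epsilon> * h N))) (n N)"
  have h0: "0 \<le> h N" for N using h(1)[of N] by simp
  have t: "0 \<le> t" by (intro tendsto_lowerbound[OF nh]) (auto intro!: always_eventually mult_nonneg_nonneg h0)
  \<comment> \<open>The grid times only converge to t, so a margin is left for those beyond
    it.\<close>
  define T where "T = t + 1"
  have T: "0 < T" using t by (simp add: T_def)
  have unif: "uniformly_continuous_on {0..\<epsilon> * T} y"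
    by (intro compact_uniformly_continuous continuous_on_subset[OF y_cont]) auto
  have close: "(\<lambda>N. y (real (n N) * (\<epsilon> * h N)) - ?X N) \<longlonglongrightarrow> 0"
  proof (rule tendstoI)
    fix e :: real assume e: "0 < e"
    \<comment> \<open>Chosen so that the bound of \<open>euler_chain_error\<close> is e / 2.\<close>
    define \<omega> where "\<omega> = e / (2 * (T * L * exp (T * L)))"
    have pos: "0 < T * L * exp (T * L)" using T L_ge_1 by simp
    then have \<omega>: "0 < \<omega>" using e by (simp add: \<omega>_def)
    obtain d where d: "0 < d" "\<And>u r. u \<in> {0..\<epsilon> * T} \<Longrightarrow> r \<in> {0..\<epsilon> * T} \<Longrightarrow> dist u r < d \<Longrightarrow> dist (y u) (y r) < \<omega>"
      using unif \<omega> unfolding uniformly_continuous_on_def by metis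
    have "\<forall>\<^sub>F N in sequentially. \<epsilon> * h N < d"
      using order_tendstoD(2)[OF tendsto_mult[OF tendsto_const h(2)], of \<epsilon> d] d by simp
    moreover have "\<forall>\<^sub>F N in sequentially. real (n N) * h N < T"
      using order_tendstoD(2)[OF nh, of T] by (simp add: T_def)
    ultimately show "\<forall>\<^sub>F N in sequentially. dist (y (real (n N) * (\<epsilon> * h N)) - ?X N) 0 < e"
    proof eventually_elim
      case (elim N)
      have "norm (y (real (n N) * (\<epsilon> * h N)) - ?X N) \<le> T * L * \<omega> * exp (T * L)"
      proof (rule euler_chain_error)
        fix r u assume "0 \<le> r" "r \<le> u" "u \<le> r + \<epsilon> * h N" "u \<le> \<epsilon> * T"
        then show "norm (y u - y r) \<le> \<omega>" using d(2)[of u r] elim by (auto simp: dist_norm)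
      qed (use h elim \<omega> in auto)
      also have "\<dots> = e / 2" using T L_ge_1 by (simp add: \<omega>_def)
      also have "\<dots> < e" using e by simp
      finally show ?case by simp
    qed
  qed
  have "(\<lambda>N. y (real (n N) * (\<epsilon> * h N))) \<longlonglongrightarrow> y (\<epsilon> * t)"
  proof (rule continuous_on_tendsto_compose[OF y_cont])
    show "(\<lambda>N. real (n N) * (\<epsilon> * h N)) \<longlonglongrightarrow> \<epsilon> * t"
      using tendsto_mult[OF tendsto_const nh, of \<epsilon>] by (simp add: mult_ac)
  qed (use t eps h0 in auto)
  from tendsto_diff[OF this close] show ?thesis by simp
qed

end

section \<open>The chain on the product space of noise sequences\<close>

lemma euler_chain_shift:
  "euler_chain h x z (Suc n) = euler_chain h (euler_step h x (z 0)) (\<lambda>i. z (Suc i)) n"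
  by (induction n) auto

lemma euler_chain_case_nat:
  "euler_chain h x (case_nat s \<zeta>) (Suc n) = euler_chain h (euler_step h x s) \<zeta> n"
  by (simp add: euler_chain_shift del: euler_chain.simps)

lemma euler_chain_measurable [measurable]:
  "(\<lambda>p. euler_chain h (fst p) (snd p) n) \<in> borel_measurable (borel \<Otimes>\<^sub>M PiM UNIV (\<lambda>_. borel))"
proof (induction n)
  case (Suc n)
  have [measurable]: "(\<lambda>p. snd p n) \<in> borel_measurable (borel \<Otimes>\<^sub>M PiM UNIV (\<lambda>_. borel :: (real^'d) measure))"
    by measurable
  show ?case using Suc unfolding euler_chain.simps euler_step_def by measurable
qed simp

abbreviation noise_path :: "real \<Rightarrow> (nat \<Rightarrow> real^'d) measure" where
  "noise_path h \<equiv> PiM UNIV (\<lambda>_. gauss_noise (2 * h))"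

lemma sets_noise_path [measurable_cong]: "sets (noise_path h) = sets (PiM UNIV (\<lambda>_. borel))"
  by (rule sets_PiM_cong) auto

lemma euler_chain_measurable' [measurable]:
  "(\<lambda>\<zeta>. euler_chain h x \<zeta> n) \<in> borel_measurable (noise_path h)"
proof -
  have "(\<lambda>\<zeta>. euler_chain h (fst (x, \<zeta>)) (snd (x, \<zeta>)) n) \<in> borel_measurable (PiM UNIV (\<lambda>_. borel))"
    by (rule measurable_compose[OF measurable_Pair1' euler_chain_measurable]) simp
  then show ?thesis by (simp add: measurable_cong_sets[OF sets_noise_path refl])
qed

lemma noise_path_iter:
  fixes F :: "(nat \<Rightarrow> real^'d) \<Rightarrow> real"
  assumes h: "0 < h" and F [measurable]: "F \<in> borel_measurable (noise_path h)" and B: "\<And>\<zeta>. \<bar>F \<zeta>\<bar> \<le> B"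
  shows "(LINT \<zeta>|noise_path h. F \<zeta>) = (LINT s|gauss_noise (2 * h). LINT \<zeta>|noise_path h. F (case_nat s \<zeta>))"
proof -
  interpret N: prob_space "gauss_noise (2 * h) :: (real^'d) measure"
    using h by (intro prob_space_gauss_noise) simp
  interpret S: sequence_space "gauss_noise (2 * h) :: (real^'d) measure" ..
  interpret P: pair_prob_space "gauss_noise (2 * h) :: (real^'d) measure" "noise_path h" ..
  have meas: "(\<lambda>p. case_nat (fst p) (snd p)) \<in> measurable (gauss_noise (2 * h) \<Otimes>\<^sub>M noise_path h) (noise_path h)"
    by measurable
  have "(LINT \<zeta>|noise_path h. F \<zeta>)
      = (LINT \<zeta>|distr (gauss_noise (2 * h) \<Otimes>\<^sub>M noise_path h) (noise_path h) (\<lambda>(s, \<omega>). case_nat s \<omega>). F \<zeta>)"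
    by (simp add: S.PiM_iter)
  also have "\<dots> = (LINT p|(gauss_noise (2 * h) \<Otimes>\<^sub>M noise_path h). F (case_nat (fst p) (snd p)))"
    using meas by (subst integral_distr) (auto simp: case_prod_beta')
  also have "\<dots> = (LINT s|gauss_noise (2 * h). LINT \<zeta>|noise_path h. F (case_nat s \<zeta>))"
  proof -
    have "integrable (gauss_noise (2 * h) \<Otimes>\<^sub>M noise_path h) (\<lambda>p. F (case_nat (fst p) (snd p)))"
      using B by (intro P.integrable_const_bound[of _ B]) (auto intro: measurable_compose[OF meas F])
    from P.integral_fst'[OF this] show ?thesis by simp
  qed
  finally show ?thesis .
qed

lemma euler_chain_expectation:
  fixes b :: "real^'d \<Rightarrow> real"
  assumes h: "0 < h" and meas [measurable]: "b \<in> borel_measurable borel" and B: "\<And>x. \<bar>b x\<bar> \<le> B"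
  shows "(LINT \<zeta>|noise_path h. b (euler_chain h x \<zeta> n)) = (euler_op h ^^ n) b x"
proof (induction n arbitrary: x)
  case 0
  interpret N: prob_space "gauss_noise (2 * h) :: (real^'d) measure"
    using h by (intro prob_space_gauss_noise) simp
  interpret S: sequence_space "gauss_noise (2 * h) :: (real^'d) measure" ..
  show ?case using S.P.prob_space by simp
next
  case (Suc n)
  have "(LINT \<zeta>|noise_path h. b (euler_chain h x \<zeta> (Suc n)))
      = (LINT s|gauss_noise (2 * h). LINT \<zeta>|noise_path h. b (euler_chain h x (case_nat s \<zeta>) (Suc n)))"
    by (rule noise_path_iter[OF h measurable_compose[OF euler_chain_measurable' meas] B])
  also have "\<dots> = euler_op h ((euler_op h ^^ n) b) x"
    unfolding euler_chain_case_nat Suc.IH euler_op_def[of h "(euler_op h ^^ n) b"] ..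
  finally show ?case by simp
qed

text \<open>Conditioning on the first noise variable peels off one step before the earlier time;
  once m = 0, the factor a is constant and only \<open>euler_chain_expectation\<close>
  remains.\<close>

lemma euler_chain_two_times:
  fixes a b :: "real^'d \<Rightarrow> real"
  assumes h: "0 < h" and a [measurable]: "a \<in> borel_measurable borel" and A: "\<And>x. \<bar>a x\<bar> \<le> A"
    and b [measurable]: "b \<in> borel_measurable borel" and B: "\<And>x. \<bar>b x\<bar> \<le> B"
  shows "(LINT \<zeta>|noise_path h. a (euler_chain h x \<zeta> m) * b (euler_chain h x \<zeta> (m + k)))
    = (euler_op h ^^ m) (\<lambda>x. a x * (euler_op h ^^ k) b x) x"
proof (induction m arbitrary: x)
  case 0
  show ?case using euler_chain_expectation[OF h b B] by simp
next
  case (Suc m)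
  have A0: "0 \<le> A" using A[of undefined] abs_ge_zero order_trans by blast
  have "(LINT \<zeta>|noise_path h. a (euler_chain h x \<zeta> (Suc m)) * b (euler_chain h x \<zeta> (Suc m + k)))
      = (LINT s|gauss_noise (2 * h). LINT \<zeta>|noise_path h.
          a (euler_chain h x (case_nat s \<zeta>) (Suc m)) * b (euler_chain h x (case_nat s \<zeta>) (Suc (m + k))))"
    unfolding add_Suc
  proof (rule noise_path_iter[OF h])
    show "(\<lambda>\<zeta>. a (euler_chain h x \<zeta> (Suc m)) * b (euler_chain h x \<zeta> (Suc (m + k)))) \<in> borel_measurable (noise_path h)"
      by (intro borel_measurable_times measurable_compose[OF euler_chain_measurable'] a b)
    show "\<bar>a (euler_chain h x \<zeta> (Suc m)) * b (euler_chain h x \<zeta> (Suc (m + k)))\<bar> \<le> A * B" for \<zeta>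
      unfolding abs_mult by (intro mult_mono A B A0) auto
  qed
  also have "\<dots> = euler_op h ((euler_op h ^^ m) (\<lambda>x. a x * (euler_op h ^^ k) b x)) x"
    unfolding euler_chain_case_nat Suc.IH euler_op_def[of h "(euler_op h ^^ m) _"] ..
  finally show ?case by simp
qed

end

lemma gauss_noise_scale:
  assumes c: "0 < c" and \<tau>: "0 < \<tau>"
  shows "distr (gauss_noise \<tau> :: (real^'d::finite) measure) borel (\<lambda>w. c *\<^sub>R w) = gauss_noise (c\<^sup>2 * \<tau>)"
proof -
  have dens: "c ^ CARD('d) * gauss (c\<^sup>2 * \<tau>) (c *\<^sub>R w) = gauss \<tau> w" for w :: "real^'d"
  proof -
    have "sqrt (2 * pi * (c\<^sup>2 * \<tau>)) = c * sqrt (2 * pi * \<tau>)"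
      using c by (simp add: real_sqrt_mult)
    then have "c ^ CARD('d) * (1 / sqrt (2 * pi * (c\<^sup>2 * \<tau>))) ^ CARD('d) = (1 / sqrt (2 * pi * \<tau>)) ^ CARD('d)"
      using c unfolding power_mult_distrib[symmetric] by simp
    moreover have "- (norm (c *\<^sub>R w))\<^sup>2 / (2 * (c\<^sup>2 * \<tau>)) = - (norm w)\<^sup>2 / (2 * \<tau>)"
      using c \<tau> by (simp add: power_mult_distrib)
    ultimately show ?thesis
      unfolding gauss_exp[OF \<tau>] gauss_exp[OF mult_pos_pos[OF zero_less_power[OF c] \<tau>]] by (simp only: mult.assoc[symmetric])
  qed
  have "(lborel :: (real^'d) measure) = density (distr lborel borel (\<lambda>x. c *\<^sub>R x)) (\<lambda>_. ennreal (c ^ CARD('d)))"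
    using lborel_affine[of c "0 :: real^'d"] c by (simp add: ennreal_power)
  then have "gauss_noise (c\<^sup>2 * \<tau>) = density (density (distr lborel borel (\<lambda>x. c *\<^sub>R x)) (\<lambda>_. ennreal (c ^ CARD('d))))
     (\<lambda>w::real^'d. ennreal (gauss (c\<^sup>2 * \<tau>) w))"
    unfolding gauss_noise_def by simp
  also have "\<dots> = density (distr lborel borel (\<lambda>x. c *\<^sub>R x)) (\<lambda>w::real^'d. ennreal (c ^ CARD('d)) * ennreal (gauss (c\<^sup>2 * \<tau>) w))"
    by (rule density_density_eq) auto
  also have "\<dots> = distr (density lborel (\<lambda>w::real^'d. ennreal (c ^ CARD('d)) * ennreal (gauss (c\<^sup>2 * \<tau>) (c *\<^sub>R w)))) borel (\<lambda>x. c *\<^sub>R x)"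
    by (rule density_distr) auto
  also have "(\<lambda>w::real^'d. ennreal (c ^ CARD('d)) * ennreal (gauss (c\<^sup>2 * \<tau>) (c *\<^sub>R w))) = (\<lambda>w. ennreal (gauss \<tau> w))"
    using c by (simp add: ennreal_mult[symmetric] gauss_nonneg dens)
  finally show ?thesis by (simp add: gauss_noise_def)
qed

section \<open>The law of the scheme driven by the given Brownian motion\<close>

context langevin_potential
begin

context
  fixes M :: "'w measure" and \<epsilon> :: real and B Y :: "real \<Rightarrow> 'w \<Rightarrow> real^'d"
  assumes eps: "0 < \<epsilon>" and langevin: "stationary_langevin M V \<epsilon> B Y"
begin

interpretation prob_space M
  using langevin by (simp add: stationary_langevin_def brownian_motion_def)

lemma Y_measurable [measurable]: "0 \<le> t \<Longrightarrow> Y t \<in> borel_measurable M"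
  using langevin by (simp add: stationary_langevin_def)

lemma B_measurable [measurable]: "0 \<le> t \<Longrightarrow> B t \<in> borel_measurable M"
  using langevin by (simp add: stationary_langevin_def brownian_motion_def)

text \<open>Increments of the noise term of the equation over a grid of mesh
  \<open>\<epsilon> * h\<close>. Their variance is (2 / \<epsilon>) * (\<epsilon> * h) = 2 h,
  exactly the noise of \<open>euler_step\<close>.\<close>

definition scaled_increment :: "real \<Rightarrow> 'w \<Rightarrow> nat \<Rightarrow> real^'d" where
  "scaled_increment h \<omega> i = sqrt (2 / \<epsilon>) *\<^sub>R B (real (Suc i) * (\<epsilon> * h)) \<omega> - sqrt (2 / \<epsilon>) *\<^sub>R B (real i * (\<epsilon> * h)) \<omega>"

lemma scaled_increment_measurable [measurable]:
  assumes "0 < h"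
  shows "(\<lambda>\<omega>. scaled_increment h \<omega> i) \<in> borel_measurable M"
    and "scaled_increment h \<in> measurable M (PiM UNIV (\<lambda>_. borel))"
proof -
  show 1: "(\<lambda>\<omega>. scaled_increment h \<omega> i) \<in> borel_measurable M" for i
    using assms eps unfolding scaled_increment_def
    by (intro borel_measurable_diff borel_measurable_scaleR borel_measurable_const B_measurable) auto
  show "scaled_increment h \<in> measurable M (PiM UNIV (\<lambda>_. borel))"
    by (rule measurable_PiM_single') (auto simp: 1)
qed

lemma distr_scaled_increment_component:
  assumes h: "0 < h"
  shows "distr M borel (\<lambda>\<omega>. scaled_increment h \<omega> i) = gauss_noise (2 * h)"
proof -
  define \<tau> where "\<tau> i = real i * (\<epsilon> * h)" for i :: nat
  let ?D = "\<lambda>\<omega>. B (\<tau> (Suc i)) \<omega> - B (\<tau> i) \<omega>"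
  have \<tau>: "0 \<le> \<tau> i" "\<tau> i < \<tau> (Suc i)" "\<tau> (Suc i) - \<tau> i = \<epsilon> * h"
    using h eps by (auto simp: \<tau>_def algebra_simps)
  have "distributed M lborel ?D (\<lambda>x. ennreal (\<Prod>i\<in>UNIV. normal_density 0 (sqrt (\<epsilon> * h)) (x $ i)))"
  proof -
    have "\<forall>r t. 0 \<le> r \<and> r < t \<longrightarrow> distributed M lborel (\<lambda>\<omega>. B t \<omega> - B r \<omega>)
        (\<lambda>x. ennreal (\<Prod>i\<in>UNIV. normal_density 0 (sqrt (t - r)) (x $ i)))"
      using langevin unfolding stationary_langevin_def brownian_motion_def by blast
    from this[rule_format, of "\<tau> i" "\<tau> (Suc i)"] show ?thesis using \<tau> by (simp only:)
  qed
  then have "distr M lborel ?D = gauss_noise (\<epsilon> * h)"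
    by (simp add: distributed_def gauss_noise_def gauss_def)
  then have D: "distr M borel ?D = gauss_noise (\<epsilon> * h)"
    by (simp cong: distr_cong)
  have D_meas: "?D \<in> borel_measurable M" using \<tau> by (intro borel_measurable_diff B_measurable) auto
  have "distr M borel (\<lambda>\<omega>. scaled_increment h \<omega> i) = distr M borel (\<lambda>\<omega>. sqrt (2 / \<epsilon>) *\<^sub>R ?D \<omega>)"
    by (simp add: scaled_increment_def \<tau>_def scaleR_diff_right)
  also have "\<dots> = distr (distr M borel ?D) borel (\<lambda>x. sqrt (2 / \<epsilon>) *\<^sub>R x)"
    using D_meas by (subst distr_distr) (auto simp: o_def)
  also have "\<dots> = gauss_noise ((sqrt (2 / \<epsilon>))\<^sup>2 * (\<epsilon> * h))"
    unfolding D using h eps by (intro gauss_noise_scale) auto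
  also have "(sqrt (2 / \<epsilon>))\<^sup>2 * (\<epsilon> * h) = 2 * h" using eps by simp
  finally show ?thesis .
qed

lemma distr_scaled_increment:
  assumes h: "0 < h"
  shows "distr M (PiM UNIV (\<lambda>_. borel)) (scaled_increment h) = noise_path h"
proof -
  define \<tau> where "\<tau> i = real i * (\<epsilon> * h)" for i :: nat
  have "mono \<tau>" unfolding \<tau>_def using h eps by (intro monoI mult_right_mono) auto
  moreover have "0 \<le> \<tau> 0" by (simp add: \<tau>_def)
  ultimately have "indep_vars (\<lambda>_. borel) (\<lambda>i \<omega>. B (\<tau> (Suc i)) \<omega> - B (\<tau> i) \<omega>) UNIV"
    using langevin by (simp add: stationary_langevin_def brownian_motion_def)
  then have "indep_vars (\<lambda>_. borel) (\<lambda>i \<omega>. sqrt (2 / \<epsilon>) *\<^sub>R (B (\<tau> (Suc i)) \<omega> - B (\<tau> i) \<omega>)) UNIV"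
    by (rule indep_vars_compose2) auto
  then have "indep_vars (\<lambda>_. borel) (\<lambda>i \<omega>. scaled_increment h \<omega> i) UNIV"
    by (simp add: scaled_increment_def \<tau>_def scaleR_diff_right)
  then have "distr M (PiM UNIV (\<lambda>_. borel)) (\<lambda>\<omega>. \<lambda>i\<in>UNIV. scaled_increment h \<omega> i)
      = PiM UNIV (\<lambda>i. distr M borel (\<lambda>\<omega>. scaled_increment h \<omega> i))"
    using h by (subst (asm) indep_vars_iff_distr_eq_PiM') (auto simp: scaled_increment_measurable)
  then show ?thesis by (simp add: distr_scaled_increment_component[OF h] restrict_UNIV)
qed

text \<open>The noise sequence is a measurable function of the path of \<open>B\<close> on [0,
  infinity), so its sigma-algebra lies inside the one from which \<open>Y 0\<close> is independent;
  the joint law is then determined on rectangles.\<close>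

lemma distr_start_and_noise:
  assumes h: "0 < h"
  shows "distr M (borel \<Otimes>\<^sub>M PiM UNIV (\<lambda>_. borel)) (\<lambda>\<omega>. (Y 0 \<omega>, scaled_increment h \<omega>)) = \<pi> \<Otimes>\<^sub>M noise_path h"
proof -
  let ?N = "PiM UNIV (\<lambda>_::nat. borel :: (real^'d) measure)"
  let ?P = "PiM {0::real..} (\<lambda>_. borel :: (real^'d) measure)"
  let ?path = "\<lambda>\<omega>. \<lambda>t\<in>{0..}. B t \<omega>"
  let ?\<Psi> = "\<lambda>p i. sqrt (2 / \<epsilon>) *\<^sub>R p (real (Suc i) * (\<epsilon> * h)) - sqrt (2 / \<epsilon>) *\<^sub>R p (real i * (\<epsilon> * h)) :: real^'d"
  have pos: "0 \<le> real i * (\<epsilon> * h)" for i :: nat using h eps by simp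
  have \<Psi>: "?\<Psi> \<in> measurable ?P ?N"
  proof (rule measurable_PiM_single')
    fix i :: nat
    have "(\<lambda>p. p (real (Suc i) * (\<epsilon> * h))) \<in> measurable ?P borel" "(\<lambda>p. p (real i * (\<epsilon> * h))) \<in> measurable ?P borel"
      using pos[of i] pos[of "Suc i"] by (auto intro!: measurable_component_singleton)
    then show "(\<lambda>p. ?\<Psi> p i) \<in> measurable ?P borel" by measurable
  qed auto
  have \<Psi>_path: "?\<Psi> (?path \<omega>) = scaled_increment h \<omega>" for \<omega>
    using pos by (auto simp: scaled_increment_def fun_eq_iff simp del: of_nat_Suc)
  have path_space: "?path \<omega> \<in> space ?P" for \<omega> by (simp add: space_PiM)
  have indep: "indep_set (sets (vimage_algebra (space M) (Y 0) borel)) (sets (vimage_algebra (space M) ?path ?P))"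
    using langevin by (simp add: stationary_langevin_def)
  have sub: "sets (vimage_algebra (space M) (scaled_increment h) ?N) \<subseteq> sets (vimage_algebra (space M) ?path ?P)"
    unfolding sets_vimage_algebra
  proof (rule sigma_sets_mono, rule subsetI)
    fix S assume "S \<in> {scaled_increment h -` A \<inter> space M |A. A \<in> sets ?N}"
    then obtain A where A: "A \<in> sets ?N" "S = scaled_increment h -` A \<inter> space M" by auto
    have "S = ?path -` (?\<Psi> -` A \<inter> space ?P) \<inter> space M"
      using A(2) \<Psi>_path path_space by auto
    then show "S \<in> sigma_sets (space M) {?path -` A \<inter> space M |A. A \<in> sets ?P}"
      using measurable_sets[OF \<Psi> A(1)] by (intro sigma_sets.Basic) blast
  qed
  have Y0: "distr M borel (Y 0) = \<pi>" using langevin by (simp add: stationary_langevin_def)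
  interpret N: prob_space "gauss_noise (2 * h) :: (real^'d) measure"
    using h by (intro prob_space_gauss_noise) simp
  interpret S: sequence_space "gauss_noise (2 * h) :: (real^'d) measure" ..
  have pair: "(\<lambda>\<omega>. (Y 0 \<omega>, scaled_increment h \<omega>)) \<in> measurable M (borel \<Otimes>\<^sub>M ?N)"
    using h by (intro measurable_Pair Y_measurable scaled_increment_measurable) auto
  show ?thesis
  proof (rule pair_measure_eqI[symmetric])
    show "sets (\<pi> \<Otimes>\<^sub>M noise_path h) = sets (distr M (borel \<Otimes>\<^sub>M ?N) (\<lambda>\<omega>. (Y 0 \<omega>, scaled_increment h \<omega>)))"
      unfolding sets_distr by (rule sets_pair_measure_cong[OF sets_gibbs sets_noise_path])
    fix A C assume "A \<in> sets \<pi>" "C \<in> sets (noise_path h)"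
    then have A [measurable]: "A \<in> sets borel" and C [measurable]: "C \<in> sets ?N"
      by (simp_all add: sets_noise_path)
    let ?A = "Y 0 -` A \<inter> space M" and ?C = "scaled_increment h -` C \<inter> space M"
    have "?A \<in> sets (vimage_algebra (space M) (Y 0) borel)"
      using A by (auto intro!: in_vimage_algebra)
    moreover have "?C \<in> sets (vimage_algebra (space M) ?path ?P)"
      using C sub by (auto intro!: in_vimage_algebra)
    ultimately have indep_AC: "prob (?A \<inter> ?C) = prob ?A * prob ?C"
      using indep unfolding indep_sets2_eq by blast
    have "emeasure \<pi> A * emeasure (noise_path h) C = emeasure (distr M borel (Y 0)) A * emeasure (distr M ?N (scaled_increment h)) C"
      by (simp add: Y0 distr_scaled_increment[OF h])
    also have "\<dots> = emeasure M ?A * emeasure M ?C"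
      using h A C by (simp add: emeasure_distr scaled_increment_measurable)
    also have "\<dots> = emeasure M (?A \<inter> ?C)"
      by (simp add: emeasure_eq_measure indep_AC ennreal_mult)
    also have "?A \<inter> ?C = (\<lambda>\<omega>. (Y 0 \<omega>, scaled_increment h \<omega>)) -` (A \<times> C) \<inter> space M" by auto
    also have "emeasure M \<dots> = emeasure (distr M (borel \<Otimes>\<^sub>M ?N) (\<lambda>\<omega>. (Y 0 \<omega>, scaled_increment h \<omega>))) (A \<times> C)"
      using pair by (intro emeasure_distr[symmetric]) auto
    finally show "emeasure \<pi> A * emeasure (noise_path h) C
        = emeasure (distr M (borel \<Otimes>\<^sub>M ?N) (\<lambda>\<omega>. (Y 0 \<omega>, scaled_increment h \<omega>))) (A \<times> C)" .
  qed (auto intro: gibbs.sigma_finite_measure_axioms S.P.sigma_finite_measure_axioms)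
qed

lemma euler_scheme_two_times:
  fixes a b :: "real^'d \<Rightarrow> real"
  assumes h: "0 < h" and a [measurable]: "a \<in> borel_measurable borel" and A: "\<And>x. \<bar>a x\<bar> \<le> A"
    and b [measurable]: "b \<in> borel_measurable borel" and B: "\<And>x. \<bar>b x\<bar> \<le> B'"
  shows "expectation (\<lambda>\<omega>. a (euler_chain h (Y 0 \<omega>) (scaled_increment h \<omega>) m) *
      b (euler_chain h (Y 0 \<omega>) (scaled_increment h \<omega>) (m + k)))
    = (LINT x|\<pi>. (euler_op h ^^ m) (\<lambda>x. a x * (euler_op h ^^ k) b x) x)"
proof -
  let ?N = "PiM UNIV (\<lambda>_::nat. borel :: (real^'d) measure)"
  let ?F = "\<lambda>p. a (euler_chain h (fst p) (snd p) m) * b (euler_chain h (fst p) (snd p) (m + k))"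
  interpret N: prob_space "gauss_noise (2 * h) :: (real^'d) measure"
    using h by (intro prob_space_gauss_noise) simp
  interpret S: sequence_space "gauss_noise (2 * h) :: (real^'d) measure" ..
  interpret P: pair_prob_space \<pi> "noise_path h" ..
  have A0: "0 \<le> A" using A[of undefined] abs_ge_zero order_trans by blast
  have F: "?F \<in> borel_measurable (borel \<Otimes>\<^sub>M ?N)"
    by (intro borel_measurable_times measurable_compose[OF euler_chain_measurable] a b)
  have [simp]: "sets (\<pi> \<Otimes>\<^sub>M noise_path h) = sets (borel \<Otimes>\<^sub>M ?N)"
    by (intro sets_pair_measure_cong sets_gibbs sets_noise_path)
  have "expectation (\<lambda>\<omega>. ?F (Y 0 \<omega>, scaled_increment h \<omega>))
      = (LINT p|distr M (borel \<Otimes>\<^sub>M ?N) (\<lambda>\<omega>. (Y 0 \<omega>, scaled_increment h \<omega>)). ?F p)"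
    using h by (intro integral_distr[symmetric] F measurable_Pair Y_measurable scaled_increment_measurable) auto
  also have "\<dots> = (LINT p|(\<pi> \<Otimes>\<^sub>M noise_path h). ?F p)" unfolding distr_start_and_noise[OF h] ..
  also have "\<dots> = (LINT x|\<pi>. LINT \<zeta>|noise_path h. ?F (x, \<zeta>))"
  proof (rule P.integral_fst'[symmetric], rule P.integrable_const_bound)
    show "AE p in \<pi> \<Otimes>\<^sub>M noise_path h. norm (?F p) \<le> A * B'"
      by (intro AE_I2) (auto simp: abs_mult intro!: mult_mono A B A0)
    show "?F \<in> borel_measurable (\<pi> \<Otimes>\<^sub>M noise_path h)"
      using F by (simp cong: measurable_cong_sets)
  qed
  also have "\<dots> = (LINT x|\<pi>. (euler_op h ^^ m) (\<lambda>x. a x * (euler_op h ^^ k) b x) x)"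
    using euler_chain_two_times[OF h a A b B] by simp
  finally show ?thesis by simp
qed

lemma euler_scheme_tendsto:
  assumes h: "\<And>N. 0 < h N" "h \<longlonglongrightarrow> 0" and nh: "(\<lambda>N. real (n N) * h N) \<longlonglongrightarrow> t"
  shows "AE \<omega> in M. (\<lambda>N. euler_chain (h N) (Y 0 \<omega>) (scaled_increment (h N) \<omega>) (n N)) \<longlonglongrightarrow> Y (\<epsilon> * t) \<omega>"
proof -
  have cont: "\<And>\<omega>. \<omega> \<in> space M \<Longrightarrow> continuous_on {0..} (\<lambda>t. Y t \<omega>)"
    and eq: "AE \<omega> in M. \<forall>t\<ge>0. Y t \<omega> =
        Y 0 \<omega> - (1 / \<epsilon>) *\<^sub>R (LINT u:{0..t}|lborel. grad V (Y u \<omega>)) + sqrt (2 / \<epsilon>) *\<^sub>R B t \<omega>"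
    using langevin unfolding stationary_langevin_def by blast+
  from eq AE_space show ?thesis
  proof eventually_elim
    case (elim \<omega>)
    have "\<And>t. 0 \<le> t \<Longrightarrow> Y t \<omega> =
        Y 0 \<omega> - (1 / \<epsilon>) *\<^sub>R (LINT u:{0..t}|lborel. grad V (Y u \<omega>)) + sqrt (2 / \<epsilon>) *\<^sub>R B t \<omega>"
      using elim(1) by blast
    from euler_chain_tendsto[where y = "\<lambda>t. Y t \<omega>" and w = "\<lambda>t. sqrt (2 / \<epsilon>) *\<^sub>R B t \<omega>", OF eps cont[OF elim(2)] this h nh]
    show ?case by (simp add: scaled_increment_def[abs_def])
  qed
qed

end

end

section \<open>Approximation by bounded Lipschitz functions\<close>

definition lipschitz_bounded :: "('a::metric_space \<Rightarrow> real) \<Rightarrow> bool" where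
  "lipschitz_bounded g \<longleftrightarrow> (\<exists>A. \<forall>x. \<bar>g x\<bar> \<le> A) \<and> (\<exists>\<Lambda>. \<forall>x y. \<bar>g x - g y\<bar> \<le> \<Lambda> * dist x y)"

lemma lipschitz_bounded_continuous: "lipschitz_bounded g \<Longrightarrow> continuous_on UNIV g"
proof -
  assume "lipschitz_bounded g"
  then obtain \<Lambda> where \<Lambda>: "\<And>x y. \<bar>g x - g y\<bar> \<le> \<Lambda> * dist x y" by (auto simp: lipschitz_bounded_def)
  have "(max \<Lambda> 0)-lipschitz_on UNIV g"
  proof (rule lipschitz_onI)
    show "dist (g x) (g y) \<le> max \<Lambda> 0 * dist x y" for x y
      using \<Lambda>[of x y] mult_right_mono[of \<Lambda> "max \<Lambda> 0" "dist x y"] by (simp add: dist_real_def)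
  qed simp
  then show ?thesis by (rule lipschitz_on_continuous_on)
qed

lemma lipschitz_bounded_const: "lipschitz_bounded (\<lambda>_. c)"
  unfolding lipschitz_bounded_def by (auto intro: exI[of _ 0] exI[of _ "\<bar>c\<bar>"])

lemma lipschitz_bounded_add:
  assumes "lipschitz_bounded f" "lipschitz_bounded g"
  shows "lipschitz_bounded (\<lambda>x. f x + g x)"
proof -
  obtain A B \<Lambda> M where *: "\<And>x. \<bar>f x\<bar> \<le> A" "\<And>x. \<bar>g x\<bar> \<le> B"
    "\<And>x y. \<bar>f x - f y\<bar> \<le> \<Lambda> * dist x y" "\<And>x y. \<bar>g x - g y\<bar> \<le> M * dist x y"
    using assms by (auto simp: lipschitz_bounded_def)
  have "\<bar>f x + g x\<bar> \<le> A + B" for x using *(1,2)[of x] by linarith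
  moreover have "\<bar>(f x + g x) - (f y + g y)\<bar> \<le> (\<Lambda> + M) * dist x y" for x y
    using *(3,4)[of x y] by (simp add: distrib_right)
  ultimately show ?thesis unfolding lipschitz_bounded_def by blast
qed

lemma lipschitz_bounded_scale:
  assumes "lipschitz_bounded f"
  shows "lipschitz_bounded (\<lambda>x. c * f x)"
proof -
  obtain A \<Lambda> where *: "\<And>x. \<bar>f x\<bar> \<le> A" "\<And>x y. \<bar>f x - f y\<bar> \<le> \<Lambda> * dist x y"
    using assms by (auto simp: lipschitz_bounded_def)
  have "\<bar>c * f x\<bar> \<le> \<bar>c\<bar> * A" for x using *(1)[of x] by (simp add: abs_mult mult_left_mono)
  moreover have "\<bar>c * f x - c * f y\<bar> \<le> (\<bar>c\<bar> * \<Lambda>) * dist x y" for x y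
    using mult_left_mono[OF *(2)[of x y], of "\<bar>c\<bar>"] by (simp add: right_diff_distrib[symmetric] abs_mult mult.assoc)
  ultimately show ?thesis unfolding lipschitz_bounded_def by blast
qed

text \<open>Lipschitz functions tending to the indicator of a closed F. The distance to the empty
  set is 0 by convention, so the bump of the empty set is constantly 1 and that set is treated
  separately below.\<close>

definition closed_bump :: "'a::metric_space set \<Rightarrow> nat \<Rightarrow> 'a \<Rightarrow> real" where
  "closed_bump F n x = max 0 (1 - real n * infdist x F)"

lemma closed_bump_bounds: "0 \<le> closed_bump F n x" "closed_bump F n x \<le> 1"
  by (auto simp: closed_bump_def infdist_nonneg)

lemma lipschitz_bounded_closed_bump: "lipschitz_bounded (closed_bump F n)"
  unfolding lipschitz_bounded_def
proof (intro conjI exI allI)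
  show "\<bar>closed_bump F n x\<bar> \<le> 1" for x using closed_bump_bounds[of F n x] by simp
  show "\<bar>closed_bump F n x - closed_bump F n y\<bar> \<le> real n * dist x y" for x y
  proof -
    have "\<bar>infdist x F - infdist y F\<bar> \<le> dist x y" by (rule infdist_triangle_abs)
    from mult_left_mono[OF this, of "real n"]
    have "\<bar>real n * infdist x F - real n * infdist y F\<bar> \<le> real n * dist x y"
      by (simp add: right_diff_distrib[symmetric] abs_mult)
    then show ?thesis unfolding closed_bump_def by (auto simp: max_def abs_le_iff)
  qed
qed

lemma closed_bump_tendsto:
  assumes "closed F" "F \<noteq> {}"
  shows "(\<lambda>n. closed_bump F n x) \<longlonglongrightarrow> indicator F x"
proof (cases "x \<in> F")
  case True
  then show ?thesis by (simp add: closed_bump_def)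
next
  case False
  then have pos: "0 < infdist x F" using assms by (simp add: infdist_pos_not_in_closed)
  obtain n0 :: nat where n0: "1 < real n0 * infdist x F" using reals_Archimedean3[OF pos] by blast
  have "\<forall>\<^sub>F n in sequentially. closed_bump F n x = indicator F x"
    using eventually_ge_at_top[of n0]
  proof eventually_elim
    case (elim n)
    then have "real n0 * infdist x F \<le> real n * infdist x F" using pos by (intro mult_right_mono) auto
    then show ?case using n0 False by (simp add: closed_bump_def)
  qed
  then show ?thesis by (rule tendsto_eventually)
qed

lemma closed_bump_measurable [measurable]: "closed_bump F n \<in> borel_measurable borel"
  by (intro borel_measurable_continuous_onI lipschitz_bounded_continuous lipschitz_bounded_closed_bump)

lemma closed_bump_integral_tendsto:
  assumes "prob_space M" "sets M = sets borel" and F: "closed F" "F \<noteq> {}"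
  shows "(\<lambda>n. LINT x|M. closed_bump F n x) \<longlonglongrightarrow> measure M F"
proof -
  interpret prob_space M by fact
  note [measurable_cong] = assms(2)
  have "(\<lambda>n. LINT x|M. closed_bump F n x) \<longlonglongrightarrow> (LINT x|M. indicator F x)"
  proof (rule integral_dominated_convergence[where w = "\<lambda>_. 1"])
    show "AE x in M. (\<lambda>n. closed_bump F n x) \<longlonglongrightarrow> indicator F x"
      using closed_bump_tendsto[OF F] by simp
    show "AE x in M. norm (closed_bump F n x) \<le> 1" for n
      by (simp add: abs_of_nonneg[OF closed_bump_bounds(1)] closed_bump_bounds(2))
    show "indicat_real F \<in> borel_measurable M"
      using F by (intro borel_measurable_indicator) (simp add: assms(2))
  qed auto
  then show ?thesis using sets_eq_imp_space_eq[OF assms(2)] by simp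
qed

text \<open>Closed sets are stable under intersection and generate the Borel sets, and their
  measures are limits of integrals of Lipschitz bumps.\<close>

lemma prob_measure_eq_lipschitz:
  fixes M N :: "'a::metric_space measure"
  assumes "prob_space M" "prob_space N" and sets: "sets M = sets borel" "sets N = sets borel"
    and eq: "\<And>g. lipschitz_bounded g \<Longrightarrow> (LINT x|M. g x) = (LINT x|N. g x)"
  shows "M = N"
proof (rule measure_eqI_generator_eq[where E = "Collect closed" and \<Omega> = UNIV and A = "\<lambda>_. UNIV"])
  interpret M: prob_space M by fact
  interpret N: prob_space N by fact
  note [measurable_cong] = sets
  show "Int_stable (Collect closed :: 'a set set)" by (auto simp: Int_stable_def)
  show "sets M = sigma_sets UNIV (Collect closed)" "sets N = sigma_sets UNIV (Collect closed)"
    unfolding sets by (simp_all add: borel_eq_closed)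
  fix F :: "'a set" assume "F \<in> Collect closed"
  then have F: "closed F" by simp
  show "emeasure M F = emeasure N F"
  proof (cases "F = {}")
    case False
    have "measure M F = measure N F"
      using closed_bump_integral_tendsto[OF assms(1) sets(1) F False]
        closed_bump_integral_tendsto[OF assms(2) sets(2) F False]
      unfolding eq[OF lipschitz_bounded_closed_bump] by (rule LIMSEQ_unique)
    then show ?thesis by (simp add: M.emeasure_eq_measure N.emeasure_eq_measure)
  qed simp
qed (use assms(1) in \<open>auto simp: prob_space.emeasure_space_1 prob_space_def finite_measure.emeasure_finite\<close>)

section \<open>Density of bounded Lipschitz functions in L2\<close>

definition lipschitz_approximable :: "'a::metric_space measure \<Rightarrow> ('a \<Rightarrow> real) \<Rightarrow> bool" where
  "lipschitz_approximable M f \<longleftrightarrow> f \<in> borel_measurable borel \<and> integrable M (\<lambda>x. (f x)\<^sup>2) \<and>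
     (\<forall>e>0. \<exists>g. lipschitz_bounded g \<and> (LINT x|M. (f x - g x)\<^sup>2) < e)"

lemma square_sum_le: "(a + b)\<^sup>2 \<le> 2 * a\<^sup>2 + 2 * (b::real)\<^sup>2"
  using zero_le_power2[of "a - b"] by (simp add: power2_sum power2_diff)

context
  fixes M :: "'a::polish_space measure"
  assumes prob: "prob_space M" and sets_M [measurable_cong]: "sets M = sets borel"
begin

interpretation prob_space M by (rule prob)

lemma lipschitz_bounded_measurable:
  assumes "lipschitz_bounded (g :: 'a \<Rightarrow> real)"
  shows "g \<in> borel_measurable M" "g \<in> borel_measurable borel"
  using borel_measurable_continuous_onI[OF lipschitz_bounded_continuous[OF assms]]
  by (simp_all add: measurable_cong_sets[OF sets_M refl])

lemma lipschitz_bounded_square_integrable: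
  assumes "lipschitz_bounded (g :: 'a \<Rightarrow> real)"
  shows "integrable M (\<lambda>x. (g x)\<^sup>2)"
proof -
  obtain A where A: "\<And>x. \<bar>g x\<bar> \<le> A" using assms by (auto simp: lipschitz_bounded_def)
  have "(g x)\<^sup>2 \<le> A\<^sup>2" for x using power_mono[OF A[of x], of 2] by simp
  then show ?thesis
    using lipschitz_bounded_measurable[OF assms] by (intro integrable_const_bound[of _ "A\<^sup>2"]) auto
qed

lemma square_integrable_diff:
  fixes f g :: "'a \<Rightarrow> real"
  assumes [measurable]: "f \<in> borel_measurable M" "g \<in> borel_measurable M"
    and int: "integrable M (\<lambda>x. (f x)\<^sup>2)" "integrable M (\<lambda>x. (g x)\<^sup>2)"
  shows "integrable M (\<lambda>x. (f x - g x)\<^sup>2)" and "integrable M (\<lambda>x. (f x + g x)\<^sup>2)"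
proof -
  have dom: "integrable M (\<lambda>x. 2 * (f x)\<^sup>2 + 2 * (g x)\<^sup>2)" using int by simp
  show "integrable M (\<lambda>x. (f x - g x)\<^sup>2)"
    using square_sum_le[of "f _" "- g _"] by (intro Bochner_Integration.integrable_bound[OF dom]) auto
  show "integrable M (\<lambda>x. (f x + g x)\<^sup>2)"
    using square_sum_le[of "f _" "g _"] by (intro Bochner_Integration.integrable_bound[OF dom]) auto
qed

lemma integral_square_sum_le:
  fixes f g :: "'a \<Rightarrow> real"
  assumes [measurable]: "f \<in> borel_measurable M" "g \<in> borel_measurable M"
    and int: "integrable M (\<lambda>x. (f x)\<^sup>2)" "integrable M (\<lambda>x. (g x)\<^sup>2)"
  shows "(LINT x|M. (f x + g x)\<^sup>2) \<le> 2 * (LINT x|M. (f x)\<^sup>2) + 2 * (LINT x|M. (g x)\<^sup>2)"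
proof -
  have "(LINT x|M. (f x + g x)\<^sup>2) \<le> (LINT x|M. 2 * (f x)\<^sup>2 + 2 * (g x)\<^sup>2)"
    using square_integrable_diff(2)[OF assms] int square_sum_le by (intro integral_mono) auto
  then show ?thesis using int by simp
qed

lemma lipschitz_approximable_add:
  assumes f: "lipschitz_approximable M f" and g: "lipschitz_approximable M g"
  shows "lipschitz_approximable M (\<lambda>x. f x + g x)"
  unfolding lipschitz_approximable_def
proof (intro conjI allI impI)
  have fm: "f \<in> borel_measurable M" "g \<in> borel_measurable M" "integrable M (\<lambda>x. (f x)\<^sup>2)" "integrable M (\<lambda>x. (g x)\<^sup>2)"
    using f g by (auto simp: lipschitz_approximable_def measurable_cong_sets[OF sets_M refl])
  show "(\<lambda>x. f x + g x) \<in> borel_measurable borel" using fm by (simp add: measurable_cong_sets[OF sets_M refl])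
  show "integrable M (\<lambda>x. (f x + g x)\<^sup>2)" by (rule square_integrable_diff(2)) fact+
  fix e :: real assume e: "0 < e"
  then obtain u v where u: "lipschitz_bounded u" "(LINT x|M. (f x - u x)\<^sup>2) < e / 4"
    and v: "lipschitz_bounded v" "(LINT x|M. (g x - v x)\<^sup>2) < e / 4"
    using f g unfolding lipschitz_approximable_def by (meson zero_less_divide_iff zero_less_numeral)
  note um = lipschitz_bounded_measurable(1)[OF u(1)] lipschitz_bounded_square_integrable[OF u(1)]
  note vm = lipschitz_bounded_measurable(1)[OF v(1)] lipschitz_bounded_square_integrable[OF v(1)]
  have "(LINT x|M. ((f x - u x) + (g x - v x))\<^sup>2) \<le> 2 * (LINT x|M. (f x - u x)\<^sup>2) + 2 * (LINT x|M. (g x - v x)\<^sup>2)"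
    using fm um vm by (intro integral_square_sum_le square_integrable_diff) auto
  also have "\<dots> < e" using u v by simp
  finally have "(LINT x|M. (f x + g x - (u x + v x))\<^sup>2) < e" by (simp add: algebra_simps)
  with lipschitz_bounded_add[OF u(1) v(1)]
  show "\<exists>u. lipschitz_bounded u \<and> (LINT x|M. (f x + g x - u x)\<^sup>2) < e" by blast
qed

lemma lipschitz_approximable_scale:
  assumes f: "lipschitz_approximable M f"
  shows "lipschitz_approximable M (\<lambda>x. c * f x)"
  unfolding lipschitz_approximable_def
proof (intro conjI allI impI)
  show "(\<lambda>x. c * f x) \<in> borel_measurable borel" "integrable M (\<lambda>x. (c * f x)\<^sup>2)"
    using f by (auto simp: lipschitz_approximable_def power_mult_distrib)
  fix e :: real assume e: "0 < e"
  define e' where "e' = e / (c\<^sup>2 + 1)"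
  have c: "0 < c\<^sup>2 + 1" by (simp add: add_nonneg_pos)
  have e': "0 < e'" using e c by (simp add: e'_def)
  then obtain u where u: "lipschitz_bounded u" "(LINT x|M. (f x - u x)\<^sup>2) < e'"
    using f unfolding lipschitz_approximable_def by blast
  have "(LINT x|M. (c * f x - c * u x)\<^sup>2) = c\<^sup>2 * (LINT x|M. (f x - u x)\<^sup>2)"
    by (simp add: right_diff_distrib[symmetric] power_mult_distrib)
  also have "\<dots> \<le> c\<^sup>2 * e'" using u by (intro mult_left_mono) auto
  also have "\<dots> < e" using e c by (simp add: e'_def field_simps)
  finally show "\<exists>u. lipschitz_bounded u \<and> (LINT x|M. (c * f x - u x)\<^sup>2) < e"
    using lipschitz_bounded_scale[OF u(1), of c] by blast
qed

lemma lipschitz_approximable_limit: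
  assumes f: "f \<in> borel_measurable borel" "integrable M (\<lambda>x. (f x)\<^sup>2)"
    and F: "\<And>n. lipschitz_approximable M (F n)" and lim: "(\<lambda>n::nat. LINT x|M. (f x - F n x)\<^sup>2) \<longlonglongrightarrow> 0"
  shows "lipschitz_approximable M f"
  unfolding lipschitz_approximable_def
proof (intro conjI f allI impI)
  fix e :: real assume e: "0 < e"
  have "\<forall>\<^sub>F n in sequentially. (LINT x|M. (f x - F n x)\<^sup>2) < e / 4"
    using order_tendstoD(2)[OF lim, of "e / 4"] e by simp
  then obtain n where n: "(LINT x|M. (f x - F n x)\<^sup>2) < e / 4" by (auto simp: eventually_sequentially)
  obtain u where u: "lipschitz_bounded u" "(LINT x|M. (F n x - u x)\<^sup>2) < e / 4"
    using F[of n] e unfolding lipschitz_approximable_def by (meson zero_less_divide_iff zero_less_numeral)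
  have meas: "f \<in> borel_measurable M" "F n \<in> borel_measurable M" "integrable M (\<lambda>x. (F n x)\<^sup>2)"
    using f F[of n] by (auto simp: lipschitz_approximable_def measurable_cong_sets[OF sets_M refl])
  note um = lipschitz_bounded_measurable(1)[OF u(1)] lipschitz_bounded_square_integrable[OF u(1)]
  have "(LINT x|M. ((f x - F n x) + (F n x - u x))\<^sup>2) \<le> 2 * (LINT x|M. (f x - F n x)\<^sup>2) + 2 * (LINT x|M. (F n x - u x)\<^sup>2)"
    using meas um f by (intro integral_square_sum_le square_integrable_diff) auto
  also have "\<dots> < e" using u n by simp
  finally show "\<exists>u. lipschitz_bounded u \<and> (LINT x|M. (f x - u x)\<^sup>2) < e" using u(1) by auto
qed

lemma lipschitz_approximable_closed_indicator:
  assumes "closed F"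
  shows "lipschitz_approximable M (indicator F)"
proof (cases "F = {}")
  case True
  then show ?thesis
    unfolding lipschitz_approximable_def using lipschitz_bounded_const[of 0] by (auto intro!: exI[of _ "\<lambda>_. 0"])
next
  case False
  have [measurable]: "F \<in> sets borel" using assms by simp
  show ?thesis
  proof (rule lipschitz_approximable_limit[where F = "closed_bump F"])
    show "integrable M (\<lambda>x. (indicat_real F x)\<^sup>2)"
    proof (rule integrable_const_bound[of _ 1])
      show "(\<lambda>x. (indicat_real F x)\<^sup>2) \<in> borel_measurable M" by measurable
    qed (auto simp: indicator_def)
    show "lipschitz_approximable M (closed_bump F n)" for n
      using lipschitz_bounded_closed_bump[of F n] lipschitz_bounded_square_integrable[OF lipschitz_bounded_closed_bump[of F n]]
      unfolding lipschitz_approximable_def by (auto intro!: exI[of _ "closed_bump F n"])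
    have "(\<lambda>n. LINT x|M. (indicat_real F x - closed_bump F n x)\<^sup>2) \<longlonglongrightarrow> (LINT x|M. 0)"
    proof (rule integral_dominated_convergence[where w = "\<lambda>_. 1"])
      show "AE x in M. (\<lambda>n. (indicat_real F x - closed_bump F n x)\<^sup>2) \<longlonglongrightarrow> 0"
      proof (rule AE_I2)
        fix x
        have "(\<lambda>n. (indicat_real F x - closed_bump F n x)\<^sup>2) \<longlonglongrightarrow> (indicat_real F x - indicat_real F x)\<^sup>2"
          by (intro tendsto_intros closed_bump_tendsto assms False)
        then show "(\<lambda>n. (indicat_real F x - closed_bump F n x)\<^sup>2) \<longlonglongrightarrow> 0" by simp
      qed
      show "AE x in M. norm ((indicat_real F x - closed_bump F n x)\<^sup>2) \<le> 1" for n
      proof (rule AE_I2)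
        fix x
        have "\<bar>indicat_real F x - closed_bump F n x\<bar> \<le> 1" using closed_bump_bounds[of F n x] by (auto simp: indicator_def)
        then show "norm ((indicat_real F x - closed_bump F n x)\<^sup>2) \<le> 1" by (simp add: abs_square_le_1)
      qed
    qed (use assms in measurable)
    then show "(\<lambda>n. LINT x|M. (indicat_real F x - closed_bump F n x)\<^sup>2) \<longlonglongrightarrow> 0" by simp
  qed (use assms in auto)
qed

text \<open>Inner regularity of a finite Borel measure on a Polish space supplies closed subsets of
  almost full measure; the squared L2 distance of the indicators is the missing measure.\<close>

lemma lipschitz_approximable_indicator:
  assumes A: "A \<in> sets borel"
  shows "lipschitz_approximable M (indicator A)"
proof -
  have "\<exists>F. closed F \<and> F \<subseteq> A \<and> measure M A - measure M F < 1 / Suc n" for n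
  proof -
    have "emeasure M A = (SUP K\<in>{K. K \<subseteq> A \<and> compact K}. emeasure M K)"
      by (rule inner_regular) (auto simp: A sets_M)
    moreover have "emeasure M A - ennreal (1 / Suc n) < emeasure M A \<or> emeasure M A = 0"
      by (auto simp: emeasure_eq_measure ennreal_minus zero_less_measure_iff intro!: ennreal_lessI)
    ultimately have "\<exists>K\<in>{K. K \<subseteq> A \<and> compact K}. measure M A - 1 / Suc n < measure M K"
    proof (cases "emeasure M A = 0")
      case True
      then show ?thesis by (intro bexI[of _ "{}"]) (auto simp: measure_def)
    next
      case False
      then have "emeasure M A - ennreal (1 / Suc n) < (SUP K\<in>{K. K \<subseteq> A \<and> compact K}. emeasure M K)"
        using \<open>emeasure M A = _\<close> \<open>_ \<or> _\<close> by simp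
      then obtain K where K: "K \<subseteq> A" "compact K" "emeasure M A - ennreal (1 / Suc n) < emeasure M K"
        by (auto simp: less_SUP_iff)
      have "measure M A - 1 / Suc n < measure M K \<or> measure M A - 1 / Suc n < 0"
        using K(3) by (auto simp: emeasure_eq_measure ennreal_minus ennreal_less_iff)
      then have "measure M A - 1 / Suc n < measure M K" using measure_nonneg[of M K] by linarith
      then show ?thesis using K by blast
    qed
    then show ?thesis by (auto intro!: compact_imp_closed simp: algebra_simps)
  qed
  then obtain F where F: "\<And>n. closed (F n)" "\<And>n. F n \<subseteq> A" "\<And>n. measure M A - measure M (F n) < 1 / Suc n" by metis
  note [measurable] = A
  show ?thesis
  proof (rule lipschitz_approximable_limit[where F = "\<lambda>n. indicator (F n)"])
    show "integrable M (\<lambda>x. (indicat_real A x)\<^sup>2)"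
      by (intro integrable_const_bound[of _ 1]) (auto simp: indicator_def)
    have "(LINT x|M. (indicat_real A x - indicator (F n) x)\<^sup>2) = measure M A - measure M (F n)" for n
    proof -
      have "(LINT x|M. (indicat_real A x - indicator (F n) x)\<^sup>2) = (LINT x|M. indicator (A - F n) x)"
        using F(2)[of n] by (intro Bochner_Integration.integral_cong) (auto simp: indicator_def)
      also have "\<dots> = measure M (A - F n)" using A F(1)[of n] sets_eq_imp_space_eq[OF sets_M] by simp
      also have "\<dots> = measure M A - measure M (F n)"
        using A F(1,2)[of n] by (intro finite_measure_Diff) (auto simp: sets_M)
      finally show ?thesis .
    qed
    moreover have "(\<lambda>n. measure M A - measure M (F n)) \<longlonglongrightarrow> 0"
    proof (rule tendsto_sandwich[OF _ _ tendsto_const])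
      show "\<forall>\<^sub>F n in sequentially. 0 \<le> measure M A - measure M (F n)"
        using F(2) A by (auto intro!: always_eventually finite_measure_mono simp: sets_M)
      show "\<forall>\<^sub>F n in sequentially. measure M A - measure M (F n) \<le> inverse (real (Suc n))"
        using F(3) by (auto intro!: always_eventually less_imp_le simp: inverse_eq_divide)
    qed (rule LIMSEQ_inverse_real_of_nat)
    ultimately show "(\<lambda>n. LINT x|M. (indicat_real A x - indicator (F n) x)\<^sup>2) \<longlonglongrightarrow> 0" by simp
  qed (use F lipschitz_approximable_closed_indicator in auto)
qed

text \<open>Simple functions are finite combinations of indicators. They can be chosen with absolute
  value at most twice that of f, so 9 times f squared dominates the squared errors.\<close>

lemma lipschitz_approximable_square_integrable:
  assumes f: "f \<in> borel_measurable borel" "integrable M (\<lambda>x. (f x)\<^sup>2)"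
  shows "lipschitz_approximable M f"
proof -
  have "f \<in> borel_measurable M" using f by (simp add: measurable_cong_sets[OF sets_M refl])
  from borel_measurable_implies_sequence_metric[OF this, of 0] obtain F where
    F: "\<And>i. simple_function M (F i)" "\<And>x. x \<in> space M \<Longrightarrow> (\<lambda>i. F i x) \<longlonglongrightarrow> f x"
      "\<And>i x. x \<in> space M \<Longrightarrow> dist (F i x) 0 \<le> 2 * dist (f x) 0" by blast
  have space: "space M = UNIV" using sets_eq_imp_space_eq[OF sets_M] by simp
  have approx_sum: "lipschitz_approximable M (\<lambda>x. \<Sum>y\<in>Y. c y * indicator (S y) x)"
    if "finite Y" "\<And>y. y \<in> Y \<Longrightarrow> S y \<in> sets borel" for Y :: "real set" and c S
    using that
  proof (induction Y)
    case empty
    have "lipschitz_approximable M (\<lambda>x. 0 * indicator ({} :: 'a set) x)"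
      by (intro lipschitz_approximable_scale lipschitz_approximable_indicator) auto
    then show ?case by simp
  next
    case (insert y Y)
    show ?case
      unfolding sum.insert[OF insert.hyps]
      by (intro lipschitz_approximable_add lipschitz_approximable_scale lipschitz_approximable_indicator insert) auto
  qed
  have meas: "F n \<in> borel_measurable M" for n using F(1) by (rule borel_measurable_simple_function)
  show ?thesis
  proof (rule lipschitz_approximable_limit[OF f, where F = F])
    fix n
    have "F n = (\<lambda>x. \<Sum>y\<in>F n ` UNIV. y * indicator (F n -` {y}) x)"
    proof
      fix x
      have "(\<Sum>y\<in>F n ` UNIV. y * indicator (F n -` {y}) x) = (\<Sum>y\<in>F n ` UNIV. if y = F n x then y else 0)"
        by (intro sum.cong) (auto simp: indicator_def)
      also have "\<dots> = F n x" using F(1)[of n] by (simp add: simple_function_def space)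
      finally show "F n x = (\<Sum>y\<in>F n ` UNIV. y * indicator (F n -` {y}) x)" by simp
    qed
    moreover have "lipschitz_approximable M (\<lambda>x. \<Sum>y\<in>F n ` UNIV. y * indicator (F n -` {y}) x)"
      using F(1)[of n] by (intro approx_sum) (auto simp: simple_function_def space sets_M)
    ultimately show "lipschitz_approximable M (F n)" by simp
  next
    have "(\<lambda>n. LINT x|M. (f x - F n x)\<^sup>2) \<longlonglongrightarrow> (LINT x|M. 0)"
    proof (rule integral_dominated_convergence[where w = "\<lambda>x. 9 * (f x)\<^sup>2"])
      show "AE x in M. (\<lambda>n. (f x - F n x)\<^sup>2) \<longlonglongrightarrow> 0"
        using F(2) by (intro AE_I2) (auto intro!: tendsto_eq_intros)
      show "AE x in M. norm ((f x - F n x)\<^sup>2) \<le> 9 * (f x)\<^sup>2" for n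
      proof (rule AE_I2)
        fix x assume "x \<in> space M"
        then have "\<bar>f x - F n x\<bar> \<le> 3 * \<bar>f x\<bar>" using F(3)[of x n] by (auto simp: dist_real_def)
        from power_mono[OF this, of 2] show "norm ((f x - F n x)\<^sup>2) \<le> 9 * (f x)\<^sup>2"
          by (simp add: power_mult_distrib)
      qed
      show "integrable M (\<lambda>x. 9 * (f x)\<^sup>2)" using f by simp
    qed (use \<open>f \<in> borel_measurable M\<close> meas in auto)
    then show "(\<lambda>n. LINT x|M. (f x - F n x)\<^sup>2) \<longlonglongrightarrow> 0" by simp
  qed
qed

end

section \<open>Covariances of the stationary diffusion\<close>

lemma floor_grid_tendsto:
  assumes "0 \<le> t" and h: "\<And>N. 0 < h N" "h \<longlonglongrightarrow> 0"
  shows "(\<lambda>N. real (nat \<lfloor>t / h N\<rfloor>) * h N) \<longlonglongrightarrow> t"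
proof (rule tendsto_sandwich)
  have nat: "real (nat \<lfloor>t / h N\<rfloor>) = of_int \<lfloor>t / h N\<rfloor>" for N
    using assms(1) h(1)[of N] by (simp add: zero_le_floor)
  show "\<forall>\<^sub>F N in sequentially. t - h N \<le> real (nat \<lfloor>t / h N\<rfloor>) * h N"
  proof (intro always_eventually allI)
    fix N
    have "t / h N - 1 \<le> of_int \<lfloor>t / h N\<rfloor>" by linarith
    from mult_right_mono[OF this, of "h N"] show "t - h N \<le> real (nat \<lfloor>t / h N\<rfloor>) * h N"
      using h(1)[of N] by (simp add: nat left_diff_distrib)
  qed
  show "\<forall>\<^sub>F N in sequentially. real (nat \<lfloor>t / h N\<rfloor>) * h N \<le> t"
  proof (intro always_eventually allI)
    fix N
    have "of_int \<lfloor>t / h N\<rfloor> \<le> t / h N" by linarith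
    from mult_right_mono[OF this, of "h N"] show "real (nat \<lfloor>t / h N\<rfloor>) * h N \<le> t"
      using h(1)[of N] by (simp add: nat)
  qed
  show "(\<lambda>N. t - h N) \<longlonglongrightarrow> t" using tendsto_diff[OF tendsto_const h(2), of t] by simp
qed simp

text \<open>The number of steps times h^(3/2) is (n h) sqrt h, and n h stays bounded: the
  accumulated asymmetry vanishes.\<close>

lemma grid_error_tendsto:
  assumes h: "\<And>N. 0 < h N" "h \<longlonglongrightarrow> 0" and nh: "(\<lambda>N. real (n N) * h N) \<longlonglongrightarrow> t"
  shows "(\<lambda>N. real (n N) * (D * (h N * sqrt (h N)) * A * B)) \<longlonglongrightarrow> 0"
proof -
  have "(\<lambda>N. (real (n N) * h N) * sqrt (h N) * (D * A * B)) \<longlonglongrightarrow> t * sqrt 0 * (D * A * B)"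
    by (intro tendsto_intros nh h)
  then show ?thesis by (simp add: mult_ac)
qed

context langevin_potential
begin

context
  fixes M :: "'w measure" and \<epsilon> :: real and B Y :: "real \<Rightarrow> 'w \<Rightarrow> real^'d"
  assumes eps: "0 < \<epsilon>" and langevin: "stationary_langevin M V \<epsilon> B Y"
begin

interpretation prob_space M
  using langevin by (simp add: stationary_langevin_def brownian_motion_def)

text \<open>The scheme gives the Gibbs integral of the m-th iterate applied to w = a times the k-th
  iterate of b. Pairing with the constant 1, which the kernel fixes, almost symmetry removes the m
  iterations at a vanishing cost. The resulting sequence depends neither on s nor on
  \<open>\<epsilon>\<close>, which is stationarity in the limit.\<close>

lemma langevin_correlation_limit:
  fixes a b :: "real^'d \<Rightarrow> real"
  assumes a: "continuous_on UNIV a" "\<And>x. \<bar>a x\<bar> \<le> A" and b: "continuous_on UNIV b" "\<And>x. \<bar>b x\<bar> \<le> B'"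
    and h: "\<And>N. 0 < h N" "h \<longlonglongrightarrow> 0" and s: "0 \<le> s" and t: "0 \<le> t"
    and k: "(\<lambda>N. real (k N) * h N) \<longlonglongrightarrow> t"
  shows "(\<lambda>N. LINT x|\<pi>. a x * (euler_op (h N) ^^ k N) b x) \<longlonglongrightarrow> expectation (\<lambda>\<omega>. a (Y (\<epsilon> * s) \<omega>) * b (Y (\<epsilon> * (s + t)) \<omega>))"
proof -
  define m where "m N = nat \<lfloor>s / h N\<rfloor>" for N
  have m: "(\<lambda>N. real (m N) * h N) \<longlonglongrightarrow> s" unfolding m_def by (rule floor_grid_tendsto[OF s h])
  have mk: "(\<lambda>N. real (m N + k N) * h N) \<longlonglongrightarrow> s + t"
    using tendsto_add[OF m k] by (simp add: distrib_right)
  have a_meas [measurable]: "a \<in> borel_measurable borel" and b_meas [measurable]: "b \<in> borel_measurable borel"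
    using a b by (auto intro: borel_measurable_continuous_onI)
  have A0: "0 \<le> A" using a(2)[of undefined] abs_ge_zero order_trans by blast
  have st: "0 \<le> \<epsilon> * s" "0 \<le> \<epsilon> * (s + t)" using eps s t by auto
  let ?X = "\<lambda>N n \<omega>. euler_chain (h N) (Y 0 \<omega>) (scaled_increment \<epsilon> B (h N) \<omega>) n"
  have X_meas: "(\<lambda>\<omega>. ?X N n \<omega>) \<in> borel_measurable M" for N n
  proof -
    have "(\<lambda>\<omega>. (Y 0 \<omega>, scaled_increment \<epsilon> B (h N) \<omega>)) \<in> measurable M (borel \<Otimes>\<^sub>M PiM UNIV (\<lambda>_. borel))"
      by (intro measurable_Pair Y_measurable[OF eps langevin] scaled_increment_measurable[OF eps langevin h(1)]) simp
    from measurable_compose[OF this euler_chain_measurable] show ?thesis by simp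
  qed
  have "(\<lambda>N. expectation (\<lambda>\<omega>. a (?X N (m N) \<omega>) * b (?X N (m N + k N) \<omega>)))
      \<longlonglongrightarrow> expectation (\<lambda>\<omega>. a (Y (\<epsilon> * s) \<omega>) * b (Y (\<epsilon> * (s + t)) \<omega>))"
  proof (rule integral_dominated_convergence[where w = "\<lambda>_. A * B'"])
    show "AE \<omega> in M. (\<lambda>N. a (?X N (m N) \<omega>) * b (?X N (m N + k N) \<omega>)) \<longlonglongrightarrow> a (Y (\<epsilon> * s) \<omega>) * b (Y (\<epsilon> * (s + t)) \<omega>)"
      using euler_scheme_tendsto[OF eps langevin h m] euler_scheme_tendsto[OF eps langevin h mk]
    proof eventually_elim
      case (elim \<omega>)
      then show ?case
        by (intro tendsto_mult continuous_on_tendsto_compose[OF a(1)] continuous_on_tendsto_compose[OF b(1)]) auto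
    qed
    show "(\<lambda>\<omega>. a (Y (\<epsilon> * s) \<omega>) * b (Y (\<epsilon> * (s + t)) \<omega>)) \<in> borel_measurable M"
      by (intro borel_measurable_times measurable_compose[OF Y_measurable[OF eps langevin]] a_meas b_meas st)
    show "(\<lambda>\<omega>. a (?X N (m N) \<omega>) * b (?X N (m N + k N) \<omega>)) \<in> borel_measurable M" for N
      by (intro borel_measurable_times measurable_compose[OF X_meas] a_meas b_meas)
    show "AE \<omega> in M. norm (a (?X N (m N) \<omega>) * b (?X N (m N + k N) \<omega>)) \<le> A * B'" for N
      by (intro AE_I2) (auto simp: abs_mult intro!: mult_mono a b A0)
  qed simp
  then have lim: "(\<lambda>N. LINT x|\<pi>. (euler_op (h N) ^^ m N) (\<lambda>x. a x * (euler_op (h N) ^^ k N) b x) x)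
      \<longlonglongrightarrow> expectation (\<lambda>\<omega>. a (Y (\<epsilon> * s) \<omega>) * b (Y (\<epsilon> * (s + t)) \<omega>))"
    unfolding euler_scheme_two_times[OF eps langevin h(1) a_meas a(2) b_meas b(2)] .
  obtain D where D: "\<And>n h u v A B. 0 < h \<Longrightarrow> h \<le> 1 \<Longrightarrow> u \<in> borel_measurable borel \<Longrightarrow> v \<in> borel_measurable borel \<Longrightarrow>
      (\<And>x. \<bar>u x\<bar> \<le> A) \<Longrightarrow> (\<And>x. \<bar>v x\<bar> \<le> B) \<Longrightarrow>
    \<bar>(LINT x|\<pi>. u x * (euler_op h ^^ n) v x) - (LINT x|\<pi>. (euler_op h ^^ n) u x * v x)\<bar>
      \<le> real n * (D * (h * sqrt h) * A * B)"
    using euler_op_iterate_almost_symmetric by blast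
  have "(\<lambda>N. (LINT x|\<pi>. (euler_op (h N) ^^ m N) (\<lambda>x. a x * (euler_op (h N) ^^ k N) b x) x)
      - (LINT x|\<pi>. a x * (euler_op (h N) ^^ k N) b x)) \<longlonglongrightarrow> 0"
  proof (rule Lim_null_comparison)
    show "(\<lambda>N. real (m N) * (D * (h N * sqrt (h N)) * 1 * (A * B'))) \<longlonglongrightarrow> 0"
      by (rule grid_error_tendsto[OF h m])
    have "\<forall>\<^sub>F N in sequentially. h N < 1" using order_tendstoD(2)[OF h(2), of 1] by simp
    then show "\<forall>\<^sub>F N in sequentially. norm ((LINT x|\<pi>. (euler_op (h N) ^^ m N) (\<lambda>x. a x * (euler_op (h N) ^^ k N) b x) x)
      - (LINT x|\<pi>. a x * (euler_op (h N) ^^ k N) b x)) \<le> real (m N) * (D * (h N * sqrt (h N)) * 1 * (A * B'))"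
    proof eventually_elim
      case (elim N)
      note bk = euler_op_iterate[where h = "h N" and n = "k N", OF b_meas h(1) b(2)]
      have "(\<lambda>x. a x * (euler_op (h N) ^^ k N) b x) \<in> borel_measurable borel"
        by (intro borel_measurable_times a_meas bk)
      moreover have "\<bar>a x * (euler_op (h N) ^^ k N) b x\<bar> \<le> A * B'" for x
        unfolding abs_mult by (intro mult_mono a bk A0) auto
      ultimately show ?case
        using D[of "h N" "\<lambda>_. 1" "\<lambda>x. a x * (euler_op (h N) ^^ k N) b x" 1 "A * B'" "m N"] elim h(1)[of N]
        by (simp add: euler_op_const)
    qed
  qed
  from tendsto_diff[OF lim this] show ?thesis by simp
qed

text \<open>The case b = 1 with lag 0, where the approximating sequence is constant.\<close>

lemma langevin_stationary:
  assumes t: "0 \<le> t"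
  shows "distr M borel (Y t) = \<pi>"
proof (rule prob_measure_eq_lipschitz)
  have meas: "Y t \<in> borel_measurable M" by (rule Y_measurable[OF eps langevin t])
  then show "prob_space (distr M borel (Y t))" by (rule prob_space_distr)
  fix g :: "real^'d \<Rightarrow> real" assume g: "lipschitz_bounded g"
  then obtain A where A: "\<And>x. \<bar>g x\<bar> \<le> A" by (auto simp: lipschitz_bounded_def)
  have "(\<lambda>N. LINT x|\<pi>. g x * (euler_op (inverse (real (Suc N))) ^^ 0) (\<lambda>_. 1) x)
      \<longlonglongrightarrow> expectation (\<lambda>\<omega>. g (Y (\<epsilon> * (t / \<epsilon>)) \<omega>) * 1)"
    using t eps by (intro langevin_correlation_limit[OF lipschitz_bounded_continuous[OF g] A, where B' = 1 and t = 0])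
      (auto intro: LIMSEQ_inverse_real_of_nat[unfolded of_nat_Suc])
  then have "(LINT x|\<pi>. g x) = expectation (\<lambda>\<omega>. g (Y t \<omega>))"
    using eps by (simp add: LIMSEQ_const_iff)
  then show "(LINT x|distr M borel (Y t). g x) = (LINT x|\<pi>. g x)"
    using meas borel_measurable_continuous_onI[OF lipschitz_bounded_continuous[OF g]] by (simp add: integral_distr)
qed (auto simp: prob_gibbs)

end

end

lemma psd_function_limit:
  assumes psd: "\<And>j. psd_function (C' j)" and lim: "\<And>t. 0 \<le> t \<Longrightarrow> (\<lambda>j::nat. C' j t) \<longlonglongrightarrow> C t"
  shows "psd_function C"
  unfolding psd_function_def
proof (intro allI impI)
  fix n :: nat and a t :: "nat \<Rightarrow> real" assume t: "\<forall>i<n. 0 \<le> t i"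
  have "(\<lambda>k. \<Sum>i<n. \<Sum>j<n. a i * a j * C' k (t i + t j)) \<longlonglongrightarrow> (\<Sum>i<n. \<Sum>j<n. a i * a j * C (t i + t j))"
    using t by (intro tendsto_sum tendsto_mult tendsto_const lim) auto
  moreover have "\<forall>\<^sub>F k in sequentially. 0 \<le> (\<Sum>i<n. \<Sum>j<n. a i * a j * C' k (t i + t j))"
    using psd t by (intro always_eventually allI) (auto simp: psd_function_def)
  ultimately show "0 \<le> (\<Sum>i<n. \<Sum>j<n. a i * a j * C (t i + t j))"
    by (rule tendsto_lowerbound) simp
qed

lemma abs_mult_le_weighted:
  fixes a b c :: real
  assumes "0 < c"
  shows "\<bar>a * b\<bar> \<le> (c * a\<^sup>2 + b\<^sup>2 / c) / 2"
proof -
  have "0 \<le> (c * \<bar>a\<bar> - \<bar>b\<bar>)\<^sup>2" by simp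
  then have "2 * (c * (\<bar>a\<bar> * \<bar>b\<bar>)) \<le> c * (c * a\<^sup>2) + b\<^sup>2"
    by (simp add: power2_diff power_mult_distrib) (simp add: power2_eq_square mult_ac)
  then show ?thesis using assms by (simp add: abs_mult field_simps)
qed

context langevin_potential
begin

text \<open>The free weight \<gamma> replaces a Cauchy-Schwarz bound: for a small factor it is
  chosen to balance the two squares.\<close>

lemma product_of_stationary:
  fixes u v :: "real^'d \<Rightarrow> real"
  assumes M: "prob_space M" and X [measurable]: "X \<in> borel_measurable M" "X' \<in> borel_measurable M"
    and law: "distr M borel X = \<pi>" "distr M borel X' = \<pi>"
    and u [measurable]: "u \<in> borel_measurable borel" and v [measurable]: "v \<in> borel_measurable borel"
    and int: "integrable \<pi> (\<lambda>x. (u x)\<^sup>2)" "integrable \<pi> (\<lambda>x. (v x)\<^sup>2)"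
  shows "integrable M (\<lambda>\<omega>. u (X \<omega>) * v (X' \<omega>))"
    and "0 < \<gamma> \<Longrightarrow> \<bar>LINT \<omega>|M. u (X \<omega>) * v (X' \<omega>)\<bar> \<le> (\<gamma> * (LINT x|\<pi>. (u x)\<^sup>2) + (LINT x|\<pi>. (v x)\<^sup>2) / \<gamma>) / 2"
proof -
  have iu: "integrable M (\<lambda>\<omega>. (u (X \<omega>))\<^sup>2)" and iv: "integrable M (\<lambda>\<omega>. (v (X' \<omega>))\<^sup>2)"
    using int integrable_distr_eq[OF X(1), of "\<lambda>x. (u x)\<^sup>2"] integrable_distr_eq[OF X(2), of "\<lambda>x. (v x)\<^sup>2"]
    by (simp_all add: law)
  have eu: "(LINT \<omega>|M. (u (X \<omega>))\<^sup>2) = (LINT x|\<pi>. (u x)\<^sup>2)" and ev: "(LINT \<omega>|M. (v (X' \<omega>))\<^sup>2) = (LINT x|\<pi>. (v x)\<^sup>2)"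
    using integral_distr[OF X(1), of "\<lambda>x. (u x)\<^sup>2"] integral_distr[OF X(2), of "\<lambda>x. (v x)\<^sup>2"]
    by (simp_all add: law)
  have dom: "integrable M (\<lambda>\<omega>. (\<gamma> * (u (X \<omega>))\<^sup>2 + (v (X' \<omega>))\<^sup>2 / \<gamma>) / 2)" for \<gamma> using iu iv by simp
  show int_uv: "integrable M (\<lambda>\<omega>. u (X \<omega>) * v (X' \<omega>))"
    using abs_mult_le_weighted[of 1]
    by (intro Bochner_Integration.integrable_bound[OF dom[of 1]]) (auto intro!: AE_I2 order_trans[OF _ abs_ge_self])
  assume \<gamma>: "0 < \<gamma>"
  have "\<bar>LINT \<omega>|M. u (X \<omega>) * v (X' \<omega>)\<bar> \<le> (LINT \<omega>|M. \<bar>u (X \<omega>) * v (X' \<omega>)\<bar>)" by (rule integral_abs_bound)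
  also have "\<dots> \<le> (LINT \<omega>|M. (\<gamma> * (u (X \<omega>))\<^sup>2 + (v (X' \<omega>))\<^sup>2 / \<gamma>) / 2)"
    using int_uv abs_mult_le_weighted[OF \<gamma>] by (intro integral_mono dom) auto
  also have "\<dots> = (\<gamma> * (LINT x|\<pi>. (u x)\<^sup>2) + (LINT x|\<pi>. (v x)\<^sup>2) / \<gamma>) / 2"
    using iu iv by (simp add: eu ev)
  finally show "\<bar>LINT \<omega>|M. u (X \<omega>) * v (X' \<omega>)\<bar> \<le> (\<gamma> * (LINT x|\<pi>. (u x)\<^sup>2) + (LINT x|\<pi>. (v x)\<^sup>2) / \<gamma>) / 2" .
qed

text \<open>Subtracting the mean of the approximant does not increase its L2 distance from f,
  because f has mean 0. Mean 0 is what \<open>correlation_decay\<close> demands.\<close>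

lemma centered_lipschitz_approximation:
  assumes f: "f \<in> borel_measurable borel" "integrable \<pi> (\<lambda>x. (f x)\<^sup>2)" and mean: "(LINT x|\<pi>. f x) = 0" and e: "0 < e"
  shows "\<exists>g. lipschitz_bounded g \<and> (LINT x|\<pi>. g x) = 0 \<and> (LINT x|\<pi>. (f x - g x)\<^sup>2) < e"
proof -
  obtain g where g: "lipschitz_bounded g" "(LINT x|\<pi>. (f x - g x)\<^sup>2) < e"
    using lipschitz_approximable_square_integrable[OF prob_gibbs sets_gibbs f] e
    unfolding lipschitz_approximable_def by blast
  note gm = lipschitz_bounded_measurable[OF prob_gibbs sets_gibbs g(1)]
    lipschitz_bounded_square_integrable[OF prob_gibbs sets_gibbs g(1)]
  have fm: "f \<in> borel_measurable \<pi>" using f by (simp add: measurable_cong_sets[OF sets_gibbs refl])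
  have fg2: "integrable \<pi> (\<lambda>x. (f x - g x)\<^sup>2)"
    using square_integrable_diff[OF prob_gibbs sets_gibbs] fm f gm by blast
  have fi: "integrable \<pi> f" using gibbs.square_integrable_imp_integrable fm f by blast
  have gi: "integrable \<pi> g" using gibbs.square_integrable_imp_integrable gm by blast
  define m where "m = (LINT x|\<pi>. g x)"
  have "(LINT x|\<pi>. (f x - (g x + - m))\<^sup>2) = (LINT x|\<pi>. (f x - g x)\<^sup>2 + 2 * m * (f x - g x) + m\<^sup>2)"
    by (intro Bochner_Integration.integral_cong) (auto simp: power2_eq_square algebra_simps)
  also have "\<dots> = (LINT x|\<pi>. (f x - g x)\<^sup>2) + 2 * m * (0 - m) + m\<^sup>2"
    using fg2 fi gi mean gibbs.prob_space by (simp add: m_def)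
  also have "\<dots> \<le> (LINT x|\<pi>. (f x - g x)\<^sup>2)" by (simp add: power2_eq_square)
  also have "\<dots> < e" by (rule g)
  finally have "(LINT x|\<pi>. (f x - (g x + - m))\<^sup>2) < e" .
  moreover have "lipschitz_bounded (\<lambda>x. g x + - m)" by (intro lipschitz_bounded_add lipschitz_bounded_const g)
  moreover have "(LINT x|\<pi>. g x + - m) = 0" using gi gibbs.prob_space by (simp add: m_def)
  ultimately show ?thesis by (intro exI[of _ "\<lambda>x. g x + - m"] conjI)
qed

context
  fixes M :: "real \<Rightarrow> 'w measure" and B Y :: "real \<Rightarrow> real \<Rightarrow> 'w \<Rightarrow> real^'d"
  assumes langevin: "\<And>\<epsilon>. 0 < \<epsilon> \<Longrightarrow> stationary_langevin (M \<epsilon>) V \<epsilon> (B \<epsilon>) (Y \<epsilon>)"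
begin

text \<open>Both s and t count time in units of \<open>\<epsilon>\<close>; t is the lag.\<close>

definition correlation :: "(real^'d \<Rightarrow> real) \<Rightarrow> real \<Rightarrow> real \<Rightarrow> real \<Rightarrow> real" where
  "correlation f \<epsilon> s t = (LINT \<omega>|M \<epsilon>. f (Y \<epsilon> (\<epsilon> * s) \<omega>) * f (Y \<epsilon> (\<epsilon> * (s + t)) \<omega>))"

lemma prob_M: "0 < \<epsilon> \<Longrightarrow> prob_space (M \<epsilon>)"
  using langevin[of \<epsilon>] unfolding stationary_langevin_def brownian_motion_def by blast

lemma correlation_limit:
  assumes g: "lipschitz_bounded g" and eps: "0 < \<epsilon>" and h: "\<And>N. 0 < h N" "h \<longlonglongrightarrow> 0" and s: "0 \<le> s" and t: "0 \<le> t"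
    and k: "(\<lambda>N. real (k N) * h N) \<longlonglongrightarrow> t"
  shows "(\<lambda>N. LINT x|\<pi>. g x * (euler_op (h N) ^^ k N) g x) \<longlonglongrightarrow> correlation g \<epsilon> s t"
proof -
  obtain A where A: "\<And>x. \<bar>g x\<bar> \<le> A" using g by (auto simp: lipschitz_bounded_def)
  note c = lipschitz_bounded_continuous[OF g]
  show ?thesis unfolding correlation_def
    by (rule langevin_correlation_limit[OF eps langevin[OF eps] c A c A h s t k])
qed

text \<open>Both sides are limits of the same sequence of Euler pairings, in which only t
  occurs.\<close>

lemma correlation_eq:
  assumes g: "lipschitz_bounded g" and "0 < \<epsilon>" "0 \<le> s" "0 \<le> t"
  shows "correlation g \<epsilon> s t = correlation g 1 0 t"
proof -
  define h where "h N = inverse (real (Suc N))" for N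
  have h: "\<And>N. 0 < h N" "h \<longlonglongrightarrow> 0" unfolding h_def by simp (rule LIMSEQ_inverse_real_of_nat)
  note lim = correlation_limit[OF g _ h _ \<open>0 \<le> t\<close> floor_grid_tendsto[OF \<open>0 \<le> t\<close> h]]
  show ?thesis using LIMSEQ_unique[OF lim[OF \<open>0 < \<epsilon>\<close> \<open>0 \<le> s\<close>] lim[of 1 0]] by simp
qed

text \<open>Almost symmetry splits the iterate of order \<open>k i + k j\<close> into one of order
  \<open>k i\<close> on each copy's left factor and \<open>k j\<close> on the right, so the
  coefficients approach a Gram matrix and the form approaches the square of an L2 norm.\<close>

lemma correlation_psd:
  assumes g: "lipschitz_bounded g"
  shows "psd_function (correlation g 1 0)"
  unfolding psd_function_def
proof (intro allI impI)
  fix n :: nat and a t :: "nat \<Rightarrow> real" assume "\<forall>i<n. 0 \<le> t i"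
  then have t: "\<And>i. i < n \<Longrightarrow> 0 \<le> t i" by auto
  obtain A where A: "\<And>x. \<bar>g x\<bar> \<le> A" using g by (auto simp: lipschitz_bounded_def)
  have gm [measurable]: "g \<in> borel_measurable borel"
    by (rule lipschitz_bounded_measurable(2)[OF prob_gibbs sets_gibbs g])
  define h where "h N = inverse (real (Suc N))" for N
  have h: "\<And>N. 0 < h N" "h \<longlonglongrightarrow> 0" unfolding h_def by simp (rule LIMSEQ_inverse_real_of_nat)
  define k where "k i N = nat \<lfloor>t i / h N\<rfloor>" for i N
  have k: "(\<lambda>N. real (k i N) * h N) \<longlonglongrightarrow> t i" if "i < n" for i
    unfolding k_def by (rule floor_grid_tendsto[OF t[OF that] h])
  define P where "P i N = (euler_op (h N) ^^ k i N) g" for i N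
  have P: "P i N \<in> borel_measurable borel" "\<bar>P i N x\<bar> \<le> A" for i N x
    unfolding P_def by (rule euler_op_iterate[OF gm h(1) A])+
  have P_int: "integrable \<pi> (\<lambda>x. P i N x * P j N x)" for i j N
  proof -
    have A0: "0 \<le> A" using A[of undefined] abs_ge_zero order_trans by blast
    show ?thesis
    proof (rule gibbs.integrable_const_bound[of _ "A * A"])
      show "AE x in \<pi>. norm (P i N x * P j N x) \<le> A * A"
        by (intro AE_I2) (auto simp: abs_mult intro!: mult_mono P A0)
      show "(\<lambda>x. P i N x * P j N x) \<in> borel_measurable \<pi>"
        using borel_measurable_times[OF P(1)[of i N] P(1)[of j N]] by (simp add: measurable_cong_sets[OF sets_gibbs refl])
    qed
  qed
  obtain D where D: "\<And>n h u v A B. 0 < h \<Longrightarrow> h \<le> 1 \<Longrightarrow> u \<in> borel_measurable borel \<Longrightarrow> v \<in> borel_measurable borel \<Longrightarrow>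
      (\<And>x. \<bar>u x\<bar> \<le> A) \<Longrightarrow> (\<And>x. \<bar>v x\<bar> \<le> B) \<Longrightarrow>
    \<bar>(LINT x|\<pi>. u x * (euler_op h ^^ n) v x) - (LINT x|\<pi>. (euler_op h ^^ n) u x * v x)\<bar>
      \<le> real n * (D * (h * sqrt h) * A * B)"
    using euler_op_iterate_almost_symmetric by blast
  have lim: "(\<lambda>N. LINT x|\<pi>. P i N x * P j N x) \<longlonglongrightarrow> correlation g 1 0 (t i + t j)" if ij: "i < n" "j < n" for i j
  proof -
    have "(\<lambda>N. real (k i N + k j N) * h N) \<longlonglongrightarrow> t i + t j"
      using tendsto_add[OF k[OF ij(1)] k[OF ij(2)]] by (simp add: distrib_right)
    from correlation_limit[OF g zero_less_one h order_refl _ this]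
    have 1: "(\<lambda>N. LINT x|\<pi>. g x * (euler_op (h N) ^^ (k i N + k j N)) g x) \<longlonglongrightarrow> correlation g 1 0 (t i + t j)"
      using t ij by simp
    have "(\<lambda>N. (LINT x|\<pi>. g x * (euler_op (h N) ^^ (k i N + k j N)) g x) - (LINT x|\<pi>. P i N x * P j N x)) \<longlonglongrightarrow> 0"
    proof (rule Lim_null_comparison)
      show "(\<lambda>N. real (k i N) * (D * (h N * sqrt (h N)) * A * A)) \<longlonglongrightarrow> 0"
        by (rule grid_error_tendsto[OF h k[OF ij(1)]])
      have "\<forall>\<^sub>F N in sequentially. h N < 1" using order_tendstoD(2)[OF h(2), of 1] by simp
      then show "\<forall>\<^sub>F N in sequentially. norm ((LINT x|\<pi>. g x * (euler_op (h N) ^^ (k i N + k j N)) g x)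
          - (LINT x|\<pi>. P i N x * P j N x)) \<le> real (k i N) * (D * (h N * sqrt (h N)) * A * A)"
      proof eventually_elim
        case (elim N)
        show ?case
          using D[of "h N" g "P j N" A A "k i N"] h(1)[of N] elim gm P[of j N] A
          by (simp add: P_def funpow_add)
      qed
    qed
    from tendsto_diff[OF 1 this] show ?thesis by simp
  qed
  have "(\<lambda>N. \<Sum>i<n. \<Sum>j<n. a i * a j * (LINT x|\<pi>. P i N x * P j N x))
      \<longlonglongrightarrow> (\<Sum>i<n. \<Sum>j<n. a i * a j * correlation g 1 0 (t i + t j))"
    by (intro tendsto_sum tendsto_mult tendsto_const lim) auto
  moreover have "\<forall>\<^sub>F N in sequentially. 0 \<le> (\<Sum>i<n. \<Sum>j<n. a i * a j * (LINT x|\<pi>. P i N x * P j N x))"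
  proof (intro always_eventually allI)
    fix N
    have "0 \<le> (LINT x|\<pi>. (\<Sum>i<n. a i * P i N x)\<^sup>2)" by (rule integral_nonneg_AE) simp
    also have "(LINT x|\<pi>. (\<Sum>i<n. a i * P i N x)\<^sup>2) = (LINT x|\<pi>. (\<Sum>i<n. \<Sum>j<n. a i * a j * (P i N x * P j N x)))"
      by (intro Bochner_Integration.integral_cong refl) (simp add: power2_eq_square sum_product mult_ac)
    also have "\<dots> = (\<Sum>i<n. \<Sum>j<n. a i * a j * (LINT x|\<pi>. P i N x * P j N x))"
      using P_int by simp
    finally show "0 \<le> (\<Sum>i<n. \<Sum>j<n. a i * a j * (LINT x|\<pi>. P i N x * P j N x))" .
  qed
  ultimately show "0 \<le> (\<Sum>i<n. \<Sum>j<n. a i * a j * correlation g 1 0 (t i + t j))"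
    by (rule tendsto_lowerbound) simp
qed

lemma correlation_decay:
  assumes g: "lipschitz_bounded g" and mean: "(LINT x|\<pi>. g x) = 0" and t: "0 \<le> t"
  shows "correlation g 1 0 t \<le> correlation g 1 0 0 * exp (- (K / 2) * t)"
proof -
  obtain A \<Lambda> where A: "\<And>x. \<bar>g x\<bar> \<le> A" and \<Lambda>: "\<And>x y. \<bar>g x - g y\<bar> \<le> \<Lambda> * norm (x - y)"
    using g by (auto simp: lipschitz_bounded_def dist_norm)
  have gm: "g \<in> borel_measurable borel"
    by (rule lipschitz_bounded_measurable(2)[OF prob_gibbs sets_gibbs g])
  \<comment> \<open>This constant involves the Lipschitz bound of g; \<open>psd_exp_decay\<close>
    removes it at the end.\<close>
  define c where "c = A * \<Lambda> * (LINT x|\<pi>. norm x)"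
  define h where "h N = inverse (real (Suc N))" for N
  have h: "\<And>N. 0 < h N" "h \<longlonglongrightarrow> 0" unfolding h_def by simp (rule LIMSEQ_inverse_real_of_nat)
  have bound: "correlation g 1 0 t \<le> c * exp (- (K / 2) * t)" if t: "0 \<le> t" for t
  proof -
    define k where "k N = nat \<lfloor>t / h N\<rfloor>" for N
    have k: "(\<lambda>N. real (k N) * h N) \<longlonglongrightarrow> t"
      unfolding k_def by (rule floor_grid_tendsto[OF t h])
    have "(\<lambda>N. c * exp (- (real (k N) * h N * K / 2))) \<longlonglongrightarrow> c * exp (- (t * K / 2))"
      by (intro tendsto_intros k) simp
    moreover have "\<forall>\<^sub>F N in sequentially. (LINT x|\<pi>. g x * (euler_op (h N) ^^ k N) g x) \<le> c * exp (- (real (k N) * h N * K / 2))"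
    proof -
      have "0 < K / L\<^sup>2" using K_pos L_ge_1 by simp
      then have "\<forall>\<^sub>F N in sequentially. h N < K / L\<^sup>2" using order_tendstoD(2)[OF h(2)] by simp
      then show ?thesis
      proof eventually_elim
        case (elim N)
        show ?case
          using euler_op_decay[OF gm A \<Lambda> h(1) less_imp_le[OF elim] mean, of "k N"] by (simp add: c_def)
      qed
    qed
    ultimately have "correlation g 1 0 t \<le> c * exp (- (t * K / 2))"
      using correlation_limit[OF g zero_less_one h order_refl t k] by (intro tendsto_le) auto
    then show ?thesis by (simp add: mult.commute)
  qed
  show ?thesis by (rule psd_exp_decay[OF correlation_psd[OF g] bound t])
qed

lemma correlation_continuous:
  assumes g: "lipschitz_bounded g"
  shows "continuous_on {0..} (correlation g 1 0)"
  unfolding continuous_on_sequentially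
proof (intro allI ballI impI)
  fix u :: "nat \<Rightarrow> real" and t assume t: "t \<in> {0..}" and u: "(\<forall>n. u n \<in> {0..}) \<and> u \<longlonglongrightarrow> t"
  interpret prob_space "M 1" by (rule prob_M) simp
  obtain A where A: "\<And>x. \<bar>g x\<bar> \<le> A" using g by (auto simp: lipschitz_bounded_def)
  have A0: "0 \<le> A" using A[of undefined] abs_ge_zero order_trans by blast
  have gm: "g \<in> borel_measurable borel"
    by (rule lipschitz_bounded_measurable(2)[OF prob_gibbs sets_gibbs g])
  have Y: "\<And>r. 0 \<le> r \<Longrightarrow> Y 1 r \<in> borel_measurable (M 1)" by (rule Y_measurable[OF _ langevin]) auto
  have meas: "(\<lambda>\<omega>. g (Y 1 0 \<omega>) * g (Y 1 r \<omega>)) \<in> borel_measurable (M 1)" if "0 \<le> r" for r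
    by (intro borel_measurable_times measurable_compose[OF Y gm] that order_refl)
  have cont: "\<forall>\<omega>\<in>space (M 1). continuous_on {0..} (\<lambda>t. Y 1 t \<omega>)"
    using langevin[OF zero_less_one] unfolding stationary_langevin_def by blast
  have "(\<lambda>n. expectation (\<lambda>\<omega>. g (Y 1 0 \<omega>) * g (Y 1 (u n) \<omega>))) \<longlonglongrightarrow> expectation (\<lambda>\<omega>. g (Y 1 0 \<omega>) * g (Y 1 t \<omega>))"
  proof (rule integral_dominated_convergence[where w = "\<lambda>_. A * A"])
    show "AE \<omega> in M 1. (\<lambda>n. g (Y 1 0 \<omega>) * g (Y 1 (u n) \<omega>)) \<longlonglongrightarrow> g (Y 1 0 \<omega>) * g (Y 1 t \<omega>)"
    proof (rule AE_I2)
      fix \<omega> assume "\<omega> \<in> space (M 1)"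
      then have "(\<lambda>n. Y 1 (u n) \<omega>) \<longlonglongrightarrow> Y 1 t \<omega>"
        using cont u t by (intro continuous_on_tendsto_compose[of "{0..}" "\<lambda>t. Y 1 t \<omega>"]) auto
      then show "(\<lambda>n. g (Y 1 0 \<omega>) * g (Y 1 (u n) \<omega>)) \<longlonglongrightarrow> g (Y 1 0 \<omega>) * g (Y 1 t \<omega>)"
        by (intro tendsto_mult tendsto_const continuous_on_tendsto_compose[OF lipschitz_bounded_continuous[OF g]]) auto
    qed
    show "AE \<omega> in M 1. norm (g (Y 1 0 \<omega>) * g (Y 1 (u n) \<omega>)) \<le> A * A" for n
      by (intro AE_I2) (auto simp: abs_mult intro!: mult_mono A A0)
  qed (use t u meas in auto)
  then show "(correlation g 1 0 \<circ> u) \<longlonglongrightarrow> correlation g 1 0 t"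
    by (simp add: correlation_def o_def)
qed

text \<open>One factor is changed at a time: f f' - g g' = (f - g) f' + g (f' - g'). The weights 1 /
  \<delta> and \<delta> make each summand of order \<delta>. The bound depends on f alone and is
  uniform in \<open>\<epsilon>\<close>, s and t.\<close>

lemma correlation_difference:
  assumes f: "f \<in> borel_measurable borel" "integrable \<pi> (\<lambda>x. (f x)\<^sup>2)"
    and g: "g \<in> borel_measurable borel" "integrable \<pi> (\<lambda>x. (g x)\<^sup>2)"
    and close: "(LINT x|\<pi>. (f x - g x)\<^sup>2) \<le> \<delta>\<^sup>2" and \<delta>: "0 < \<delta>" "\<delta> \<le> 1"
    and eps: "0 < \<epsilon>" and s: "0 \<le> s" and t: "0 \<le> t"
  shows "\<bar>correlation f \<epsilon> s t - correlation g \<epsilon> s t\<bar> \<le> \<delta> * (2 + 2 * (LINT x|\<pi>. (f x)\<^sup>2))"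
proof -
  let ?F = "LINT x|\<pi>. (f x)\<^sup>2" and ?G = "LINT x|\<pi>. (g x)\<^sup>2" and ?q = "LINT x|\<pi>. (f x - g x)\<^sup>2"
  let ?X = "Y \<epsilon> (\<epsilon> * s)" and ?X' = "Y \<epsilon> (\<epsilon> * (s + t))"
  have st: "0 \<le> \<epsilon> * s" "0 \<le> \<epsilon> * (s + t)" using eps s t by auto
  have fm: "f \<in> borel_measurable \<pi>" "g \<in> borel_measurable \<pi>"
    using f g by (simp_all add: measurable_cong_sets[OF sets_gibbs refl])
  have d: "(\<lambda>x. f x - g x) \<in> borel_measurable borel" "integrable \<pi> (\<lambda>x. (f x - g x)\<^sup>2)"
    using f g square_integrable_diff[OF prob_gibbs sets_gibbs] fm by auto
  note prod = product_of_stationary[OF prob_M[OF eps] Y_measurable[OF eps langevin[OF eps] st(1)]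
      Y_measurable[OF eps langevin[OF eps] st(2)] langevin_stationary[OF eps langevin[OF eps] st(1)]
      langevin_stationary[OF eps langevin[OF eps] st(2)]]
  have "correlation f \<epsilon> s t - correlation g \<epsilon> s t
      = (LINT \<omega>|M \<epsilon>. (f (?X \<omega>) - g (?X \<omega>)) * f (?X' \<omega>)) + (LINT \<omega>|M \<epsilon>. g (?X \<omega>) * (f (?X' \<omega>) - g (?X' \<omega>)))"
  proof -
    have "(LINT \<omega>|M \<epsilon>. (f (?X \<omega>) - g (?X \<omega>)) * f (?X' \<omega>)) = correlation f \<epsilon> s t - (LINT \<omega>|M \<epsilon>. g (?X \<omega>) * f (?X' \<omega>))"
      using prod(1)[OF f(1) f(1) f(2) f(2)] prod(1)[OF g(1) f(1) g(2) f(2)]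
      by (simp add: left_diff_distrib correlation_def)
    moreover have "(LINT \<omega>|M \<epsilon>. g (?X \<omega>) * (f (?X' \<omega>) - g (?X' \<omega>))) = (LINT \<omega>|M \<epsilon>. g (?X \<omega>) * f (?X' \<omega>)) - correlation g \<epsilon> s t"
      using prod(1)[OF g(1) f(1) g(2) f(2)] prod(1)[OF g(1) g(1) g(2) g(2)]
      by (simp add: right_diff_distrib correlation_def)
    ultimately show ?thesis by simp
  qed
  moreover have "\<bar>LINT \<omega>|M \<epsilon>. (f (?X \<omega>) - g (?X \<omega>)) * f (?X' \<omega>)\<bar> \<le> (1 / \<delta> * ?q + ?F / (1 / \<delta>)) / 2"
    using prod(2)[OF d(1) f(1) d(2) f(2), of "1 / \<delta>"] \<delta>(1) by (simp only: zero_less_divide_1_iff)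
  moreover have "\<bar>LINT \<omega>|M \<epsilon>. g (?X \<omega>) * (f (?X' \<omega>) - g (?X' \<omega>))\<bar> \<le> (\<delta> * ?G + ?q / \<delta>) / 2"
    using prod(2)[OF g(1) d(1) g(2) d(2), of \<delta>] \<delta>(1) by (simp only:)
  moreover have "?q / \<delta> \<le> \<delta>" using close \<delta> by (simp add: divide_le_eq power2_eq_square)
  moreover have "\<delta> * ?G \<le> \<delta> * (2 * ?F + 2)"
  proof (intro mult_left_mono)
    have "(LINT x|\<pi>. (f x + (- 1) * (f x - g x))\<^sup>2) \<le> 2 * ?F + 2 * (LINT x|\<pi>. ((- 1) * (f x - g x))\<^sup>2)"
      using fm f d square_integrable_diff(1)[OF prob_gibbs sets_gibbs fm(2,1) g(2) f(2)] by (intro integral_square_sum_le[OF prob_gibbs sets_gibbs]) (auto simp: power_mult_distrib)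
    moreover have "?q \<le> 1" using close \<delta> power_le_one[of \<delta> 2] by simp
    ultimately show "?G \<le> 2 * ?F + 2" by (simp add: power2_commute)
  qed (use \<delta> in simp)
  moreover have "0 \<le> \<delta> * ?F" using \<delta> by (simp add: integral_nonneg_AE)
  moreover have "\<bar>p + q\<bar> \<le> \<delta> * (2 + 2 * F)"
    if "\<bar>p\<bar> \<le> (1 / \<delta> * Q + F / (1 / \<delta>)) / 2" "\<bar>q\<bar> \<le> (\<delta> * G + Q / \<delta>) / 2" "Q / \<delta> \<le> \<delta>"
      "\<delta> * G \<le> \<delta> * (2 * F + 2)" "0 \<le> \<delta> * F" for p q F G Q :: real
  proof -
    have "2 * \<bar>p\<bar> \<le> Q / \<delta> + \<delta> * F" "2 * \<bar>q\<bar> \<le> \<delta> * G + Q / \<delta>"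
      using that(1,2) by (simp_all add: mult.commute)
    moreover have "\<delta> * (2 * F + 2) = 2 * (\<delta> * F) + 2 * \<delta>" "\<delta> * (2 + 2 * F) = 2 * \<delta> + 2 * (\<delta> * F)"
      by (simp_all add: algebra_simps)
    ultimately have "\<bar>p\<bar> + \<bar>q\<bar> \<le> \<delta> * (2 + 2 * F)" using that(3-5) by linarith
    then show ?thesis using abs_triangle_ineq[of p q] by (rule order_trans[rotated])
  qed
  ultimately show ?thesis by simp
qed

text \<open>The approximants have L2 error below 2^(-j), so their correlations converge uniformly in
  the lag. Continuity, positive definiteness and the decay inequality, whose constant is the value
  at 0, all survive this limit.\<close>

lemma langevin_covariance:
  assumes f: "f \<in> borel_measurable borel" "integrable \<pi> (\<lambda>x. (f x)\<^sup>2)" and mean: "(LINT x|\<pi>. f x) = 0"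
  shows "\<exists>C. psd_function C \<and> continuous_on {0..} C \<and> (\<forall>t\<ge>0. C t \<le> C 0 * exp (- (K / 2) * t)) \<and>
    (\<forall>\<epsilon>>0. \<forall>s\<ge>0. \<forall>t\<ge>0. (LINT \<omega>|M \<epsilon>. f (Y \<epsilon> (\<epsilon> * s) \<omega>) * f (Y \<epsilon> (\<epsilon> * (s + t)) \<omega>)) = C t)"
proof -
  have "\<exists>g. lipschitz_bounded g \<and> (LINT x|\<pi>. g x) = 0 \<and> (LINT x|\<pi>. (f x - g x)\<^sup>2) < ((1 / 2) ^ j)\<^sup>2" for j :: nat
    by (rule centered_lipschitz_approximation[OF f mean]) simp
  then obtain g where g: "\<And>j. lipschitz_bounded (g j)" "\<And>j. (LINT x|\<pi>. g j x) = 0"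
    "\<And>j::nat. (LINT x|\<pi>. (f x - g j x)\<^sup>2) < ((1 / 2) ^ j)\<^sup>2" by metis
  define F where "F = 2 + 2 * (LINT x|\<pi>. (f x)\<^sup>2)"
  define C where "C = correlation f 1 0"
  have diff: "\<bar>correlation f \<epsilon> s t - correlation (g j) 1 0 t\<bar> \<le> (1 / 2) ^ j * F"
    if "0 < \<epsilon>" "0 \<le> s" "0 \<le> t" for \<epsilon> s t j
  proof -
    have "\<bar>correlation f \<epsilon> s t - correlation (g j) \<epsilon> s t\<bar> \<le> (1 / 2) ^ j * F"
      unfolding F_def using that
      by (intro correlation_difference f less_imp_le[OF g(3)] lipschitz_bounded_measurable(2)[OF prob_gibbs sets_gibbs g(1)]
          lipschitz_bounded_square_integrable[OF prob_gibbs sets_gibbs g(1)]) (auto simp: power_le_one)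
    then show ?thesis using correlation_eq[OF g(1) that] by simp
  qed
  have err: "(\<lambda>j. (1 / 2) ^ j * F) \<longlonglongrightarrow> 0"
    using tendsto_mult[OF LIMSEQ_power_zero[of "1 / 2 :: real"] tendsto_const, of F] by simp
  have lim: "(\<lambda>j. correlation (g j) 1 0 t) \<longlonglongrightarrow> correlation f \<epsilon> s t" if "0 < \<epsilon>" "0 \<le> s" "0 \<le> t" for \<epsilon> s t
  proof -
    have "(\<lambda>j. correlation f \<epsilon> s t - correlation (g j) 1 0 t) \<longlonglongrightarrow> 0"
      using diff[OF that] by (intro Lim_null_comparison[OF _ err]) auto
    from tendsto_diff[OF tendsto_const this, of "correlation f \<epsilon> s t"] show ?thesis by simp
  qed
  have limC: "(\<lambda>j. correlation (g j) 1 0 t) \<longlonglongrightarrow> C t" if "0 \<le> t" for t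
    unfolding C_def using that by (intro lim) auto
  have "psd_function C" by (rule psd_function_limit[OF correlation_psd[OF g(1)] limC])
  moreover have "continuous_on {0..} C"
  proof (rule uniform_limit_theorem)
    show "\<forall>\<^sub>F j in sequentially. continuous_on {0..} (correlation (g j) 1 0)"
      using correlation_continuous[OF g(1)] by simp
    show "uniform_limit {0..} (\<lambda>j. correlation (g j) 1 0) C sequentially"
    proof (rule uniform_limitI)
      fix e :: real assume "0 < e"
      then have "\<forall>\<^sub>F j in sequentially. (1 / 2) ^ j * F < e" using order_tendstoD(2)[OF err] by simp
      then show "\<forall>\<^sub>F j in sequentially. \<forall>t\<in>{0..}. dist (correlation (g j) 1 0 t) (C t) < e"
      proof eventually_elim
        case (elim j)
        have "dist (correlation (g j) 1 0 t) (C t) < e" if "0 \<le> t" for t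
          using diff[of 1 0 t j] that elim by (simp add: dist_real_def C_def abs_minus_commute)
        then show ?case by simp
      qed
    qed
  qed simp
  moreover have "C t \<le> C 0 * exp (- (K / 2) * t)" if "0 \<le> t" for t
    by (rule LIMSEQ_le[OF limC[OF that] tendsto_mult[OF limC tendsto_const]])
       (use correlation_decay[OF g(1) g(2) that] in auto)
  moreover have "correlation f \<epsilon> s t = C t" if "0 < \<epsilon>" "0 \<le> s" "0 \<le> t" for \<epsilon> s t
    using LIMSEQ_unique[OF lim[OF that] limC[OF that(3)]] .
  ultimately show ?thesis unfolding correlation_def by blast
qed

end

end

section \<open>Limits of the variances\<close>

lemma cesaro_mean:
  fixes a :: "nat \<Rightarrow> real"
  assumes "a \<longlonglongrightarrow> L"
  shows "(\<lambda>n. (\<Sum>m<n. a m) / real n) \<longlonglongrightarrow> L"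
proof -
  define b where "b m = a m - L" for m
  have b: "b \<longlonglongrightarrow> 0" unfolding b_def[abs_def] using LIM_zero[OF assms] .
  have "(\<lambda>n. (\<Sum>m<n. b m) / real n) \<longlonglongrightarrow> 0"
  proof (rule LIMSEQ_I)
    fix e :: real assume e: "0 < e"
    obtain n0 where n0: "\<And>m. n0 \<le> m \<Longrightarrow> \<bar>b m\<bar> < e / 2"
      using LIMSEQ_D[OF b, of "e / 2"] e by auto
    define S where "S = (\<Sum>m<n0. \<bar>b m\<bar>)"
    obtain n1 :: nat where n1: "S / (e / 2) < real n1" using reals_Archimedean2 by blast
    have "norm ((\<Sum>m<n. b m) / real n - 0) < e" if n: "n \<ge> max (Suc n0) n1" for n
    proof -
      have "\<bar>\<Sum>m<n. b m\<bar> \<le> (\<Sum>m<n. \<bar>b m\<bar>)" by (rule sum_abs)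
      also have "(\<Sum>m<n. \<bar>b m\<bar>) = S + (\<Sum>m\<in>{n0..<n}. \<bar>b m\<bar>)"
        using n sum.atLeastLessThan_concat[of 0 n0 n "\<lambda>m. \<bar>b m\<bar>"] by (simp add: S_def atLeast0LessThan)
      also have "(\<Sum>m\<in>{n0..<n}. \<bar>b m\<bar>) \<le> (\<Sum>m\<in>{n0..<n}. e / 2)"
        using n0 by (intro sum_mono less_imp_le) auto
      also have "\<dots> \<le> real n * (e / 2)" using e by simp
      also have "S < real n * (e / 2)"
      proof -
        have "S < real n1 * (e / 2)" using n1 e by (simp add: divide_less_eq)
        also have "\<dots> \<le> real n * (e / 2)" using n e by (intro mult_right_mono) auto
        finally show ?thesis .
      qed
      finally have "\<bar>\<Sum>m<n. b m\<bar> < real n * e" by (simp add: mult.commute)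
      then show ?thesis using n by (simp add: divide_less_eq mult.commute)
    qed
    then show "\<exists>no. \<forall>n\<ge>no. norm ((\<Sum>m<n. b m) / real n - 0) < e" by blast
  qed
  moreover have "\<forall>\<^sub>F n in sequentially. (\<Sum>m<n. b m) / real n + L = (\<Sum>m<n. a m) / real n"
    using eventually_gt_at_top[of 0]
    by eventually_elim (simp add: b_def sum_subtractf field_simps)
  ultimately show ?thesis
    using tendsto_add[of _ 0 sequentially "\<lambda>_. L" L] by (auto intro: Lim_transform_eventually)
qed

text \<open>Passing from n to n + 1 adds a row and a column, which contribute each positive distance
  twice and distance 0 once. The double sum thereby becomes a sum of partial sums, and division by n
  makes it a Cesaro mean.\<close>

lemma sum_distance_eq:
  fixes \<phi> :: "nat \<Rightarrow> real"
  shows "(\<Sum>i<n. \<Sum>j<n. \<phi> (if i \<le> j then j - i else i - j))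
    = (\<Sum>m<n. \<Sum>k\<le>m. (if k = 0 then 1 else 2) * \<phi> k)"
proof (induction n)
  case (Suc n)
  let ?d = "\<lambda>i j. \<phi> (if i \<le> j then j - i else i - j :: nat)"
  have rev: "(\<Sum>i<n. \<phi> (n - i)) = (\<Sum>k\<in>{1..n}. \<phi> k)"
    by (rule sum.reindex_bij_witness[where i = "\<lambda>k. n - k" and j = "\<lambda>i. n - i"]) auto
  have "(\<Sum>i<Suc n. \<Sum>j<Suc n. ?d i j) = (\<Sum>i<n. \<Sum>j<n. ?d i j) + (\<Sum>i<n. ?d i n) + (\<Sum>j<n. ?d n j) + \<phi> 0"
    by (simp add: sum.distrib)
  also have "(\<Sum>i<n. ?d i n) = (\<Sum>k\<in>{1..n}. \<phi> k)" using rev by simp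
  also have "(\<Sum>j<n. ?d n j) = (\<Sum>k\<in>{1..n}. \<phi> k)" using rev by (simp add: not_le)
  also have "(\<Sum>i<n. \<Sum>j<n. ?d i j) + (\<Sum>k\<in>{1..n}. \<phi> k) + (\<Sum>k\<in>{1..n}. \<phi> k) + \<phi> 0
     = (\<Sum>i<n. \<Sum>j<n. ?d i j) + (\<Sum>k\<le>n. (if k = 0 then 1 else 2) * \<phi> k)"
  proof -
    have "(\<Sum>k\<le>n. (if k = 0 then 1 else 2) * \<phi> k) = \<phi> 0 + (\<Sum>k\<in>{1..n}. 2 * \<phi> k)"
    proof -
      have "{..n} = insert 0 {1..n}" by auto
      then show ?thesis by (simp add: sum.insert)
    qed
    then show ?thesis by (simp add: sum_distrib_left[symmetric])
  qed
  finally show ?case using Suc by simp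
qed simp

text \<open>The function is u coth (u / 2). With e = exp (-u), the numerator of its derivative is 2
  e (sinh u - u), and the derivative of exp u - exp (-u) - 2 u is a square.\<close>

lemma coth_type_mono:
  fixes x y :: real
  assumes "0 < x" "x \<le> y"
  shows "x * ((1 + exp (- x)) / (1 - exp (- x))) \<le> y * ((1 + exp (- y)) / (1 - exp (- y)))"
proof (rule DERIV_nonneg_imp_nondecreasing[where f = "\<lambda>x. x * ((1 + exp (- x)) / (1 - exp (- x)))", OF assms(2)])
  fix u assume "x \<le> u" "u \<le> y"
  with assms have u: "0 < u" by simp
  define e where "e = exp (- u)"
  have e: "0 < e" "e < 1" using u by (auto simp: e_def)
  have "((\<lambda>u. u * ((1 + exp (- u)) / (1 - exp (- u)))) has_real_derivative
      (1 - e\<^sup>2 - 2 * u * e) / (1 - e)\<^sup>2) (at u)"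
    unfolding e_def using u
    by (auto intro!: derivative_eq_intros simp: divide_simps) (simp add: power2_eq_square algebra_simps)
  moreover have "0 \<le> (1 - e\<^sup>2 - 2 * u * e) / (1 - e)\<^sup>2"
  proof -
    have "(\<lambda>u. exp u - exp (- u) - 2 * u) 0 \<le> (\<lambda>u. exp u - exp (- u) - 2 * u) u"
    proof (rule DERIV_nonneg_imp_nondecreasing[where f = "\<lambda>u. exp u - exp (- u) - 2 * u"])
      fix v :: real
      have "((\<lambda>u. exp u - exp (- u) - 2 * u) has_real_derivative (exp v + exp (- v) - 2)) (at v)"
        by (auto intro!: derivative_eq_intros)
      moreover have "0 \<le> exp v + exp (- v) - 2"
      proof -
        have "0 \<le> (exp (v / 2) - exp (- v / 2))\<^sup>2" by simp
        also have "\<dots> = exp v + exp (- v) - 2"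
          by (simp add: power2_diff exp_double[symmetric] exp_add[symmetric])
        finally show ?thesis .
      qed
      ultimately show "\<exists>z. ((\<lambda>u. exp u - exp (- u) - 2 * u) has_real_derivative z) (at v) \<and> 0 \<le> z" by blast
    qed (use u in simp)
    then have "0 \<le> exp u - e - 2 * u" by (simp add: e_def)
    then have "0 \<le> (exp u - e - 2 * u) * e" using e by simp
    also have "\<dots> = 1 - e\<^sup>2 - 2 * u * e"
      by (simp add: algebra_simps e_def power2_eq_square exp_minus)
    finally show ?thesis by simp
  qed
  ultimately show "\<exists>z. ((\<lambda>u. u * ((1 + exp (- u)) / (1 - exp (- u)))) has_real_derivative z) (at u) \<and> 0 \<le> z" by blast
qed

text \<open>The value 2 is the limit of u coth (u / 2) at 0. This inequality will compare continuous
  observation with any sampling.\<close>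

lemma coth_type_lower:
  fixes x :: real
  assumes "0 < x"
  shows "2 \<le> x * ((1 + exp (- x)) / (1 - exp (- x)))"
proof -
  have "(\<lambda>u. u * (1 + exp (- u)) - 2 * (1 - exp (- u))) 0 \<le> (\<lambda>u. u * (1 + exp (- u)) - 2 * (1 - exp (- u))) x"
  proof (rule DERIV_nonneg_imp_nondecreasing[where f = "\<lambda>u. u * (1 + exp (- u)) - 2 * (1 - exp (- u))"])
    fix u :: real assume u: "0 \<le> u"
    have "((\<lambda>u. u * (1 + exp (- u)) - 2 * (1 - exp (- u))) has_real_derivative (1 - (1 + u) * exp (- u))) (at u)"
      by (auto intro!: derivative_eq_intros simp: algebra_simps)
    moreover have "0 \<le> 1 - (1 + u) * exp (- u)"
      using mult_right_mono[OF exp_ge_add_one_self[of u], of "exp (- u)"] by (simp add: exp_minus)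
    ultimately show "\<exists>z. ((\<lambda>u. u * (1 + exp (- u)) - 2 * (1 - exp (- u))) has_real_derivative z) (at u) \<and> 0 \<le> z" by blast
  qed (use assms in simp)
  then show ?thesis using assms by (simp add: le_divide_eq)
qed

section \<open>Limiting variances in terms of the Laplace transform\<close>

text \<open>The representation turns limits into integrals over \<open>\<nu>\<close>; the
  exponential decay makes those limits finite, which finiteness of \<open>\<nu>\<close> alone would
  not, since mass could accumulate at 0.\<close>

locale decaying_laplace_transform =
  fixes C :: "real \<Rightarrow> real" and \<nu> :: "real measure" and \<kappa> :: real
  assumes finite_\<nu>: "finite_measure \<nu>" and sets_\<nu> [simp, measurable_cong]: "sets \<nu> = sets borel"
    and pos_\<nu>: "AE x in \<nu>. 0 < x" and rep: "\<And>t. 0 \<le> t \<Longrightarrow> C t = (LINT x|\<nu>. exp (- t * x))"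
    and decay: "\<And>t. 0 \<le> t \<Longrightarrow> C t \<le> C 0 * exp (- \<kappa> * t)" and \<kappa>: "0 < \<kappa>"
    and cont: "continuous_on {0..} C"
begin

sublocale \<nu>: finite_measure \<nu> by (rule finite_\<nu>)

lemma integrable_exp: "0 \<le> t \<Longrightarrow> integrable \<nu> (\<lambda>x. exp (- t * x))"
  using pos_\<nu> by (intro \<nu>.integrable_const_bound[of _ 1]) (auto elim!: eventually_mono)

lemma nn_integral_exp: "0 \<le> t \<Longrightarrow> (\<integral>\<^sup>+x. ennreal (exp (- t * x)) \<partial>\<nu>) = ennreal (C t)"
  using nn_integral_eq_integral[OF integrable_exp] rep by simp

lemma C_nonneg: "0 \<le> t \<Longrightarrow> 0 \<le> C t"
  using rep by (simp add: integral_nonneg_AE)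

text \<open>The sum over all integer lags of the even extension, folded onto the nonnegative
  integers.\<close>

definition sample_term :: "real \<Rightarrow> nat \<Rightarrow> real" where
  "sample_term l k = (if k = 0 then 1 else 2) * C (real k * l)"

lemma sample_term_nonneg: "0 < l \<Longrightarrow> 0 \<le> sample_term l k"
  using C_nonneg[of "real k * l"] by (simp add: sample_term_def)

lemma summable_sample_term:
  assumes l: "0 < l"
  shows "summable (sample_term l)"
proof (rule summable_comparison_test'[where g = "\<lambda>k. 2 * C 0 * exp (- \<kappa> * l) ^ k"])
  have "norm (exp (- \<kappa> * l)) < 1" using \<kappa> l by simp
  then show "summable (\<lambda>k. 2 * C 0 * exp (- \<kappa> * l) ^ k)" by (intro summable_mult summable_geometric)
  show "norm (sample_term l k) \<le> 2 * C 0 * exp (- \<kappa> * l) ^ k" for k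
  proof -
    have kl: "0 \<le> real k * l" using l by simp
    have "norm (sample_term l k) \<le> 2 * C (real k * l)" using C_nonneg[OF kl] by (cases "k = 0") (simp_all add: sample_term_def)
    also have "\<dots> \<le> 2 * (C 0 * exp (- \<kappa> * (real k * l)))" using decay[OF kl] by simp
    also have "exp (- \<kappa> * (real k * l)) = exp (- \<kappa> * l) ^ k" by (simp add: exp_of_nat_mult[symmetric] mult_ac)
    finally show ?thesis by simp
  qed
qed

text \<open>With q = exp (- l x), the series with weight 1 at 0 and 2 elsewhere sums to (1 + q) / (1
  - q); all terms are nonnegative, so sum and integral may be exchanged.\<close>

lemma sampled_variance_repr:
  assumes l: "0 < l"
  shows "ennreal (\<Sum>k. sample_term l k) = (\<integral>\<^sup>+x. ennreal (1 + exp (- l * x)) / ennreal (1 - exp (- l * x)) \<partial>\<nu>)"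
proof -
  have "(\<integral>\<^sup>+x. ennreal (1 + exp (- l * x)) / ennreal (1 - exp (- l * x)) \<partial>\<nu>)
      = (\<integral>\<^sup>+x. (\<Sum>k. ennreal ((if k = 0 then 1 else 2) * exp (- (real k * l) * x))) \<partial>\<nu>)"
  proof (rule nn_integral_cong_AE, use pos_\<nu> in eventually_elim)
    case (elim x)
    define q where "q = exp (- l * x)"
    have q: "0 < q" "q < 1" using elim l by (auto simp: q_def)
    have geo: "(\<lambda>k. q ^ k) sums (1 / (1 - q))" using q by (intro geometric_sums) simp
    have "(\<lambda>k. 2 * q ^ k - (if k = 0 then 1 else 0)) sums (2 * (1 / (1 - q)) - 1)"
      by (intro sums_diff sums_mult geo sums_single)
    moreover have "2 * (1 / (1 - q)) - 1 = (1 + q) / (1 - q)" using q by (simp add: field_simps)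
    moreover have "2 * q ^ k - (if k = 0 then 1 else 0) = (if k = 0 then 1 else 2) * exp (- (real k * l) * x)" for k
      by (cases "k = 0") (simp_all add: q_def exp_of_nat_mult[symmetric] mult_ac)
    ultimately have s: "(\<lambda>k. (if k = 0 then 1 else 2) * exp (- (real k * l) * x)) sums ((1 + q) / (1 - q))" by simp
    have "(\<Sum>k. ennreal ((if k = 0 then 1 else 2) * exp (- (real k * l) * x))) = ennreal ((1 + q) / (1 - q))"
      using sums_unique[OF s] sums_summable[OF s] by (subst suminf_ennreal2) auto
    also have "\<dots> = ennreal (1 + q) / ennreal (1 - q)" using q by (simp add: divide_ennreal del: ennreal_plus)
    finally show ?case by (simp add: q_def del: ennreal_plus)
  qed
  also have "\<dots> = (\<Sum>k. \<integral>\<^sup>+x. ennreal ((if k = 0 then 1 else 2) * exp (- (real k * l) * x)) \<partial>\<nu>)"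
    by (rule nn_integral_suminf) measurable
  also have "\<dots> = (\<Sum>k. ennreal (sample_term l k))"
  proof (rule suminf_cong)
    fix k :: nat
    have kl: "0 \<le> real k * l" using l by simp
    have "(\<integral>\<^sup>+x. ennreal ((if k = 0 then 1 else 2) * exp (- (real k * l) * x)) \<partial>\<nu>)
       = (\<integral>\<^sup>+x. ennreal (if k = 0 then 1 else 2) * ennreal (exp (- (real k * l) * x)) \<partial>\<nu>)"
      by (simp add: ennreal_mult)
    also have "\<dots> = ennreal (if k = 0 then 1 else 2) * ennreal (C (real k * l))"
      using nn_integral_exp[OF kl] by (subst nn_integral_cmult) auto
    also have "\<dots> = ennreal (sample_term l k)"
      using C_nonneg[OF kl] by (simp add: sample_term_def ennreal_mult)
    finally show "(\<integral>\<^sup>+x. ennreal ((if k = 0 then 1 else 2) * exp (- (real k * l) * x)) \<partial>\<nu>) = ennreal (sample_term l k)" .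
  qed
  also have "\<dots> = ennreal (\<Sum>k. sample_term l k)"
    using summable_sample_term[OF l] sample_term_nonneg[OF l] by (intro suminf_ennreal2)
  finally show ?thesis by simp
qed

text \<open>The expression is arranged as in \<open>scaled_variance_sampled\<close>: l, a factor l
  \<epsilon> n that tends to 1, and a Cesaro mean of the partial sums.\<close>

lemma sampled_variance_limit:
  assumes l: "0 < l"
  shows "((\<lambda>\<epsilon>. l * (l * \<epsilon> * real (nat \<lfloor>1 / (l * \<epsilon>)\<rfloor>)) *
      ((\<Sum>m<nat \<lfloor>1 / (l * \<epsilon>)\<rfloor>. \<Sum>k\<le>m. sample_term l k) / real (nat \<lfloor>1 / (l * \<epsilon>)\<rfloor>)))
    \<longlongrightarrow> l * (\<Sum>k. sample_term l k)) (at_right 0)"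
proof -
  let ?n = "\<lambda>\<epsilon>. nat \<lfloor>1 / (l * \<epsilon>)\<rfloor>"
  have pos: "\<forall>\<^sub>F \<epsilon> in at_right 0. (0::real) < \<epsilon>" by (rule eventually_at_right_less)
  have n: "filterlim ?n sequentially (at_right 0)"
    unfolding filterlim_at_top
  proof
    fix Z :: nat
    have "0 < 1 / (l * real (Suc Z))" using l by simp
    then have "\<forall>\<^sub>F \<epsilon> in at_right 0. \<epsilon> < 1 / (l * real (Suc Z))" by (rule order_tendstoD(2)[OF tendsto_ident_at])
    with pos show "\<forall>\<^sub>F \<epsilon> in at_right 0. Z \<le> ?n \<epsilon>"
    proof eventually_elim
      case (elim \<epsilon>)
      have le: "0 < l * \<epsilon>" using elim l by simp
      have "real (Suc Z) \<le> 1 / (l * \<epsilon>)" using elim l le by (simp add: field_simps del: of_nat_Suc)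
      then have "real Z \<le> 1 / (l * \<epsilon>)" by simp
      then show "Z \<le> ?n \<epsilon>" by (rule le_nat_floor)
    qed
  qed
  have "(\<lambda>m. \<Sum>k\<le>m. sample_term l k) \<longlonglongrightarrow> (\<Sum>k. sample_term l k)"
    using summable_LIMSEQ'[OF summable_sample_term[OF l]] .
  from filterlim_compose[OF cesaro_mean[OF this] n]
  have "((\<lambda>\<epsilon>. (\<Sum>m<?n \<epsilon>. \<Sum>k\<le>m. sample_term l k) / real (?n \<epsilon>)) \<longlongrightarrow> (\<Sum>k. sample_term l k)) (at_right 0)" .
  moreover have "((\<lambda>\<epsilon>. l * \<epsilon> * real (?n \<epsilon>)) \<longlongrightarrow> 1) (at_right 0)"
  proof (rule tendsto_sandwich)
    have fl: "1 - l * \<epsilon> \<le> l * \<epsilon> * real (?n \<epsilon>)" "l * \<epsilon> * real (?n \<epsilon>) \<le> 1" if "0 < \<epsilon>" for \<epsilon>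
    proof -
      have le: "0 < l * \<epsilon>" using that l by simp
      have n_eq: "real (?n \<epsilon>) = of_int \<lfloor>1 / (l * \<epsilon>)\<rfloor>" using le by (simp add: zero_le_floor)
      have "1 / (l * \<epsilon>) - 1 \<le> real (?n \<epsilon>)" "real (?n \<epsilon>) \<le> 1 / (l * \<epsilon>)" unfolding n_eq by linarith+
      from mult_left_mono[OF this(1), of "l * \<epsilon>"] mult_left_mono[OF this(2), of "l * \<epsilon>"]
      show "1 - l * \<epsilon> \<le> l * \<epsilon> * real (?n \<epsilon>)" "l * \<epsilon> * real (?n \<epsilon>) \<le> 1"
        using le l that by (simp_all add: right_diff_distrib)
    qed
    show "\<forall>\<^sub>F \<epsilon> in at_right 0. 1 - l * \<epsilon> \<le> l * \<epsilon> * real (?n \<epsilon>)" using pos by eventually_elim (rule fl)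
    show "\<forall>\<^sub>F \<epsilon> in at_right 0. l * \<epsilon> * real (?n \<epsilon>) \<le> 1" using pos by eventually_elim (rule fl)
    have "((\<lambda>\<epsilon>. 1 - l * \<epsilon>) \<longlongrightarrow> 1 - l * 0) (at_right 0)" by (intro tendsto_intros)
    then show "((\<lambda>\<epsilon>. 1 - l * \<epsilon>) \<longlongrightarrow> 1) (at_right 0)" by simp
  qed simp
  ultimately have "((\<lambda>\<epsilon>. l * (l * \<epsilon> * real (?n \<epsilon>)) * ((\<Sum>m<?n \<epsilon>. \<Sum>k\<le>m. sample_term l k) / real (?n \<epsilon>)))
     \<longlongrightarrow> l * 1 * (\<Sum>k. sample_term l k)) (at_right 0)"
    by (intro tendsto_mult tendsto_const)
  then show ?thesis by simp
qed

end

lemma nn_integral_lborel_abs: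
  fixes g :: "real \<Rightarrow> ennreal"
  assumes [measurable]: "g \<in> borel_measurable borel"
  shows "(\<integral>\<^sup>+u. g \<bar>u\<bar> \<partial>lborel) = 2 * (\<integral>\<^sup>+u. g u * indicator {0..} u \<partial>lborel)"
proof -
  have "(\<integral>\<^sup>+u. g \<bar>u\<bar> \<partial>lborel) = (\<integral>\<^sup>+u. g u * indicator {0..} u + g (- u) * indicator {0..} (- u) \<partial>lborel)"
  proof (rule nn_integral_cong_AE)
    have "AE u in lborel. u \<noteq> (0::real)" by (rule AE_lborel_singleton)
    then show "AE u in lborel. g \<bar>u\<bar> = g u * indicator {0..} u + g (- u) * indicator {0..} (- u)"
      by eventually_elim (auto simp: indicator_def abs_if)
  qed
  also have "\<dots> = (\<integral>\<^sup>+u. g u * indicator {0..} u \<partial>lborel) + (\<integral>\<^sup>+u. g (- u) * indicator {0..} (- u) \<partial>lborel)"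
    by (rule nn_integral_add) measurable
  also have "(\<integral>\<^sup>+u. g (- u) * indicator {0..} (- u) \<partial>lborel) = (\<integral>\<^sup>+u. g u * indicator {0..} u \<partial>lborel)"
    using nn_integral_real_affine[of "\<lambda>u. g u * indicator {0..} u" "-1" 0] by simp
  finally show ?thesis by (simp add: mult_2)
qed

lemma nn_integral_exp_abs:
  assumes x: "0 < x"
  shows "(\<integral>\<^sup>+u. ennreal (exp (- \<bar>u\<bar> * x)) \<partial>lborel) = 2 * inverse (ennreal x)"
proof -
  have "(\<integral>\<^sup>+u. ennreal (exp (- u * x)) * indicator {0..} u \<partial>lborel) = ennreal (0 - (- exp (- 0 * x) / x))"
  proof (rule nn_integral_FTC_atLeast)
    show "((\<lambda>u. - exp (- u * x) / x) has_real_derivative exp (- u * x)) (at u)" for u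
      using x by (auto intro!: derivative_eq_intros)
    have "((\<lambda>u. - exp (- (u * x)) / x) \<longlongrightarrow> - 0 / x) at_top"
      using x by (intro tendsto_intros filterlim_compose[OF exp_at_bot] filterlim_compose[OF filterlim_uminus_at_bot_at_top]
          filterlim_at_top_mult_tendsto_pos[OF tendsto_const _ filterlim_ident, unfolded mult.commute[of _ x]]) auto
    then show "((\<lambda>u. - exp (- u * x) / x) \<longlongrightarrow> 0) at_top" by simp
  qed auto
  then have "(\<integral>\<^sup>+u. ennreal (exp (- u * x)) * indicator {0..} u \<partial>lborel) = inverse (ennreal x)"
    using x by (simp add: inverse_ennreal inverse_eq_divide)
  then show ?thesis using nn_integral_lborel_abs[of "\<lambda>u. ennreal (exp (- u * x))"] by simp
qed

context decaying_laplace_transform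
begin

lemma continuous_C_abs: "continuous_on UNIV (\<lambda>u. C \<bar>u\<bar>)"
  by (intro continuous_on_compose2[OF cont]) (auto intro!: continuous_intros)

lemma measurable_C_abs [measurable]: "(\<lambda>u. C \<bar>u\<bar>) \<in> borel_measurable borel"
  by (intro borel_measurable_continuous_onI continuous_C_abs)

lemma nn_integral_C_abs: "(\<integral>\<^sup>+u. ennreal (C \<bar>u\<bar>) \<partial>lborel) = 2 * (\<integral>\<^sup>+x. inverse (ennreal x) \<partial>\<nu>)"
proof -
  interpret pair_sigma_finite \<nu> "lborel :: real measure" ..
  have "(\<integral>\<^sup>+u. ennreal (C \<bar>u\<bar>) \<partial>lborel) = (\<integral>\<^sup>+u. \<integral>\<^sup>+x. ennreal (exp (- \<bar>u\<bar> * x)) \<partial>\<nu> \<partial>lborel)"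
    by (intro nn_integral_cong nn_integral_exp[symmetric]) simp
  also have "\<dots> = (\<integral>\<^sup>+x. \<integral>\<^sup>+u. ennreal (exp (- \<bar>u\<bar> * x)) \<partial>lborel \<partial>\<nu>)"
    by (rule Fubini') measurable
  also have "\<dots> = (\<integral>\<^sup>+x. 2 * inverse (ennreal x) \<partial>\<nu>)"
    by (rule nn_integral_cong_AE, use pos_\<nu> in eventually_elim) (rule nn_integral_exp_abs)
  also have "\<dots> = 2 * (\<integral>\<^sup>+x. inverse (ennreal x) \<partial>\<nu>)"
    by (rule nn_integral_cmult) measurable
  finally show ?thesis .
qed

lemma integrable_C_abs: "integrable lborel (\<lambda>u. C \<bar>u\<bar>)"
proof (rule integrableI_nonneg)
  have "C \<bar>u\<bar> \<le> C 0 * exp (- \<bar>u\<bar> * \<kappa>)" for u using decay[of "\<bar>u\<bar>"] by (simp add: mult.commute)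
  then have "(\<integral>\<^sup>+u. ennreal (C \<bar>u\<bar>) \<partial>lborel) \<le> (\<integral>\<^sup>+u. ennreal (C 0) * ennreal (exp (- \<bar>u\<bar> * \<kappa>)) \<partial>lborel)"
    using C_nonneg[of 0] by (intro nn_integral_mono) (simp add: ennreal_mult[symmetric] ennreal_leI)
  also have "\<dots> = ennreal (C 0) * (2 * inverse (ennreal \<kappa>))"
    unfolding nn_integral_exp_abs[OF \<kappa>, symmetric] by (rule nn_integral_cmult) measurable
  also have "\<dots> < \<infinity>" using \<kappa> by (simp add: ennreal_mult_less_top inverse_ennreal)
  finally show "(\<integral>\<^sup>+u. ennreal (C \<bar>u\<bar>) \<partial>lborel) < \<infinity>" .
qed (auto simp: C_nonneg)

text \<open>Substituting t = s + \<epsilon> u and integrating over s first leaves the length of the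
  overlap of [0, 1] with its translate by \<epsilon> u, which is the triangle.\<close>

lemma correlation_triangle:
  assumes \<epsilon>: "0 < \<epsilon>"
  shows "(\<integral>\<^sup>+s. \<integral>\<^sup>+t. ennreal (indicator {0..1} s * indicator {0..1} t * C (\<bar>t - s\<bar> / \<epsilon>)) \<partial>lborel \<partial>lborel)
    = ennreal \<epsilon> * (\<integral>\<^sup>+u. ennreal (C \<bar>u\<bar> * max 0 (1 - \<epsilon> * \<bar>u\<bar>)) \<partial>lborel)"
proof -
  have C_scaled: "(\<lambda>r. C (\<bar>r\<bar> / \<epsilon>)) \<in> borel_measurable borel"
    using measurable_compose[OF _ measurable_C_abs, of "\<lambda>r. r / \<epsilon>" borel] \<epsilon> by simp
  have inner: "(\<integral>\<^sup>+t. ennreal (indicator {0..1} s * indicator {0..1} t * C (\<bar>t - s\<bar> / \<epsilon>)) \<partial>lborel)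
      = ennreal \<epsilon> * (\<integral>\<^sup>+u. ennreal (C \<bar>u\<bar>) * (indicator {0..1} s * indicator {0..1} (s + \<epsilon> * u)) \<partial>lborel)" for s
  proof -
    have "(\<integral>\<^sup>+t. ennreal (indicator {0..1} s * indicator {0..1} t * C (\<bar>t - s\<bar> / \<epsilon>)) \<partial>lborel)
      = ennreal \<bar>\<epsilon>\<bar> * (\<integral>\<^sup>+u. ennreal (indicator {0..1} s * indicator {0..1} (s + \<epsilon> * u) * C (\<bar>s + \<epsilon> * u - s\<bar> / \<epsilon>)) \<partial>lborel)"
    proof (rule nn_integral_real_affine)
      have "(\<lambda>t. C (\<bar>t - s\<bar> / \<epsilon>)) \<in> borel_measurable borel"
        using measurable_compose[OF _ C_scaled, of "\<lambda>t. t - s" borel] by simp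
      then show "(\<lambda>t. ennreal (indicator {0..1} s * indicator {0..1} t * C (\<bar>t - s\<bar> / \<epsilon>))) \<in> borel_measurable borel"
        by measurable
    qed (use \<epsilon> in simp)
    also have "\<dots> = ennreal \<epsilon> * (\<integral>\<^sup>+u. ennreal (C \<bar>u\<bar>) * (indicator {0..1} s * indicator {0..1} (s + \<epsilon> * u)) \<partial>lborel)"
      using \<epsilon> by (intro arg_cong2[where f = "(*)"] nn_integral_cong) (auto simp: indicator_def abs_mult)
    finally show ?thesis .
  qed
  have overlap: "(\<integral>\<^sup>+s. indicator {0..1} s * indicator {0..1} (s + \<epsilon> * u) \<partial>lborel) = ennreal (max 0 (1 - \<epsilon> * \<bar>u\<bar>))" for u
  proof -
    have "(\<integral>\<^sup>+s. indicator {0..1} s * indicator {0..1} (s + \<epsilon> * u) \<partial>lborel)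
        = (\<integral>\<^sup>+s. indicator {max 0 (- (\<epsilon> * u))..min 1 (1 - \<epsilon> * u)} s \<partial>lborel)"
      by (intro nn_integral_cong) (auto simp: indicator_def)
    also have "\<dots> = emeasure lborel {max 0 (- (\<epsilon> * u))..min 1 (1 - \<epsilon> * u)}" by simp
    also have "\<dots> = ennreal (max 0 (1 - \<epsilon> * \<bar>u\<bar>))"
    proof -
      have eq: "min 1 (1 - \<epsilon> * u) - max 0 (- (\<epsilon> * u)) = 1 - \<epsilon> * \<bar>u\<bar>"
        using \<epsilon> by (cases "0 \<le> u") (auto simp: min_def max_def mult_nonneg_nonpos zero_le_mult_iff mult_le_0_iff)
      show ?thesis
        unfolding emeasure_lborel_Icc_eq using eq by (auto simp: max_def ennreal_neg)
    qed
    finally show ?thesis .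
  qed
  have "(\<integral>\<^sup>+s. \<integral>\<^sup>+t. ennreal (indicator {0..1} s * indicator {0..1} t * C (\<bar>t - s\<bar> / \<epsilon>)) \<partial>lborel \<partial>lborel)
      = ennreal \<epsilon> * (\<integral>\<^sup>+s. \<integral>\<^sup>+u. ennreal (C \<bar>u\<bar>) * (indicator {0..1} s * indicator {0..1} (s + \<epsilon> * u)) \<partial>lborel \<partial>lborel)"
    unfolding inner by (rule nn_integral_cmult) measurable
  also have "(\<integral>\<^sup>+s. \<integral>\<^sup>+u. ennreal (C \<bar>u\<bar>) * (indicator {0..1} s * indicator {0..1} (s + \<epsilon> * u)) \<partial>lborel \<partial>lborel)
      = (\<integral>\<^sup>+u. \<integral>\<^sup>+s. ennreal (C \<bar>u\<bar>) * (indicator {0..1} s * indicator {0..1} (s + \<epsilon> * u)) \<partial>lborel \<partial>lborel)"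
    by (rule lborel_pair.Fubini') measurable
  also have "\<dots> = (\<integral>\<^sup>+u. ennreal (C \<bar>u\<bar>) * ennreal (max 0 (1 - \<epsilon> * \<bar>u\<bar>)) \<partial>lborel)"
    by (subst nn_integral_cmult) (auto simp: overlap)
  also have "\<dots> = (\<integral>\<^sup>+u. ennreal (C \<bar>u\<bar> * max 0 (1 - \<epsilon> * \<bar>u\<bar>)) \<partial>lborel)"
    by (simp add: ennreal_mult C_nonneg)
  finally show ?thesis .
qed

text \<open>The variance of the continuous average at a positive \<open>\<epsilon>\<close>: the
  double integral above, divided by \<open>\<epsilon>\<close>.\<close>

definition triangle_mean :: "real \<Rightarrow> real" where
  "triangle_mean \<epsilon> = (LINT u|lborel. C \<bar>u\<bar> * max 0 (1 - \<epsilon> * \<bar>u\<bar>))"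

lemma triangle_le: "0 \<le> \<epsilon> \<Longrightarrow> C \<bar>u\<bar> * max 0 (1 - \<epsilon> * \<bar>u\<bar>) \<le> C \<bar>u\<bar>"
  using C_nonneg[of "\<bar>u\<bar>"] by (intro mult_left_le) (auto simp: mult_left_le)

lemma triangle_mean_eq:
  assumes "0 \<le> \<epsilon>"
  shows "ennreal (triangle_mean \<epsilon>) = (\<integral>\<^sup>+u. ennreal (C \<bar>u\<bar> * max 0 (1 - \<epsilon> * \<bar>u\<bar>)) \<partial>lborel)"
  unfolding triangle_mean_def
proof (rule nn_integral_eq_integral[symmetric])
  show "integrable lborel (\<lambda>u. C \<bar>u\<bar> * max 0 (1 - \<epsilon> * \<bar>u\<bar>))"
    using triangle_le[OF assms] C_nonneg
    by (intro Bochner_Integration.integrable_bound[OF integrable_C_abs]) (auto simp: abs_of_nonneg)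
qed (simp add: C_nonneg)

lemma triangle_mean_limit: "(triangle_mean \<longlongrightarrow> (LINT u|lborel. C \<bar>u\<bar>)) (at_right 0)"
  unfolding tendsto_at_iff_sequentially
proof (intro allI impI)
  fix e :: "nat \<Rightarrow> real" assume e: "\<forall>i. e i \<in> {0<..} - {0}" "e \<longlonglongrightarrow> 0"
  show "(triangle_mean \<circ> e) \<longlonglongrightarrow> (LINT u|lborel. C \<bar>u\<bar>)"
    unfolding o_def triangle_mean_def
  proof (rule integral_dominated_convergence[OF _ _ integrable_C_abs])
    show "AE u in lborel. (\<lambda>i. C \<bar>u\<bar> * max 0 (1 - e i * \<bar>u\<bar>)) \<longlonglongrightarrow> C \<bar>u\<bar>"
    proof (rule AE_I2)
      fix u :: real
      have "(\<lambda>i. C \<bar>u\<bar> * max 0 (1 - e i * \<bar>u\<bar>)) \<longlonglongrightarrow> C \<bar>u\<bar> * max 0 (1 - 0 * \<bar>u\<bar>)"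
        by (intro tendsto_intros e)
      then show "(\<lambda>i. C \<bar>u\<bar> * max 0 (1 - e i * \<bar>u\<bar>)) \<longlonglongrightarrow> C \<bar>u\<bar>" by simp
    qed
    show "AE u in lborel. norm (C \<bar>u\<bar> * max 0 (1 - e i * \<bar>u\<bar>)) \<le> C \<bar>u\<bar>" for i
      using triangle_le[of "e i"] e(1) C_nonneg by (intro AE_I2) (auto simp: less_imp_le)
  qed measurable
qed

lemma continuous_variance_repr: "ennreal (LINT u|lborel. C \<bar>u\<bar>) = 2 * (\<integral>\<^sup>+x. inverse (ennreal x) \<partial>\<nu>)"
  using nn_integral_eq_integral[OF integrable_C_abs] nn_integral_C_abs C_nonneg by simp

lemma sampled_variance_integral:
  assumes l: "0 < l"
  shows "ennreal l * (\<integral>\<^sup>+x. ennreal (1 + exp (- l * x)) / ennreal (1 - exp (- l * x)) \<partial>\<nu>)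
    = (\<integral>\<^sup>+x. ennreal (l * ((1 + exp (- (l * x))) / (1 - exp (- (l * x))))) \<partial>\<nu>)"
proof -
  have "ennreal l * (\<integral>\<^sup>+x. ennreal (1 + exp (- l * x)) / ennreal (1 - exp (- l * x)) \<partial>\<nu>)
     = (\<integral>\<^sup>+x. ennreal l * (ennreal (1 + exp (- l * x)) / ennreal (1 - exp (- l * x))) \<partial>\<nu>)"
    by (rule nn_integral_cmult[symmetric]) measurable
  also have "\<dots> = (\<integral>\<^sup>+x. ennreal (l * ((1 + exp (- (l * x))) / (1 - exp (- (l * x))))) \<partial>\<nu>)"
  proof (rule nn_integral_cong_AE, use pos_\<nu> in eventually_elim)
    case (elim x)
    then have "exp (- (l * x)) < 1" using l by simp
    then have q: "0 \<le> (1 + exp (- (l * x))) / (1 - exp (- (l * x)))" "0 < 1 - exp (- (l * x))" by simp_all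
    show ?case unfolding ennreal_mult[OF less_imp_le[OF l] q(1)] using q(2) by (simp add: divide_ennreal del: ennreal_plus)
  qed
  finally show ?thesis .
qed

text \<open>The comparison is pointwise in x > 0: multiplied by x, the integrand is u coth (u / 2)
  at u = l x.\<close>

lemma sampled_variance_mono:
  assumes "0 < l" "l \<le> l'"
  shows "ennreal l * (\<integral>\<^sup>+x. ennreal (1 + exp (- l * x)) / ennreal (1 - exp (- l * x)) \<partial>\<nu>)
    \<le> ennreal l' * (\<integral>\<^sup>+x. ennreal (1 + exp (- l' * x)) / ennreal (1 - exp (- l' * x)) \<partial>\<nu>)"
proof -
  have l': "0 < l'" using assms by simp
  show ?thesis
    unfolding sampled_variance_integral[OF assms(1)] sampled_variance_integral[OF l']
  proof (rule nn_integral_mono_AE, use pos_\<nu> in eventually_elim)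
    case (elim x)
    have "l * x * ((1 + exp (- (l * x))) / (1 - exp (- (l * x)))) \<le> l' * x * ((1 + exp (- (l' * x))) / (1 - exp (- (l' * x))))"
      using assms elim by (intro coth_type_mono) auto
    then have "x * (l * ((1 + exp (- (l * x))) / (1 - exp (- (l * x))))) \<le> x * (l' * ((1 + exp (- (l' * x))) / (1 - exp (- (l' * x)))))"
      by (simp only: mult_ac)
    then show ?case using elim by (intro ennreal_leI) (rule mult_left_le_imp_le)
  qed
qed

lemma continuous_variance_le_sampled:
  assumes l: "0 < l"
  shows "2 * (\<integral>\<^sup>+x. inverse (ennreal x) \<partial>\<nu>)
    \<le> ennreal l * (\<integral>\<^sup>+x. ennreal (1 + exp (- l * x)) / ennreal (1 - exp (- l * x)) \<partial>\<nu>)"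
proof -
  have "2 * (\<integral>\<^sup>+x. inverse (ennreal x) \<partial>\<nu>) = (\<integral>\<^sup>+x. 2 * inverse (ennreal x) \<partial>\<nu>)"
    by (rule nn_integral_cmult[symmetric]) measurable
  also have "\<dots> \<le> (\<integral>\<^sup>+x. ennreal (l * ((1 + exp (- (l * x))) / (1 - exp (- (l * x))))) \<partial>\<nu>)"
  proof (rule nn_integral_mono_AE, use pos_\<nu> in eventually_elim)
    case (elim x)
    have "2 \<le> l * x * ((1 + exp (- (l * x))) / (1 - exp (- (l * x))))"
      using l elim by (intro coth_type_lower) auto
    then have "2 / x \<le> l * ((1 + exp (- (l * x))) / (1 - exp (- (l * x))))"
      using elim by (simp add: divide_le_eq mult_ac)
    moreover have "2 * inverse (ennreal x) = ennreal (2 / x)"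
      using elim by (simp add: inverse_ennreal divide_inverse ennreal_mult)
    ultimately show ?case by (simp add: ennreal_leI)
  qed
  finally show ?thesis unfolding sampled_variance_integral[OF l] .
qed

end

section \<open>Fubini for the continuous time average\<close>

text \<open>Time is rounded down to a grid, where only countably many random variables occur, and
  path continuity gives the limit. Clamping time at 0 permits the whole real line as time
  axis.\<close>

lemma continuous_paths_jointly_measurable:
  fixes Y :: "real \<Rightarrow> 'w \<Rightarrow> 'b::metric_space"
  assumes meas: "\<And>t. 0 \<le> t \<Longrightarrow> Y t \<in> borel_measurable M"
    and cont: "\<And>\<omega>. \<omega> \<in> space M \<Longrightarrow> continuous_on {0..} (\<lambda>t. Y t \<omega>)"
  shows "(\<lambda>p. Y (max 0 (snd p)) (fst p)) \<in> borel_measurable (M \<Otimes>\<^sub>M borel)"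
proof -
  define q where "q n t = real (nat \<lfloor>real (Suc n) * max 0 t\<rfloor>) / real (Suc n)" for n and t :: real
  have q_meas: "(\<lambda>p. Y (q n (snd p)) (fst p)) \<in> borel_measurable (M \<Otimes>\<^sub>M borel)" for n
  proof -
    have "(\<lambda>p. (\<lambda>k p. Y (real k / real (Suc n)) (fst p)) (nat \<lfloor>real (Suc n) * max 0 (snd p)\<rfloor>) p) \<in> borel_measurable (M \<Otimes>\<^sub>M borel)"
    proof (rule measurable_compose_countable[where f = "\<lambda>k p. Y (real k / real (Suc n)) (fst p)"])
      show "(\<lambda>p. Y (real k / real (Suc n)) (fst p)) \<in> borel_measurable (M \<Otimes>\<^sub>M borel)" for k
        by (rule measurable_compose[OF measurable_fst meas]) simp
    qed measurable
    then show ?thesis by (simp add: q_def)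
  qed
  show ?thesis
  proof (rule borel_measurable_LIMSEQ_metric[where f = "\<lambda>n p. Y (q n (snd p)) (fst p)", OF q_meas])
    fix p :: "'w \<times> real" assume "p \<in> space (M \<Otimes>\<^sub>M borel)"
    then have \<omega>: "fst p \<in> space M" by (auto simp: space_pair_measure)
    have "(\<lambda>n. q n (snd p)) \<longlonglongrightarrow> max 0 (snd p)"
    proof (rule tendsto_sandwich[OF _ _ _ tendsto_const])
      let ?t = "max 0 (snd p)"
      have fl: "?t - inverse (real (Suc n)) \<le> q n (snd p)" "q n (snd p) \<le> ?t" for n
      proof -
        have nat: "real (nat \<lfloor>real (Suc n) * ?t\<rfloor>) = of_int \<lfloor>real (Suc n) * ?t\<rfloor>" by (simp add: zero_le_floor)
        have le: "real (Suc n) * ?t - 1 \<le> real (nat \<lfloor>real (Suc n) * ?t\<rfloor>)" "real (nat \<lfloor>real (Suc n) * ?t\<rfloor>) \<le> real (Suc n) * ?t"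
          unfolding nat by linarith+
        have "(real (Suc n) * ?t - 1) / real (Suc n) \<le> q n (snd p)"
          unfolding q_def by (rule divide_right_mono[OF le(1)]) simp
        then show "?t - inverse (real (Suc n)) \<le> q n (snd p)" by (simp add: diff_divide_distrib inverse_eq_divide del: of_nat_Suc)
        have "q n (snd p) \<le> (real (Suc n) * ?t) / real (Suc n)"
          unfolding q_def by (rule divide_right_mono[OF le(2)]) simp
        then show "q n (snd p) \<le> ?t" by (simp del: of_nat_Suc)
      qed
      show "\<forall>\<^sub>F n in sequentially. ?t - inverse (real (Suc n)) \<le> q n (snd p)" using fl(1) by simp
      show "\<forall>\<^sub>F n in sequentially. q n (snd p) \<le> ?t" using fl(2) by simp
      show "(\<lambda>n. ?t - inverse (real (Suc n))) \<longlonglongrightarrow> ?t"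
        using tendsto_diff[OF tendsto_const LIMSEQ_inverse_real_of_nat, of ?t] by simp
    qed
    then show "(\<lambda>n. Y (q n (snd p)) (fst p)) \<longlonglongrightarrow> Y (max 0 (snd p)) (fst p)"
      by (intro continuous_on_tendsto_compose[OF cont[OF \<omega>]]) (auto simp: q_def)
  qed
qed

context
  fixes M :: "'w measure" and N :: "'b::metric_space measure" and Y :: "real \<Rightarrow> 'w \<Rightarrow> 'b" and f :: "'b \<Rightarrow> real"
  assumes prob: "prob_space M" and sets_N [measurable_cong]: "sets N = sets borel"
    and Y_meas: "\<And>t. 0 \<le> t \<Longrightarrow> Y t \<in> borel_measurable M"
    and Y_cont: "\<And>\<omega>. \<omega> \<in> space M \<Longrightarrow> continuous_on {0..} (\<lambda>t. Y t \<omega>)"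
    and law: "\<And>t. 0 \<le> t \<Longrightarrow> distr M borel (Y t) = N"
    and f_meas [measurable]: "f \<in> borel_measurable borel" and f_sq: "integrable N (\<lambda>x. (f x)\<^sup>2)"
begin

interpretation prob_space M by (rule prob)

interpretation time_pair: pair_sigma_finite M "lborel :: real measure" ..

interpretation time_triple: pair_sigma_finite M "lborel \<Otimes>\<^sub>M lborel :: (real \<times> real) measure"
  unfolding lborel_prod by (intro pair_sigma_finite.intro sigma_finite_measure_axioms sigma_finite_lborel)

text \<open>The indicator turns integrals over [0, 1] into integrals over the line; the clamp keeps
  the time in the range where Y is measurable.\<close>

definition windowed :: "'w \<Rightarrow> real \<Rightarrow> real" where
  "windowed \<omega> t = indicator {0..1} t * f (Y (max 0 t) \<omega>)"

lemma windowed_measurable [measurable]: "(\<lambda>p. windowed (fst p) (snd p)) \<in> borel_measurable (M \<Otimes>\<^sub>M borel)"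
  unfolding windowed_def
  by (intro borel_measurable_times measurable_compose[OF continuous_paths_jointly_measurable[OF Y_meas Y_cont] f_meas]) auto

lemma windowed_component_measurable [measurable]: "(\<lambda>\<omega>. windowed \<omega> t) \<in> borel_measurable M"
  unfolding windowed_def by (intro borel_measurable_times measurable_compose[OF Y_meas f_meas]) auto

lemma windowed_integral: "(LINT t:{0..1}|lborel. f (Y t \<omega>)) = (LINT t|lborel. windowed \<omega> t)"
  unfolding set_lebesgue_integral_def windowed_def
  by (intro Bochner_Integration.integral_cong) (auto simp: indicator_def)

lemma second_moment: "0 \<le> t \<Longrightarrow> (\<integral>\<^sup>+\<omega>. ennreal ((f (Y t \<omega>))\<^sup>2) \<partial>M) = (\<integral>\<^sup>+x. ennreal ((f x)\<^sup>2) \<partial>N)"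
  unfolding law[symmetric] by (subst nn_integral_distr[OF Y_meas]) auto

lemma windowed_second_moment: "(\<integral>\<^sup>+\<omega>. ennreal ((windowed \<omega> t)\<^sup>2) \<partial>M) = indicator {0..1} t * (\<integral>\<^sup>+x. ennreal ((f x)\<^sup>2) \<partial>N)"
  by (cases "t \<in> {0..1}") (auto simp: windowed_def second_moment)

lemma f_second_moment_finite: "(\<integral>\<^sup>+x. ennreal ((f x)\<^sup>2) \<partial>N) < \<infinity>"
  using f_sq by (simp add: integrable_iff_bounded)

lemma windowed_pair_integrable:
  "integrable (M \<Otimes>\<^sub>M (lborel \<Otimes>\<^sub>M lborel)) (\<lambda>p. windowed (fst p) (fst (snd p)) * windowed (fst p) (snd (snd p)))"
proof (rule integrableI_bounded)
  have m1 [measurable]: "(\<lambda>p. windowed (fst p) (fst (snd p))) \<in> borel_measurable (M \<Otimes>\<^sub>M (lborel \<Otimes>\<^sub>M lborel))"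
    using measurable_compose[OF _ windowed_measurable, of "\<lambda>p. (fst p, fst (snd p))" "M \<Otimes>\<^sub>M (lborel \<Otimes>\<^sub>M lborel)"] by simp
  have m2 [measurable]: "(\<lambda>p. windowed (fst p) (snd (snd p))) \<in> borel_measurable (M \<Otimes>\<^sub>M (lborel \<Otimes>\<^sub>M lborel))"
    using measurable_compose[OF _ windowed_measurable, of "\<lambda>p. (fst p, snd (snd p))" "M \<Otimes>\<^sub>M (lborel \<Otimes>\<^sub>M lborel)"] by simp
  show "(\<lambda>p. windowed (fst p) (fst (snd p)) * windowed (fst p) (snd (snd p))) \<in> borel_measurable (M \<Otimes>\<^sub>M (lborel \<Otimes>\<^sub>M lborel))"
    by measurable
  let ?i = "\<lambda>s t. indicator {0..1::real} s * indicator {0..1::real} t :: ennreal"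
  let ?F = "\<lambda>\<omega> s t. ?i s t * (ennreal ((windowed \<omega> s)\<^sup>2) + ennreal ((windowed \<omega> t)\<^sup>2))"
  let ?m = "\<integral>\<^sup>+x. ennreal ((f x)\<^sup>2) \<partial>N"
  have "(\<integral>\<^sup>+p. ennreal (norm (windowed (fst p) (fst (snd p)) * windowed (fst p) (snd (snd p)))) \<partial>(M \<Otimes>\<^sub>M (lborel \<Otimes>\<^sub>M lborel)))
      \<le> (\<integral>\<^sup>+p. ?F (fst p) (fst (snd p)) (snd (snd p)) \<partial>(M \<Otimes>\<^sub>M (lborel \<Otimes>\<^sub>M lborel)))"
  proof (intro nn_integral_mono)
    fix p :: "'w \<times> real \<times> real"
    obtain \<omega> s t where p: "p = (\<omega>, s, t)" by (cases p) auto
    have ab: "\<bar>a * b\<bar> \<le> a\<^sup>2 + b\<^sup>2" for a b :: real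
    proof -
      have "0 \<le> (\<bar>a\<bar> - \<bar>b\<bar>)\<^sup>2" by simp
      then have "2 * \<bar>a * b\<bar> \<le> a\<^sup>2 + b\<^sup>2" by (simp add: power2_diff abs_mult)
      then show ?thesis using abs_ge_zero[where a = "a * b"] by linarith
    qed
    show "ennreal (norm (windowed (fst p) (fst (snd p)) * windowed (fst p) (snd (snd p)))) \<le> ?F (fst p) (fst (snd p)) (snd (snd p))"
    proof (cases "s \<in> {0..1} \<and> t \<in> {0..1}")
      case True
      then show ?thesis using ab[of "windowed \<omega> s" "windowed \<omega> t"] by (simp add: p ennreal_plus[symmetric] ennreal_leI del: ennreal_plus)
    next
      case False
      then have "windowed \<omega> s * windowed \<omega> t = 0" by (auto simp: windowed_def)
      then show ?thesis unfolding p fst_conv snd_conv by (simp only: norm_zero ennreal_0 zero_le)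
    qed
  qed
  also have "\<dots> = (\<integral>\<^sup>+q. (\<integral>\<^sup>+\<omega>. ?F \<omega> (fst q) (snd q) \<partial>M) \<partial>(lborel \<Otimes>\<^sub>M lborel))"
    by (subst time_triple.nn_integral_snd[symmetric]) (auto simp: case_prod_beta')
  also have "\<dots> = (\<integral>\<^sup>+q. ?i (fst q) (snd q) * (?m + ?m) \<partial>(lborel \<Otimes>\<^sub>M lborel))"
  proof (intro nn_integral_cong)
    fix q :: "real \<times> real"
    have "(\<integral>\<^sup>+\<omega>. ?F \<omega> (fst q) (snd q) \<partial>M)
       = ?i (fst q) (snd q) * ((\<integral>\<^sup>+\<omega>. ennreal ((windowed \<omega> (fst q))\<^sup>2) \<partial>M) + (\<integral>\<^sup>+\<omega>. ennreal ((windowed \<omega> (snd q))\<^sup>2) \<partial>M))"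
      by (simp add: nn_integral_cmult nn_integral_add)
    also have "\<dots> = ?i (fst q) (snd q) * (?m + ?m)"
      unfolding windowed_second_moment by (auto simp: indicator_def)
    finally show "(\<integral>\<^sup>+\<omega>. ?F \<omega> (fst q) (snd q) \<partial>M) = ?i (fst q) (snd q) * (?m + ?m)" .
  qed
  also have "\<dots> = (\<integral>\<^sup>+q. indicator ({0..1::real} \<times> {0..1::real}) q * (?m + ?m) \<partial>(lborel \<Otimes>\<^sub>M lborel))"
    by (intro nn_integral_cong) (auto simp: indicator_def)
  also have "\<dots> = emeasure (lborel \<Otimes>\<^sub>M lborel) ({0..1::real} \<times> {0..1::real}) * (?m + ?m)"
    by (subst nn_integral_multc) auto
  also have "\<dots> = ?m + ?m" by (subst lborel.emeasure_pair_measure_Times) auto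
  also have "\<dots> < \<infinity>" using f_second_moment_finite by simp
  finally show "(\<integral>\<^sup>+p. ennreal (norm (windowed (fst p) (fst (snd p)) * windowed (fst p) (snd (snd p)))) \<partial>(M \<Otimes>\<^sub>M (lborel \<Otimes>\<^sub>M lborel))) < \<infinity>" .
qed

text \<open>The square of the integral is a double integral for those \<omega> where the product is
  integrable over the square, which is almost every \<omega>; then the expectation is moved
  inside.\<close>

lemma time_average_second_moment:
  "expectation (\<lambda>\<omega>. (LINT t:{0..1}|lborel. f (Y t \<omega>))\<^sup>2)
    = (LINT q|(lborel \<Otimes>\<^sub>M lborel). indicator {0..1} (fst q) * indicator {0..1} (snd q) * expectation (\<lambda>\<omega>. f (Y (fst q) \<omega>) * f (Y (snd q) \<omega>)))"
proof -
  let ?\<Psi> = "\<lambda>p. windowed (fst p) (fst (snd p)) * windowed (fst p) (snd (snd p))"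
  have "expectation (\<lambda>\<omega>. (LINT t:{0..1}|lborel. f (Y t \<omega>))\<^sup>2) = expectation (\<lambda>\<omega>. LINT q|(lborel \<Otimes>\<^sub>M lborel). ?\<Psi> (\<omega>, q))"
  proof (rule integral_cong_AE)
    have "AE \<omega> in M. integrable (lborel \<Otimes>\<^sub>M lborel) (\<lambda>q. ?\<Psi> (\<omega>, q))"
      by (rule time_triple.AE_integrable_fst'[OF windowed_pair_integrable])
    then show "AE \<omega> in M. (LINT t:{0..1}|lborel. f (Y t \<omega>))\<^sup>2 = (LINT q|(lborel \<Otimes>\<^sub>M lborel). ?\<Psi> (\<omega>, q))"
    proof eventually_elim
      case (elim \<omega>)
      then have "(LINT q|(lborel \<Otimes>\<^sub>M lborel). ?\<Psi> (\<omega>, q)) = (LINT s|lborel. LINT t|lborel. windowed \<omega> s * windowed \<omega> t)"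
        by (subst lborel_pair.integral_fst'[symmetric]) auto
      also have "\<dots> = (LINT t|lborel. windowed \<omega> t)\<^sup>2" by (simp add: power2_eq_square)
      finally show ?case by (simp add: windowed_integral)
    qed
    have "(\<lambda>\<omega>. LINT t|lborel. windowed \<omega> t) \<in> borel_measurable M"
      using lborel.borel_measurable_lebesgue_integral[of "\<lambda>\<omega> t. windowed \<omega> t" M] by (simp add: case_prod_beta')
    then show "(\<lambda>\<omega>. (LINT t:{0..1}|lborel. f (Y t \<omega>))\<^sup>2) \<in> borel_measurable M" unfolding windowed_integral by measurable
    show "(\<lambda>\<omega>. LINT q|(lborel \<Otimes>\<^sub>M lborel). ?\<Psi> (\<omega>, q)) \<in> borel_measurable M"
      using time_triple.integrable_fst'[OF windowed_pair_integrable] by (rule borel_measurable_integrable)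
  qed
  also have "\<dots> = (LINT q|(lborel \<Otimes>\<^sub>M lborel). expectation (\<lambda>\<omega>. ?\<Psi> (\<omega>, q)))"
  proof -
    have int: "integrable (M \<Otimes>\<^sub>M (lborel \<Otimes>\<^sub>M lborel)) (case_prod (\<lambda>\<omega> q. ?\<Psi> (\<omega>, q)))"
      using windowed_pair_integrable by (simp add: case_prod_beta')
    show ?thesis using time_triple.Fubini_integral[OF int] by simp
  qed
  also have "\<dots> = (LINT q|(lborel \<Otimes>\<^sub>M lborel). indicator {0..1} (fst q) * indicator {0..1} (snd q) * expectation (\<lambda>\<omega>. f (Y (fst q) \<omega>) * f (Y (snd q) \<omega>)))"
    by (intro Bochner_Integration.integral_cong refl) (auto simp: windowed_def indicator_def)
  finally show ?thesis .
qed

lemma time_average_mean: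
  assumes mean: "(LINT x|N. f x) = 0"
  shows "expectation (\<lambda>\<omega>. LINT t:{0..1}|lborel. f (Y t \<omega>)) = 0"
proof -
  have int: "integrable (M \<Otimes>\<^sub>M lborel) (\<lambda>p. windowed (fst p) (snd p))"
  proof (rule integrableI_bounded)
    let ?m = "\<integral>\<^sup>+x. ennreal ((f x)\<^sup>2) \<partial>N"
    let ?F = "\<lambda>\<omega> t. indicator {0..1::real} t * (1 + ennreal ((windowed \<omega> t)\<^sup>2))"
    show "(\<lambda>p. windowed (fst p) (snd p)) \<in> borel_measurable (M \<Otimes>\<^sub>M lborel)" by measurable
    have "(\<integral>\<^sup>+p. ennreal (norm (windowed (fst p) (snd p))) \<partial>(M \<Otimes>\<^sub>M lborel)) \<le> (\<integral>\<^sup>+p. ?F (fst p) (snd p) \<partial>(M \<Otimes>\<^sub>M lborel))"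
    proof (intro nn_integral_mono)
      fix p :: "'w \<times> real"
      have abs_le: "ennreal \<bar>a\<bar> \<le> 1 + ennreal (a\<^sup>2)" for a :: real
      proof -
        have "2 * \<bar>a\<bar> \<le> 1 + a\<^sup>2" using zero_le_power2[where a = "\<bar>a\<bar> - 1"] by (simp add: power2_diff)
        then have "\<bar>a\<bar> \<le> 1 + a\<^sup>2" using abs_ge_zero[where a = a] by linarith
        then have "ennreal \<bar>a\<bar> \<le> ennreal (1 + a\<^sup>2)" by (rule ennreal_leI)
        then show ?thesis by simp
      qed
      show "ennreal (norm (windowed (fst p) (snd p))) \<le> ?F (fst p) (snd p)"
        using abs_le by (cases "snd p \<in> {0..1}") (auto simp: windowed_def)
    qed
    also have "\<dots> = (\<integral>\<^sup>+t. (\<integral>\<^sup>+\<omega>. ?F \<omega> t \<partial>M) \<partial>lborel)"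
      by (subst time_pair.nn_integral_snd[symmetric]) (auto simp: case_prod_beta')
    also have "\<dots> = (\<integral>\<^sup>+t. indicator {0..1::real} t * (1 + ?m) \<partial>lborel)"
    proof (intro nn_integral_cong)
      fix t :: real
      show "(\<integral>\<^sup>+\<omega>. ?F \<omega> t \<partial>M) = indicator {0..1::real} t * (1 + ?m)"
        by (simp add: nn_integral_cmult nn_integral_add windowed_second_moment emeasure_space_1)
          (auto simp: indicator_def)
    qed
    also have "\<dots> = 1 + ?m" by (subst nn_integral_multc) auto
    also have "\<dots> < \<infinity>" using f_second_moment_finite by simp
    finally show "(\<integral>\<^sup>+p. ennreal (norm (windowed (fst p) (snd p))) \<partial>(M \<Otimes>\<^sub>M lborel)) < \<infinity>" .
  qed
  have "expectation (\<lambda>\<omega>. LINT t:{0..1}|lborel. f (Y t \<omega>)) = (LINT t|lborel. expectation (\<lambda>\<omega>. windowed \<omega> t))"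
    unfolding windowed_integral using time_pair.Fubini_integral[of windowed] int by (simp add: case_prod_beta')
  also have "\<dots> = (LINT t|(lborel :: real measure). 0)"
  proof (rule Bochner_Integration.integral_cong[OF refl])
    fix t :: real
    have "expectation (\<lambda>\<omega>. f (Y t \<omega>)) = 0" if "0 \<le> t"
      using mean integral_distr[OF Y_meas[OF that] f_meas] law[OF that] by simp
    then show "expectation (\<lambda>\<omega>. windowed \<omega> t) = 0" by (auto simp: windowed_def indicator_def)
  qed
  finally show ?thesis by simp
qed

end

section \<open>The asymptotic variance\<close>

lemma powr_neg_half_square:
  fixes x :: real
  assumes "0 < x"
  shows "(x powr (- 1 / 2))\<^sup>2 = 1 / x"
proof -
  have "(x powr (- 1 / 2))\<^sup>2 = x powr (- 1 / 2 + - 1 / 2)" unfolding powr_add power2_eq_square ..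
  then show ?thesis using assms by (simp add: powr_minus_divide)
qed

context langevin_potential
begin

context
  fixes M :: "real \<Rightarrow> 'w measure" and B Y :: "real \<Rightarrow> real \<Rightarrow> 'w \<Rightarrow> real^'d" and f :: "real^'d \<Rightarrow> real" and \<rho> :: "real \<Rightarrow> real"
  assumes langevin: "\<And>\<epsilon>. 0 < \<epsilon> \<Longrightarrow> stationary_langevin (M \<epsilon>) V \<epsilon> (B \<epsilon>) (Y \<epsilon>)"
    and f_meas [measurable]: "f \<in> borel_measurable borel" and f_sq: "integrable \<pi> (\<lambda>x. (f x)\<^sup>2)"
    and f_mean: "(LINT x|\<pi>. f x) = 0"
    and cov: "\<And>\<epsilon> s t. 0 < \<epsilon> \<Longrightarrow> 0 \<le> s \<Longrightarrow> 0 \<le> t \<Longrightarrow>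
      (LINT \<omega>|M \<epsilon>. f (Y \<epsilon> (\<epsilon> * s) \<omega>) * f (Y \<epsilon> (\<epsilon> * (s + t)) \<omega>)) = \<rho> t"
begin

lemma observable_integrable:
  assumes eps: "0 < \<epsilon>" and t: "0 \<le> t"
  shows "integrable (M \<epsilon>) (\<lambda>\<omega>. f (Y \<epsilon> t \<omega>))" and "(LINT \<omega>|M \<epsilon>. f (Y \<epsilon> t \<omega>)) = 0"
proof -
  have Y: "Y \<epsilon> t \<in> borel_measurable (M \<epsilon>)" by (rule Y_measurable[OF eps langevin[OF eps] t])
  have law: "distr (M \<epsilon>) borel (Y \<epsilon> t) = \<pi>" by (rule langevin_stationary[OF eps langevin[OF eps] t])
  have fm: "f \<in> borel_measurable \<pi>" using f_meas by (simp add: measurable_cong_sets[OF sets_gibbs refl])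
  have "integrable \<pi> f" using gibbs.square_integrable_imp_integrable[OF fm f_sq] .
  then show "integrable (M \<epsilon>) (\<lambda>\<omega>. f (Y \<epsilon> t \<omega>))"
    using integrable_distr_eq[OF Y f_meas] by (simp add: law)
  show "(LINT \<omega>|M \<epsilon>. f (Y \<epsilon> t \<omega>)) = 0"
    using integral_distr[OF Y f_meas] f_mean by (simp add: law)
qed

lemma observable_covariance:
  assumes eps: "0 < \<epsilon>" and r: "0 \<le> r" and t: "0 \<le> t"
  shows "integrable (M \<epsilon>) (\<lambda>\<omega>. f (Y \<epsilon> r \<omega>) * f (Y \<epsilon> t \<omega>))"
    and "(LINT \<omega>|M \<epsilon>. f (Y \<epsilon> r \<omega>) * f (Y \<epsilon> t \<omega>)) = \<rho> (\<bar>t - r\<bar> / \<epsilon>)"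
proof -
  note Y = Y_measurable[OF eps langevin[OF eps]] and law = langevin_stationary[OF eps langevin[OF eps]]
  show "integrable (M \<epsilon>) (\<lambda>\<omega>. f (Y \<epsilon> r \<omega>) * f (Y \<epsilon> t \<omega>))"
    by (rule product_of_stationary(1)[OF prob_M[OF langevin eps] Y[OF r] Y[OF t] law[OF r] law[OF t] f_meas f_meas f_sq f_sq])
  have ordered: "(LINT \<omega>|M \<epsilon>. f (Y \<epsilon> r \<omega>) * f (Y \<epsilon> t \<omega>)) = \<rho> ((t - r) / \<epsilon>)" if "0 \<le> r" "r \<le> t" for r t
  proof -
    have eq: "\<epsilon> * (r / \<epsilon>) = r" "\<epsilon> * (r / \<epsilon> + (t - r) / \<epsilon>) = t" using eps by (simp_all add: add_divide_distrib[symmetric])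
    show ?thesis using cov[of \<epsilon> "r / \<epsilon>" "(t - r) / \<epsilon>"] eps that by (simp only: eq) simp
  qed
  show "(LINT \<omega>|M \<epsilon>. f (Y \<epsilon> r \<omega>) * f (Y \<epsilon> t \<omega>)) = \<rho> (\<bar>t - r\<bar> / \<epsilon>)"
  proof (cases "r \<le> t")
    case True
    then show ?thesis using ordered[OF r] by simp
  next
    case False
    then show ?thesis using ordered[OF t, of r] by (simp add: mult.commute)
  qed
qed

lemma scaled_variance_sampled:
  assumes eps: "0 < \<epsilon>" and l: "0 < l"
  defines "n \<equiv> nat \<lfloor>1 / (l * \<epsilon>)\<rfloor>"
  shows "scaled_variance M Y f l \<epsilon> = l * (l * \<epsilon> * real n) *
    ((\<Sum>m<n. \<Sum>k\<le>m. (if k = 0 then 1 else 2) * \<rho> (real k * l)) / real n)"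
proof -
  define h where "h = l * \<epsilon>"
  have h: "0 < h" using eps l by (simp add: h_def)
  have ih: "0 \<le> real i * h" for i using h by simp
  define c where "c = \<epsilon> powr (- 1 / 2) * h"
  have avg: "scaled_average (Y \<epsilon>) f l \<epsilon> \<omega> = c * (\<Sum>i<n. f (Y \<epsilon> (real i * h) \<omega>))" for \<omega>
    using l by (simp add: scaled_average_def Let_def h_def n_def c_def)
  have mean: "(LINT \<omega>|M \<epsilon>. scaled_average (Y \<epsilon>) f l \<epsilon> \<omega>) = 0"
    unfolding avg using observable_integrable[OF eps ih] by simp
  have "scaled_variance M Y f l \<epsilon> = (LINT \<omega>|M \<epsilon>. (c * (\<Sum>i<n. f (Y \<epsilon> (real i * h) \<omega>)))\<^sup>2)"
    unfolding scaled_variance_def mean by (simp add: avg)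
  also have "\<dots> = (LINT \<omega>|M \<epsilon>. c\<^sup>2 * (\<Sum>i<n. \<Sum>j<n. f (Y \<epsilon> (real i * h) \<omega>) * f (Y \<epsilon> (real j * h) \<omega>)))"
    by (intro Bochner_Integration.integral_cong refl)
       (simp only: power_mult_distrib power2_eq_square[of "sum _ _"] sum_product)
  also have "\<dots> = c\<^sup>2 * (\<Sum>i<n. \<Sum>j<n. LINT \<omega>|M \<epsilon>. f (Y \<epsilon> (real i * h) \<omega>) * f (Y \<epsilon> (real j * h) \<omega>))"
    using observable_covariance(1)[OF eps ih ih] by simp
  also have "\<dots> = c\<^sup>2 * (\<Sum>i<n. \<Sum>j<n. (\<lambda>k. \<rho> (real k * l)) (if i \<le> j then j - i else i - j))"
  proof (intro arg_cong2[where f = "(*)"] sum.cong refl)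
    fix i j
    have "\<bar>real j * h - real i * h\<bar> / \<epsilon> = real (if i \<le> j then j - i else i - j) * l"
    proof (cases "i \<le> j")
      case True
      then have "real j * h - real i * h = real (j - i) * h" by (simp add: of_nat_diff left_diff_distrib)
      then show ?thesis using True eps l by (simp add: h_def abs_mult)
    next
      case False
      then have "real j * h - real i * h = - (real (i - j) * h)" by (simp add: of_nat_diff left_diff_distrib)
      then show ?thesis using False eps l by (simp add: h_def abs_mult)
    qed
    then show "(LINT \<omega>|M \<epsilon>. f (Y \<epsilon> (real i * h) \<omega>) * f (Y \<epsilon> (real j * h) \<omega>)) = (\<lambda>k. \<rho> (real k * l)) (if i \<le> j then j - i else i - j)"
      using observable_covariance(2)[OF eps ih ih, of i j] by simp
  qed
  also have "\<dots> = c\<^sup>2 * (\<Sum>m<n. \<Sum>k\<le>m. (if k = 0 then 1 else 2) * \<rho> (real k * l))"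
    by (rule arg_cong[OF sum_distance_eq[where \<phi> = "\<lambda>k. \<rho> (real k * l)"]])
  also have "c\<^sup>2 = l * h"
  proof -
    \<comment> \<open>The square of the prefactor is (1 / \<epsilon>) (l \<epsilon>)^2 = l
      h.\<close>
    have "c\<^sup>2 = (\<epsilon> powr (- 1 / 2))\<^sup>2 * h\<^sup>2" unfolding c_def by (rule power_mult_distrib)
    then show ?thesis using eps unfolding powr_neg_half_square[OF eps] by (simp add: h_def power2_eq_square)
  qed
  \<comment> \<open>For n = 0 the sum is empty and the quotient by 0 is 0, so both sides
    vanish.\<close>
  finally show ?thesis by (cases "n = 0") (simp_all add: h_def mult_ac)
qed

lemma scaled_variance_continuous:
  assumes eps: "0 < \<epsilon>" and "decaying_laplace_transform \<rho> \<nu> \<kappa>"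
  shows "scaled_variance M Y f 0 \<epsilon> = decaying_laplace_transform.triangle_mean \<rho> \<epsilon>"
proof -
  interpret decaying_laplace_transform \<rho> \<nu> \<kappa> by fact
  let ?I = "\<lambda>\<omega>. LINT t:{0..1}|lborel. f (Y \<epsilon> t \<omega>)"
  let ?g = "\<lambda>q. indicator {0..1} (fst q) * indicator {0..1} (snd q) * \<rho> (\<bar>snd q - fst q\<bar> / \<epsilon>) :: real"
  have cont: "\<And>\<omega>. \<omega> \<in> space (M \<epsilon>) \<Longrightarrow> continuous_on {0..} (\<lambda>t. Y \<epsilon> t \<omega>)"
    using langevin[OF eps] unfolding stationary_langevin_def by blast
  note path_facts = prob_M[OF langevin eps] sets_gibbs Y_measurable[OF eps langevin[OF eps]] cont
    langevin_stationary[OF eps langevin[OF eps]] f_meas f_sq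
  have mean: "(LINT \<omega>|M \<epsilon>. scaled_average (Y \<epsilon>) f 0 \<epsilon> \<omega>) = 0"
    using time_average_mean[OF path_facts f_mean] by (simp add: scaled_average_def)
  have "scaled_variance M Y f 0 \<epsilon> = (LINT \<omega>|M \<epsilon>. 1 / \<epsilon> * (?I \<omega>)\<^sup>2)"
    unfolding scaled_variance_def mean diff_zero
    by (simp only: scaled_average_def if_True refl power_mult_distrib powr_neg_half_square[OF eps])
  also have "\<dots> = 1 / \<epsilon> * (LINT \<omega>|M \<epsilon>. (?I \<omega>)\<^sup>2)" by simp
  also have "(LINT \<omega>|M \<epsilon>. (?I \<omega>)\<^sup>2) = (LINT q|(lborel \<Otimes>\<^sub>M lborel). ?g q)"
  proof -
    have "(LINT \<omega>|M \<epsilon>. (?I \<omega>)\<^sup>2) = (LINT q|(lborel \<Otimes>\<^sub>M lborel). indicator {0..1} (fst q) * indicator {0..1} (snd q) *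
        (LINT \<omega>|M \<epsilon>. f (Y \<epsilon> (fst q) \<omega>) * f (Y \<epsilon> (snd q) \<omega>)))"
      by (rule time_average_second_moment[OF path_facts])
    also have "\<dots> = (LINT q|(lborel \<Otimes>\<^sub>M lborel). ?g q)"
      by (intro Bochner_Integration.integral_cong refl) (auto simp: indicator_def observable_covariance(2)[OF eps])
    finally show ?thesis .
  qed
  also have "\<dots> = \<epsilon> * triangle_mean \<epsilon>"
  proof -
    have g_meas: "?g \<in> borel_measurable (lborel \<Otimes>\<^sub>M lborel)"
    proof -
      have "(\<lambda>q. \<rho> \<bar>(snd q - fst q) / \<epsilon>\<bar>) \<in> borel_measurable (lborel \<Otimes>\<^sub>M lborel)"
        by (rule measurable_compose[OF _ measurable_C_abs]) measurable
      then have "(\<lambda>q. \<rho> (\<bar>snd q - fst q\<bar> / \<epsilon>)) \<in> borel_measurable (lborel \<Otimes>\<^sub>M lborel)"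
        using eps by simp
      then show ?thesis by measurable
    qed
    have g_nn: "0 \<le> ?g q" for q using eps C_nonneg by (simp add: indicator_def)
    have "(\<integral>\<^sup>+q. ennreal (?g q) \<partial>(lborel \<Otimes>\<^sub>M lborel)) = (\<integral>\<^sup>+s. \<integral>\<^sup>+t. ennreal (?g (s, t)) \<partial>lborel \<partial>lborel)"
      by (rule lborel.nn_integral_fst[symmetric]) (rule measurable_compose[OF g_meas measurable_ennreal])
    also have "\<dots> = ennreal \<epsilon> * ennreal (triangle_mean \<epsilon>)"
      using correlation_triangle[OF eps] triangle_mean_eq[of \<epsilon>] eps by simp
    also have "\<dots> = ennreal (\<epsilon> * triangle_mean \<epsilon>)" using eps by (simp add: ennreal_mult')
    finally have "(\<integral>\<^sup>+q. ennreal (?g q) \<partial>(lborel \<Otimes>\<^sub>M lborel)) = ennreal (\<epsilon> * triangle_mean \<epsilon>)" .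
    moreover have "0 \<le> triangle_mean \<epsilon>"
      unfolding triangle_mean_def using C_nonneg by (intro integral_nonneg_AE) auto
    ultimately show ?thesis
      using eps integral_eq_nn_integral[OF g_meas] g_nn by simp
  qed
  finally show ?thesis using eps by simp
qed

end

end

lemma admissible_langevin_potential:
  fixes U :: "real \<Rightarrow> real^'d::finite \<Rightarrow> real"
  assumes U: "admissible_potential U" and s: "s \<in> {0..1}" and prob: "prob_space (gibbs (U s))"
  shows "\<exists>K L C c. langevin_potential (U s) K L C c"
proof -
  let ?V = "U s"
  note adm = U[unfolded admissible_potential_def]
  obtain L where L: "\<forall>x y. \<forall>t\<in>{0..1}. norm (grad (U t) x - grad (U t) y) \<le> L * norm (x - y)"
    "\<forall>x. \<forall>t\<in>{0..1}. norm (grad (U t) x) \<le> L * (1 + norm x)"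
    using adm by (elim conjE) blast
  obtain K where K: "0 < K" "\<forall>v. \<forall>t\<in>{0..1}. \<forall>x. K * (norm v)\<^sup>2
      \<le> (\<Sum>i\<in>UNIV. \<Sum>j\<in>UNIV. v $ i * pdiff i (pdiff j (U t)) x * v $ j)"
    using adm by (elim conjE) blast
  have C3: "Ck 3 ?V" using adm s by (elim conjE) blast
  obtain C where "\<forall>t\<in>{0..1}. \<forall>x i j k. \<bar>pdiff i (pdiff j (pdiff k (U t))) x\<bar> \<le> C"
    using adm by (elim conjE) blast
  then have C: "\<bar>pdiff i (pdiff j (pdiff k ?V)) x\<bar> \<le> C" for i j k x using s by blast
  have C0: "0 \<le> C" using C[of undefined undefined undefined undefined] abs_ge_zero order_trans by blast
  have "langevin_potential ?V K (max 1 L) (C * real CARD('d) ^ 3) (?V 0 - (norm (grad ?V 0))\<^sup>2 / K)"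
  proof (rule langevin_potential.intro)
    show "prob_space (gibbs ?V)" "0 < K" by fact+
    show "continuous_on UNIV ?V" by (rule Ck_continuous[OF C3])
    show "1 \<le> max 1 L" "0 \<le> C * real CARD('d) ^ 3" using C0 by auto
    show "norm (grad ?V x - grad ?V y) \<le> max 1 L * norm (x - y)" for x y
      by (rule order_trans[OF L(1)[rule_format, OF s]]) (simp add: mult_right_mono)
    show "norm (grad ?V x) \<le> max 1 L * (1 + norm x)" for x
      by (rule order_trans[OF L(2)[rule_format, OF s]]) (simp add: mult_right_mono)
    show "\<bar>?V y - ?V x - (grad ?V x + grad ?V y) \<bullet> (y - x) / 2\<bar> \<le> C * real CARD('d) ^ 3 * norm (y - x) ^ 3" for x y
      by (rule trapezoid_bound[OF C3 C])
    show "K * (norm (y - x))\<^sup>2 \<le> (grad ?V y - grad ?V x) \<bullet> (y - x)" for x y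
      by (rule grad_strongly_monotone[OF C3 K(2)[rule_format, OF s]])
    show "?V 0 - (norm (grad ?V 0))\<^sup>2 / K + K / 4 * (norm x)\<^sup>2 \<le> ?V x" for x
    proof -
      let ?g = "norm (grad ?V 0)"
      have "?V 0 + grad ?V 0 \<bullet> x + K / 2 * (norm x)\<^sup>2 \<le> ?V x"
        using quadratic_lower_bound[OF C3 K(2)[rule_format, OF s], of 0 x] by simp
      moreover have "- (?g * norm x) \<le> grad ?V 0 \<bullet> x"
        using Cauchy_Schwarz_ineq2[of "grad ?V 0" x] by (simp add: abs_le_iff)
      moreover have "?g * norm x \<le> ?g\<^sup>2 / K + K / 4 * (norm x)\<^sup>2"
      proof -
        \<comment> \<open>Completing the square absorbs the linear term into half of the quadratic
          one; this is the origin of K / 4 and of the constant \<open>c\<close>.\<close>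
        have "0 \<le> (?g - K / 2 * norm x)\<^sup>2 / K" using K by simp
        also have "\<dots> = ?g\<^sup>2 / K + K / 4 * (norm x)\<^sup>2 - ?g * norm x"
          using K(1) by (simp add: field_simps power2_eq_square)
        finally show ?thesis by simp
      qed
      moreover have "K / 2 * (norm x)\<^sup>2 = K / 4 * (norm x)\<^sup>2 + K / 4 * (norm x)\<^sup>2" by simp
      ultimately show ?thesis by linarith
    qed
  qed
  then show ?thesis by blast
qed

theorem theorem27:
  fixes U :: "real \<Rightarrow> real^'d::finite \<Rightarrow> real"
    and s :: real
    and f :: "real^'d \<Rightarrow> real"
    and M :: "real \<Rightarrow> 'w measure"
    and B Y :: "real \<Rightarrow> real \<Rightarrow> 'w \<Rightarrow> real^'d"
  assumes "admissible_potential U"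
    and "s \<in> {0..1}"
    and "f \<in> borel_measurable borel"
    and "integrable (gibbs (U s)) (\<lambda>x. (f x)\<^sup>2)"
    and "(LINT x|gibbs (U s). f x) = 0"
    and "\<And>\<epsilon>. \<epsilon> > 0 \<Longrightarrow> stationary_langevin (M \<epsilon>) (U s) \<epsilon> (B \<epsilon>) (Y \<epsilon>)"
  shows "(\<forall>l\<ge>0. (scaled_variance M Y f l \<longlongrightarrow> asymptotic_variance M Y f l) (at_right 0)) \<and>
    (\<exists>\<nu>::real measure. sets \<nu> = sets (restrict_space borel {0..}) \<and>
      (\<forall>l>0. ennreal (asymptotic_variance M Y f l) = ennreal l *
         (\<integral>\<^sup>+x. ennreal (1 + exp (- l * x)) / ennreal (1 - exp (- l * x)) \<partial>\<nu>)) \<and>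
      ennreal (asymptotic_variance M Y f 0) = 2 * (\<integral>\<^sup>+x. inverse (ennreal x) \<partial>\<nu>)) \<and>
    mono_on {0..} (asymptotic_variance M Y f)"
proof -
  have langevin1: "stationary_langevin (M 1) (U s) 1 (B 1) (Y 1)" by (rule assms(6)) simp
  \<comment> \<open>That the normalized density has mass 1 is read off from the law of
    \<open>Y 0\<close>.\<close>
  have "prob_space (gibbs (U s))"
  proof -
    have "prob_space (M 1)" "Y 1 0 \<in> borel_measurable (M 1)" "distr (M 1) borel (Y 1 0) = gibbs (U s)"
      using langevin1 unfolding stationary_langevin_def brownian_motion_def by auto
    then show ?thesis using prob_space.prob_space_distr[of "M 1" "Y 1 0" borel] by simp
  qed
  then obtain K L C c where "langevin_potential (U s) K L C c"
    using admissible_langevin_potential[OF assms(1,2)] by blast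
  then interpret langevin_potential "U s" K L C c .
  obtain \<rho> where psd: "psd_function \<rho>" and cont: "continuous_on {0..} \<rho>"
    and decay: "\<And>t. 0 \<le> t \<Longrightarrow> \<rho> t \<le> \<rho> 0 * exp (- (K / 2) * t)"
    and cov: "\<And>\<epsilon> s t. 0 < \<epsilon> \<Longrightarrow> 0 \<le> s \<Longrightarrow> 0 \<le> t \<Longrightarrow>
      (LINT \<omega>|M \<epsilon>. f (Y \<epsilon> (\<epsilon> * s) \<omega>) * f (Y \<epsilon> (\<epsilon> * (s + t)) \<omega>)) = \<rho> t"
    using langevin_covariance[of M B Y f, OF assms(6) assms(3,4,5)] by blast
  have nonneg: "0 \<le> \<rho> t" if "0 \<le> t" for t by (rule psd_nonneg[OF psd that])
  have lim: "(\<rho> \<longlongrightarrow> 0) at_top"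
  proof (rule tendsto_sandwich)
    show "\<forall>\<^sub>F t in at_top. 0 \<le> \<rho> t"
      using eventually_ge_at_top[of 0] by eventually_elim (rule nonneg)
    show "\<forall>\<^sub>F t in at_top. \<rho> t \<le> \<rho> 0 * exp (- (K / 2) * t)"
      using eventually_ge_at_top[of 0] by eventually_elim (rule decay)
    have "LIM t at_top. K / 2 * t :> at_top"
      using K_pos by (intro filterlim_tendsto_pos_mult_at_top[OF tendsto_const _ filterlim_ident]) simp
    then have "LIM t at_top. - (K / 2 * t) :> at_bot" by (simp add: filterlim_uminus_at_bot)
    from tendsto_mult[OF tendsto_const filterlim_compose[OF exp_at_bot this], of "\<rho> 0"]
    show "((\<lambda>t. \<rho> 0 * exp (- (K / 2) * t)) \<longlongrightarrow> 0) at_top" by simp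
  qed simp
  have bounded: "\<bar>\<rho> t\<bar> \<le> \<rho> 0" if "0 \<le> t" for t
  proof -
    have "\<rho> 0 * exp (- (K / 2) * t) \<le> \<rho> 0 * 1" using nonneg[of 0] K_pos that by (intro mult_left_mono) auto
    then show ?thesis using decay[OF that] nonneg[OF that] by simp
  qed
  have "\<exists>\<nu>::real measure. finite_measure \<nu> \<and> sets \<nu> = sets borel \<and> (AE x in \<nu>. 0 < x) \<and>
      (\<forall>t\<ge>0. \<rho> t = (LINT x|\<nu>. exp (- t * x)))"
    by (rule psd_laplace_representation[OF psd _ cont lim]) (rule bounded)
  then obtain \<nu> :: "real measure" where
    \<nu>: "finite_measure \<nu>" "sets \<nu> = sets borel" "AE x in \<nu>. 0 < x" "\<forall>t\<ge>0. \<rho> t = (LINT x|\<nu>. exp (- t * x))"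
    by (elim exE conjE)
  have "decaying_laplace_transform \<rho> \<nu> (K / 2)"
  proof (rule decaying_laplace_transform.intro)
    show "\<rho> t = (LINT x|\<nu>. exp (- t * x))" if "0 \<le> t" for t using \<nu>(4) that by blast
    show "\<rho> t \<le> \<rho> 0 * exp (- (K / 2) * t)" if "0 \<le> t" for t using that by (rule decay)
    show "0 < K / 2" using K_pos by simp
  qed fact+
  then interpret D: decaying_laplace_transform \<rho> \<nu> "K / 2" .
  have pos: "\<forall>\<^sub>F \<epsilon> in at_right 0. (0::real) < \<epsilon>" by (rule eventually_at_right_less)
  \<comment> \<open>The limits in closed form; that \<open>asymptotic_variance\<close> equals them
    follows only after convergence is established.\<close>
  define A where "A l = (if l = 0 then LINT u|lborel. \<rho> \<bar>u\<bar> else l * (\<Sum>k. D.sample_term l k))" for l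
  have limit: "(scaled_variance M Y f l \<longlongrightarrow> A l) (at_right 0)" if l: "0 \<le> l" for l
  proof (cases "l = 0")
    case True
    have "\<forall>\<^sub>F \<epsilon> in at_right 0. D.triangle_mean \<epsilon> = scaled_variance M Y f 0 \<epsilon>"
      using pos
    proof eventually_elim
      case (elim \<epsilon>)
      show ?case
        by (rule scaled_variance_continuous[OF assms(6) assms(3,4,5) cov elim D.decaying_laplace_transform_axioms, symmetric])
    qed
    from Lim_transform_eventually[OF D.triangle_mean_limit this] True show ?thesis by (simp add: A_def)
  next
    case False
    with l have l: "0 < l" by simp
    have "\<forall>\<^sub>F \<epsilon> in at_right 0. l * (l * \<epsilon> * real (nat \<lfloor>1 / (l * \<epsilon>)\<rfloor>)) *
      ((\<Sum>m<nat \<lfloor>1 / (l * \<epsilon>)\<rfloor>. \<Sum>k\<le>m. D.sample_term l k) / real (nat \<lfloor>1 / (l * \<epsilon>)\<rfloor>)) = scaled_variance M Y f l \<epsilon>"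
      using pos
    proof eventually_elim
      case (elim \<epsilon>)
      show ?case
        unfolding D.sample_term_def
        by (rule scaled_variance_sampled[OF assms(6) assms(3,4,5) cov elim l, symmetric])
    qed
    from Lim_transform_eventually[OF D.sampled_variance_limit[OF l] this] l show ?thesis by (simp add: A_def)
  qed
  have asym: "asymptotic_variance M Y f l = A l" if "0 \<le> l" for l
    unfolding asymptotic_variance_def by (rule tendsto_Lim[OF _ limit[OF that]]) simp
  let ?S = "\<lambda>l. ennreal l * (\<integral>\<^sup>+x. ennreal (1 + exp (- l * x)) / ennreal (1 - exp (- l * x)) \<partial>\<nu>)"
  have sample_nonneg: "0 \<le> (\<Sum>k. D.sample_term l k)" if "0 < l" for l
    using D.summable_sample_term[OF that] D.sample_term_nonneg[OF that] by (rule suminf_nonneg)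
  have A_pos: "ennreal (A l) = ?S l" if "0 < l" for l
    using that sample_nonneg[OF that] D.sampled_variance_repr[OF that] by (simp add: A_def ennreal_mult)
  have A_0: "ennreal (A 0) = 2 * (\<integral>\<^sup>+x. inverse (ennreal x) \<partial>\<nu>)"
    using D.continuous_variance_repr by (simp add: A_def)
  have A_nonneg: "0 \<le> A l" if "0 \<le> l" for l
    using that sample_nonneg[of l] D.C_nonneg by (auto simp: A_def intro!: integral_nonneg_AE mult_nonneg_nonneg)
  have mono: "A l \<le> A l'" if "0 \<le> l" "l \<le> l'" for l l'
  proof -
    \<comment> \<open>The comparison takes place in the extended reals, where the representations
      live; nonnegativity of \<open>A\<close> carries it back.\<close>
    have "ennreal (A l) \<le> ennreal (A l')"
    proof (cases "l = 0")
      case True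
      then show ?thesis
        using D.continuous_variance_le_sampled[of l'] A_pos[of l'] A_0 that by (cases "l' = 0") auto
    next
      case False
      then show ?thesis using D.sampled_variance_mono[of l l'] A_pos that by simp
    qed
    then show ?thesis using A_nonneg[of l'] that by (simp add: ennreal_le_iff)
  qed
  \<comment> \<open>\<open>\<nu>\<close> is concentrated on the positive reals, so restricting it to
    [0, infinity) changes no integral.\<close>
  have restrict: "(\<integral>\<^sup>+x. g x \<partial>restrict_space \<nu> {0..}) = (\<integral>\<^sup>+x. g x \<partial>\<nu>)" for g
  proof -
    have "(\<integral>\<^sup>+x. g x \<partial>restrict_space \<nu> {0..}) = (\<integral>\<^sup>+x. g x * indicator {0..} x \<partial>\<nu>)"
      by (rule nn_integral_restrict_space) (simp add: \<nu>(2) sets_eq_imp_space_eq[OF \<nu>(2)])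
    also have "\<dots> = (\<integral>\<^sup>+x. g x \<partial>\<nu>)"
      by (rule nn_integral_cong_AE, use \<nu>(3) in eventually_elim) simp
    finally show ?thesis .
  qed
  show ?thesis
  proof (intro conjI exI[of _ "restrict_space \<nu> {0..}"])
    show "\<forall>l\<ge>0. (scaled_variance M Y f l \<longlongrightarrow> asymptotic_variance M Y f l) (at_right 0)"
      using limit asym by simp
    show "sets (restrict_space \<nu> {0..}) = sets (restrict_space borel {0..})"
      by (rule sets_restrict_space_cong[OF \<nu>(2)])
    show "\<forall>l>0. ennreal (asymptotic_variance M Y f l) = ennreal l *
         (\<integral>\<^sup>+x. ennreal (1 + exp (- l * x)) / ennreal (1 - exp (- l * x)) \<partial>restrict_space \<nu> {0..})"
      unfolding restrict using asym A_pos by (simp add: less_imp_le)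
    show "ennreal (asymptotic_variance M Y f 0) = 2 * (\<integral>\<^sup>+x. inverse (ennreal x) \<partial>restrict_space \<nu> {0..})"
      unfolding restrict using asym A_0 by simp
    show "mono_on {0..} (asymptotic_variance M Y f)"
      using asym mono by (intro mono_onI) auto
  qed
qed

end
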